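(* Let $\Gamma$ be a strongly projectively convex cocompact subgroup of $\mathrm{SL}(n,\mathbb{R})$, and let $\xi^{sym}=(\xi,\xi^* ):\partial_\infty\Gamma\to \mathbf{P}(\mathbb{R}^n)\times\mathbf{P}({\mathbb{R}^n}^* )$ be its symmetric boundary map. Then \[2\,\delta_{1,n}(\Gamma)\;\leq\;\dim_H\big(\xi^{sym}(\partial_\infty\Gamma)\big)\;\leq\;\delta_{1,2}(\Gamma).\]
   Context: For $g\in\mathrm{SL}(n,\mathbb{R})$, $\mu_i(g)$ denotes the logarithm of the $i$-th eigenvalue (in decreasing order) of $\sqrt{gg^T}$. For a discrete subgroup $\Gamma$, $\delta_{1,2}(\Gamma)=\limsup_{R\to\infty}\frac1R\log\#\{\gamma\in\Gamma:\mu_1(\gamma)-\mu_2(\gamma)\le R\}$ and $\delta_{1,n}(\Gamma)=\limsup_{R\to\infty}\frac1R\log\#\{\gamma\in\Gamma:\mu_1(\gamma)-\mu_n(\gamma)\le R\}$. A properly convex open domain $\Omega\subset\mathbf{P}(\mathbb{R}^n)$ is a convex open set bounded in some affine chart; it carries the Hilbert distance $d_H(x,y)=\frac12\log\frac{xb\cdot ay}{ax\cdot yb}$, where $a,b$ are the points where the line through $x,y$ meets $\partial\Omega$ (with $a$ on the side of $x$). A discrete subgroup $\Gamma\subset\mathrm{SL}(n,\mathbb{R})$ is strongly projectively convex cocompact if it preserves a properly convex open domain $\Omega$ such that $(\Omega,d_H)$ is Gromov hyperbolic, and acts properly discontinuously and cocompactly on some non-empty $\Gamma$-invariant convex subset $C\subset\Omega$.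 Such a $\Gamma$ is Gromov hyperbolic and projective Anosov; its boundary maps $\xi:\partial_\infty\Gamma\to\mathbf{P}(\mathbb{R}^n)$ and $\xi^*:\partial_\infty\Gamma\to\mathbf{P}({\mathbb{R}^n}^* )$ are the continuous $\Gamma$-equivariant maps such that $\xi$ is a homeomorphism onto $\overline{C}\cap\partial\Omega$ and $\xi^*(x)$ is the hyperplane tangent to $\partial\Omega$ at $\xi(x)$. The Hausdorff dimension $\dim_H$ of a compact subset of a smooth manifold is computed with respect to (the distance induced by) any Riemannian metric; it does not depend on this choice. *)

theory Defs
  imports "HOL-Analysis.Analysis" "HOL-Computational_Algebra.Polynomial" "HOL-Library.Multiset"
begin

definition charpoly :: "real^'n^'n \<Rightarrow> real poly" where
  "charpoly A = det (\<chi> i j. (if i = j then [:0, 1:] else 0) - [:A $ i $ j:])"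

definition ggT_eigs :: "real^'n^'n \<Rightarrow> real list" where
  "ggT_eigs g = rev (sorted_list_of_multiset (proots (charpoly (g ** transpose g))))"

text \<open>mu i g = log of the i-th eigenvalue (decreasing, i = 1..n) of sqrt(g g^T);
  the eigenvalues of sqrt(g g^T) are the square roots of those of g g^T.\<close>
definition mu :: "nat \<Rightarrow> real^'n^'n \<Rightarrow> real" where
  "mu i g = ln (sqrt (ggT_eigs g ! (i - 1)))"

definition crit_exp :: "(real^'n^'n) set \<Rightarrow> (real^'n^'n \<Rightarrow> real) \<Rightarrow> ereal" where
  "crit_exp \<Gamma> f = Limsup at_top (\<lambda>R::real.
      if finite {g \<in> \<Gamma>. f g \<le> R}
      then ereal (ln (real (card {g \<in> \<Gamma>. f g \<le> R})) / R) else \<infinity>)"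

definition delta12 :: "(real^'n^'n) set \<Rightarrow> ereal" where
  "delta12 \<Gamma> = crit_exp \<Gamma> (\<lambda>g. mu 1 g - mu 2 g)"

definition delta1n :: "(real^'n^'n) set \<Rightarrow> ereal" where
  "delta1n \<Gamma> = crit_exp \<Gamma> (\<lambda>g::real^'n^'n. mu 1 g - mu CARD('n) g)"

definition ediam :: "('a \<Rightarrow> 'a \<Rightarrow> real) \<Rightarrow> 'a set \<Rightarrow> ereal" where
  "ediam d A = (SUP p \<in> A \<times> A. ereal (d (fst p) (snd p)))"

definition hausdorff_content :: "('a \<Rightarrow> 'a \<Rightarrow> real) \<Rightarrow> real \<Rightarrow> real \<Rightarrow> 'a set \<Rightarrow> ennreal" where
  "hausdorff_content d s \<epsilon> A =
     (INF U \<in> {U :: nat \<Rightarrow> 'a set. A \<subseteq> (\<Union>i. U i) \<and> (\<forall>i. ediam d (U i) \<le> ereal \<epsilon>)}.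
        (\<Sum>i. if U i = {} then 0 else ennreal (real_of_ereal (ediam d (U i)) powr s)))"

definition hausdorff_measure :: "('a \<Rightarrow> 'a \<Rightarrow> real) \<Rightarrow> real \<Rightarrow> 'a set \<Rightarrow> ennreal" where
  "hausdorff_measure d s A = (SUP \<epsilon> \<in> {0<..}. hausdorff_content d s \<epsilon> A)"

definition hausdorff_dim :: "('a \<Rightarrow> 'a \<Rightarrow> real) \<Rightarrow> 'a set \<Rightarrow> ereal" where
  "hausdorff_dim d A = (INF s \<in> {s::real. 0 < s \<and> hausdorff_measure d s A = 0}. ereal s)"

text \<open>Distance on P(R^n), points represented by nonzero vectors: chordal distance of the
  antipodal pair of unit representatives (bi-Lipschitz to the round Riemannian metric).\<close>
definition pdist :: "real^'n \<Rightarrow> real^'n \<Rightarrow> real" where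
  "pdist u v = min (norm (u /\<^sub>R norm u - v /\<^sub>R norm v)) (norm (u /\<^sub>R norm u + v /\<^sub>R norm v))"

text \<open>Distance on P(R^n) x P(R^n*); a functional is represented by its vector via the inner product.\<close>
definition pdist2 :: "((real^'n) \<times> (real^'n)) \<Rightarrow> ((real^'n) \<times> (real^'n)) \<Rightarrow> real" where
  "pdist2 p q = max (pdist (fst p) (fst q)) (pdist (snd p) (snd q))"

text \<open>Projective action of g in the affine chart {v. w \<bullet> v = 1}.\<close>
definition pact :: "real^'n \<Rightarrow> real^'n^'n \<Rightarrow> real^'n \<Rightarrow> real^'n" where
  "pact w g u = (1 / (w \<bullet> (g *v u))) *\<^sub>R (g *v u)"

definition properly_convex_chart :: "real^'n \<Rightarrow> (real^'n) set \<Rightarrow> bool" where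
  "properly_convex_chart w U \<longleftrightarrow> U \<noteq> {} \<and> U \<subseteq> {v. w \<bullet> v = 1} \<and> convex U \<and> bounded U
     \<and> openin (top_of_set {v. w \<bullet> v = 1}) U"

definition hilbert_dist :: "(real^'n) set \<Rightarrow> real^'n \<Rightarrow> real^'n \<Rightarrow> real" where
  "hilbert_dist U x y =
     (if x = y then 0 else
      (let a = x + (Sup {s. 0 \<le> s \<and> x + s *\<^sub>R (x - y) \<in> U}) *\<^sub>R (x - y);
           b = y + (Sup {t. 0 \<le> t \<and> y + t *\<^sub>R (y - x) \<in> U}) *\<^sub>R (y - x)
       in ln ((dist x b * dist a y) / (dist a x * dist y b)) / 2))"

definition gromov_product :: "('a \<Rightarrow> 'a \<Rightarrow> real) \<Rightarrow> 'a \<Rightarrow> 'a \<Rightarrow> 'a \<Rightarrow> real" where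
  "gromov_product d w x y = (d w x + d w y - d x y) / 2"

definition gromov_hyperbolic_on :: "'a set \<Rightarrow> ('a \<Rightarrow> 'a \<Rightarrow> real) \<Rightarrow> bool" where
  "gromov_hyperbolic_on X d \<longleftrightarrow> (\<exists>\<delta>\<ge>0. \<forall>w\<in>X. \<forall>x\<in>X. \<forall>y\<in>X. \<forall>z\<in>X.
      gromov_product d w x z \<ge> min (gromov_product d w x y) (gromov_product d w y z) - \<delta>)"

definition discrete_subgroup_SL :: "(real^'n^'n) set \<Rightarrow> bool" where
  "discrete_subgroup_SL \<Gamma> \<longleftrightarrow> mat 1 \<in> \<Gamma> \<and> (\<forall>g\<in>\<Gamma>. det g = 1)
     \<and> (\<forall>g\<in>\<Gamma>. \<forall>h\<in>\<Gamma>. g ** h \<in> \<Gamma>) \<and> (\<forall>g\<in>\<Gamma>. matrix_inv g \<in> \<Gamma>)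
     \<and> (\<forall>g\<in>\<Gamma>. \<exists>e>0. \<forall>h\<in>\<Gamma>. dist h g < e \<longrightarrow> h = g)"

definition spcc_data :: "(real^'n^'n) set \<Rightarrow> real^'n \<Rightarrow> (real^'n) set \<Rightarrow> (real^'n) set \<Rightarrow> bool" where
  "spcc_data \<Gamma> w U C \<longleftrightarrow>
     properly_convex_chart w U
     \<and> (\<forall>g\<in>\<Gamma>. (\<forall>u\<in>U. w \<bullet> (g *v u) \<noteq> 0) \<and> pact w g ` U = U)
     \<and> gromov_hyperbolic_on U (hilbert_dist U)
     \<and> C \<noteq> {} \<and> C \<subseteq> U \<and> convex C \<and> (\<forall>g\<in>\<Gamma>. pact w g ` C = C)
     \<and> (\<forall>K. compact K \<and> K \<subseteq> C \<longrightarrow> finite {g\<in>\<Gamma>. pact w g ` K \<inter> K \<noteq> {}})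
     \<and> (\<exists>K. compact K \<and> K \<subseteq> C \<and> C \<subseteq> (\<Union>g\<in>\<Gamma>. pact w g ` K))"

definition strongly_proj_convex_cocompact :: "(real^'n^'n) set \<Rightarrow> bool" where
  "strongly_proj_convex_cocompact \<Gamma> \<longleftrightarrow> discrete_subgroup_SL \<Gamma> \<and> (\<exists>w U C. spcc_data \<Gamma> w U C)"

text \<open>Image of the symmetric boundary map: pairs (\<xi>(x), \<xi>*(x)) where \<xi>(x) ranges over
  closure C \<inter> \<partial>\<Omega> and \<xi>*(x) is the hyperplane tangent to \<partial>\<Omega> at \<xi>(x), given by a
  nonzero functional vanishing at \<xi>(x) and positive on \<Omega>.\<close>
definition sym_boundary_image :: "(real^'n) set \<Rightarrow> (real^'n) set \<Rightarrow> ((real^'n) \<times> (real^'n)) set" where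
  "sym_boundary_image U C = {(x, \<phi>) | x \<phi>. x \<in> closure C - U \<and> \<phi> \<noteq> 0 \<and> \<phi> \<bullet> x = 0
      \<and> (\<forall>u\<in>U. 0 < \<phi> \<bullet> u)}"

end

theory Submission
  imports Defs
begin

text \<open>
  Everything is read off from the open cone \<open>T\<close> over \<open>U\<close>: a map \<open>h\<close> preserving \<open>T\<close> satisfies
  \<open>w \<bullet> (h q) \<ge> c \<parallel>h\<parallel>\<close> for \<open>q\<close> in a compact subset of \<open>U\<close>, and similarly for positive functionals.

  Upper bound. If the segment from the base point \<open>p\<close> to a limit point \<open>x\<close> meets \<open>g K\<close>, then \<open>x\<close> and
  its tangent functional are images under \<open>g\<close> of directions that \<open>g\<close> almost maximally expands, so
  that the set of all such tangent pairs has diameter at most a constant times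
  \<open>exp (- (\<mu>\<^sub>1 - \<mu>\<^sub>2) (g)) + exp (- (\<mu>\<^sub>1 - \<mu>\<^sub>2) (g\<^sup>-\<^sup>1))\<close>. Every limit point lies in infinitely many of
  these sets, and the series of the \<open>s\<close>-th powers converges for \<open>s > \<delta>\<^sub>1\<^sub>2\<close>.

  Lower bound. Two tangent pairs at distance \<open>r\<close> satisfy \<open>\<phi> \<bullet> y + \<psi> \<bullet> x = (\<phi> - \<psi>) \<bullet> (y - x) = O(r\<^sup>2)\<close>, hence
  the segment from \<open>x\<close> to \<open>y\<close> is at Hilbert distance at least \<open>ln (1 / r) - O(1)\<close> from \<open>p\<close>. By Gromov
  hyperbolicity a cover by sets of diameters \<open>r\<^sub>i\<close> is thus dominated by the shadows of group elements
  \<open>a\<^sub>i\<close> with \<open>exp (- (\<mu>\<^sub>1 - \<mu>\<^sub>n) (a\<^sub>i) / 2) = O(r\<^sub>i)\<close>. All but finitely many \<open>g\<close> lie in such a shadow, where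
  \<open>\<mu>\<^sub>1 - \<mu>\<^sub>n\<close> of \<open>g\<close> is the sum of its values at \<open>a\<^sub>i\<close> and at \<open>a\<^sub>i\<^sup>-\<^sup>1 g\<close> up to a constant. If \<open>\<Sum> r\<^sub>i\<^sup>s\<close> is small, the
  Poincare series at \<open>s / 2\<close> is therefore at most a finite sum plus half of itself, so it converges
  and \<open>\<delta>\<^sub>1\<^sub>n \<le> s / 2\<close>. This self-improvement replaces Patterson--Sullivan measures.
\<close>

section \<open>Spectral theorem and characteristic polynomials\<close>

text \<open>The factor 2 of the lower bound is a quadratic effect. For a limit point x, the point (1
  - t) x + t p is at Hilbert distance (1/2) ln (1 / t) + O(1) from p, and two tangent pairs at
  distance r determine the parameter t = r^2, that is the depth ln (1 / r). Closeness of x and y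
  alone would only give \<phi> . y = O(r); the simultaneous closeness of \<phi> and \<psi> yields
  the square. As exp (2 d_H(p, g p)) is comparable to exp (mu_1 - mu_n)(g), a sum of r^s matches the
  Poincare series at s / 2. An inequality "S is at most a constant plus S / 2" says nothing about an
  infinite S. The self-improvement is therefore run on finite sets of group elements that are closed
  under decreasing \<open>cond_number\<close>. The radii are taken so small that a_i^-1 g never has
  a larger condition number than g, so each truncated sum reproduces itself, with a bound
  independent of the truncation. In the upper bound the gap of g^-1 appears because functionals are
  moved by the inverse transpose; inversion permutes the group, so both series converge
  together.\<close>

lemma symmetric_matrix_dot:
  fixes A :: "real^'n^'n"
  assumes "transpose A = A"
  shows "(A *v x) \<bullet> y = x \<bullet> (A *v y)"
  using assms dot_lmul_matrix[of x A y] by (metis transpose_matrix_vector)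

text \<open>Rayleigh quotient: moving from a maximizer of v . A v on the unit sphere of
  \<open>S\<close> along the residual \<open>e\<close> changes the quotient to first order by a
  multiple of |e|^2, so maximality forces \<open>e = 0\<close>.\<close>

lemma symmetric_matrix_eigenvector:
  fixes A :: "real^'n^'n"
  assumes sym: "transpose A = A" and S: "subspace S" and "S \<noteq> {0}"
    and inv: "\<And>v. v \<in> S \<Longrightarrow> A *v v \<in> S"
  obtains v c where "v \<in> S" "norm v = 1" "A *v v = c *\<^sub>R v"
proof -
  let ?K = "S \<inter> sphere 0 1"
  let ?q = "\<lambda>v. v \<bullet> (A *v v)"
  have "compact ?K"
    by (intro closed_Int_compact closed_subspace S compact_sphere)
  moreover have "?K \<noteq> {}"
  proof -
    obtain v where "v \<in> S" "v \<noteq> 0" using assms(3) S subspace_0 by blast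
    then have "v /\<^sub>R norm v \<in> ?K" using S by (auto simp: subspace_scale)
    then show ?thesis by blast
  qed
  moreover have "continuous_on ?K ?q"
    by (intro continuous_on_inner continuous_on_id linear_continuous_on matrix_vector_mul_bounded_linear)
  ultimately obtain v where v: "v \<in> ?K" and max: "\<And>u. u \<in> ?K \<Longrightarrow> ?q u \<le> ?q v"
    using continuous_attains_sup[of ?K ?q] by blast
  define c where "c = ?q v"
  have v1: "v \<in> S" "norm v = 1" "v \<bullet> v = 1" using v by (auto simp: dot_square_norm)
  have bound: "?q u \<le> c * (u \<bullet> u)" if "u \<in> S" for u
  proof (cases "u = 0")
    case False
    have "u /\<^sub>R norm u \<in> ?K" using that S False by (auto simp: subspace_scale)
    from max[OF this] have "?q u / (norm u * norm u) \<le> c"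
      by (simp add: c_def matrix_vector_mult_scaleR divide_inverse mult_ac)
    then show ?thesis using False by (simp add: divide_le_eq dot_square_norm power2_eq_square)
  qed simp
  define e where "e = A *v v - c *\<^sub>R v"
  have eS: "e \<in> S" unfolding e_def using v1 inv S by (simp add: subspace_diff subspace_scale)
  define k where "k = c * (e \<bullet> e) - ?q e"
  have *: "2 * (e \<bullet> e) \<le> t * k" if "t > 0" for t
  proof -
    have "v + t *\<^sub>R e \<in> S" using v1 eS S by (simp add: subspace_add subspace_scale)
    from bound[OF this]
    have "?q v + 2 * t * (e \<bullet> (A *v v)) + t\<^sup>2 * ?q e \<le> c * (1 + 2 * t * (e \<bullet> v) + t\<^sup>2 * (e \<bullet> e))"
      using v1 symmetric_matrix_dot[OF sym, of v e]
      by (simp add: matrix_vector_right_distrib matrix_vector_mult_scaleR inner_add inner_commute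
          algebra_simps power2_eq_square)
    then have "2 * t * (e \<bullet> (A *v v) - c * (e \<bullet> v)) \<le> t * (t * k)"
      unfolding k_def c_def by (simp add: algebra_simps power2_eq_square)
    moreover have "e \<bullet> (A *v v) - c * (e \<bullet> v) = e \<bullet> e"
      by (metis e_def inner_diff_right inner_scaleR_right)
    ultimately show ?thesis using that by simp
  qed
  have "e \<bullet> e \<le> 0"
  proof (rule ccontr)
    assume "\<not> e \<bullet> e \<le> 0"
    then have pos: "e \<bullet> e > 0" by linarith
    have "2 * (e \<bullet> e) \<le> k" using *[of 1] by simp
    with pos have k: "k > 0" by linarith
    have "2 * (e \<bullet> e) \<le> e \<bullet> e"
      using *[of "(e \<bullet> e) / k"] pos k by (simp del: inner_gt_zero_iff)
    with pos show False by linarith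
  qed
  then have "e \<bullet> e = 0" using inner_ge_zero[of e] by linarith
  then have "e = 0" by simp
  then have "A *v v = c *\<^sub>R v" by (simp add: e_def)
  then show ?thesis using that v1 by blast
qed

text \<open>Take an orthonormal set of eigenvectors of maximal cardinality. By symmetry of
  \<open>A\<close> its orthogonal complement is invariant, so a nonzero complement would contribute
  one more eigenvector.\<close>

lemma symmetric_matrix_eigenbasis:
  fixes A :: "real^'n^'n"
  assumes sym: "transpose A = A"
  obtains u :: "'n \<Rightarrow> real^'n" and d :: "'n \<Rightarrow> real"
  where "\<And>i j. u i \<bullet> u j = (if i = j then 1 else 0)" "\<And>i. A *v u i = d i *\<^sub>R u i"
proof -
  define good where "good B \<longleftrightarrow> pairwise orthogonal B \<and> (\<forall>b\<in>B. norm b = 1 \<and> (\<exists>c. A *v b = c *\<^sub>R b))"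
    for B :: "(real^'n) set"
  have indep: "independent B" if "good B" for B
    using that pairwise_orthogonal_independent[of B] by (force simp: good_def)
  have "good {}" by (simp add: good_def)
  moreover have "\<forall>B. good B \<longrightarrow> card B < Suc CARD('n)"
    using indep independent_card_le by (fastforce simp: less_Suc_eq_le)
  ultimately obtain B where B: "good B" and max: "\<And>B'. good B' \<Longrightarrow> card B' \<le> card B"
    using ex_has_greatest_nat[of good "{}" card "Suc CARD('n)"] by blast
  have finB: "finite B" using indep[OF B] independent_imp_finite by blast
  have span: "span B = UNIV"
  proof (rule ccontr)
    assume neq: "span B \<noteq> UNIV"
    define S where "S = {v. \<forall>b\<in>B. b \<bullet> v = 0}"
    have "subspace S" by (auto simp: S_def subspace_def inner_add)
    moreover have "S \<noteq> {0}"
    proof -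
      have "dim B < DIM(real^'n)" using neq dim_eq_full[of B] dim_subset_UNIV[of B] by simp
      then obtain x where "x \<noteq> 0" "\<And>y. y \<in> span B \<Longrightarrow> orthogonal x y"
        using orthogonal_to_subspace_exists by blast
      then have "x \<in> S" by (auto simp: S_def orthogonal_def inner_commute span_base)
      with \<open>x \<noteq> 0\<close> show ?thesis by blast
    qed
    moreover have "A *v v \<in> S" if "v \<in> S" for v
      unfolding S_def
    proof safe
      fix b assume b: "b \<in> B"
      then obtain c where "A *v b = c *\<^sub>R b" using B by (auto simp: good_def)
      then have "b \<bullet> (A *v v) = c * (b \<bullet> v)"
        using symmetric_matrix_dot[OF sym, of b v] by simp
      then show "b \<bullet> (A *v v) = 0" using that b by (simp add: S_def)
    qed
    ultimately obtain v c where v: "v \<in> S" "norm v = 1" "A *v v = c *\<^sub>R v"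
      using symmetric_matrix_eigenvector[OF sym] by blast
    have "v \<notin> B" using v by (auto simp: S_def)
    moreover have "good (insert v B)"
      using B v by (auto simp: good_def pairwise_insert S_def orthogonal_def inner_commute)
    ultimately show False using max[of "insert v B"] finB by simp
  qed
  have "card B = CARD('n)"
    using span indep[OF B] dim_eq_card_independent[of B] by (metis dim_UNIV dim_span DIM_cart DIM_real mult.right_neutral)
  then obtain u where u: "bij_betw u (UNIV :: 'n set) B"
    using finite_same_card_bij[OF _ finB] by (metis finite_class.finite_UNIV)
  have "\<forall>i. \<exists>c. A *v u i = c *\<^sub>R u i"
    using u B by (auto simp: good_def bij_betw_def)
  then obtain d where "\<And>i. A *v u i = d i *\<^sub>R u i" by metis
  moreover have "u i \<bullet> u j = (if i = j then 1 else 0)" for i j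
  proof -
    have "u i \<in> B" "u j \<in> B" "u i = u j \<longleftrightarrow> i = j"
      using u by (auto simp: bij_betw_def inj_on_def)
    then show ?thesis using B by (auto simp: good_def pairwise_def orthogonal_def dot_square_norm)
  qed
  ultimately show ?thesis using that by blast
qed

text \<open>The rows \<open>u i\<close> form a square matrix with Q Q^T = 1. One-sided inverses of
  square matrices are two-sided, and Q^T Q = 1 is the completeness of the family.\<close>

lemma orthonormal_family_expansion:
  fixes u :: "'n \<Rightarrow> real^'n"
  assumes on: "\<And>i j. u i \<bullet> u j = (if i = j then 1 else 0)"
  shows "(\<Sum>i\<in>UNIV. (x \<bullet> u i) *\<^sub>R u i) = x" and "x \<bullet> y = (\<Sum>i\<in>UNIV. (x \<bullet> u i) * (y \<bullet> u i))"
proof -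
  define Q :: "real^'n^'n" where "Q = (\<chi> i. u i)"
  have "Q ** transpose Q = mat 1"
    using on by (simp add: Q_def vec_eq_iff matrix_matrix_mult_def transpose_def mat_def inner_vec_def)
  then have QQ: "transpose Q ** Q = mat 1" by (simp add: matrix_left_right_inverse)
  have "(\<Sum>i\<in>UNIV. (x \<bullet> u i) *\<^sub>R u i) = transpose Q *v (Q *v x)" for x
    by (simp add: Q_def vec_eq_iff matrix_vector_mult_def transpose_def inner_vec_def mult.commute)
  then show *: "(\<Sum>i\<in>UNIV. (x \<bullet> u i) *\<^sub>R u i) = x" for x
    using QQ by (simp add: matrix_vector_mul_assoc)
  have "y \<bullet> x = y \<bullet> (\<Sum>i\<in>UNIV. (x \<bullet> u i) *\<^sub>R u i)" by (simp add: *)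
  also have "\<dots> = (\<Sum>i\<in>UNIV. (x \<bullet> u i) * (y \<bullet> u i))"
    by (simp add: inner_sum_right)
  finally show "x \<bullet> y = (\<Sum>i\<in>UNIV. (x \<bullet> u i) * (y \<bullet> u i))"
    by (simp add: inner_commute)
qed

text \<open>Embeds real matrices multiplicatively into matrices over R[X], where the determinant
  behind \<open>charpoly\<close> lives, so that similarities carry over.\<close>

definition const_poly_matrix :: "real^'n^'n \<Rightarrow> real poly^'n^'n" where
  "const_poly_matrix A = (\<chi> i j. [:A $ i $ j:])"

lemma const_poly_matrix_mult:
  fixes A B :: "real^'n^'n"
  shows "const_poly_matrix (A ** B) = const_poly_matrix A ** const_poly_matrix B"
proof -
  have const_add: "[:a + b:] = [:a:] + [:b:]" for a b :: real by simp
  have "[:\<Sum>k\<in>S. f k:] = (\<Sum>k\<in>S. [:f k:])" for S and f :: "'n \<Rightarrow> real"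
    by (induction S rule: infinite_finite_induct) (simp_all add: const_add del: add_pCons)
  then show ?thesis
    by (simp add: const_poly_matrix_def matrix_matrix_mult_def vec_eq_iff mult.commute)
qed

lemma const_poly_matrix_1: "const_poly_matrix (mat 1) = mat 1"
  by (simp add: const_poly_matrix_def mat_def vec_eq_iff one_pCons)

lemma charpoly_eq_det: "charpoly A = det (mat [:0, 1:] - const_poly_matrix A)"
  unfolding charpoly_def
    by (rule arg_cong[of _ _ det]) (simp add: const_poly_matrix_def mat_def vec_eq_iff)

lemma matrix_diff_ldistrib:
  fixes A :: "'a::ring_1^'m^'n"
  shows "A ** (B - C) = A ** B - A ** C"
  by (simp add: matrix_matrix_mult_def vec_eq_iff right_diff_distrib sum_subtractf)

lemma matrix_diff_rdistrib:
  fixes A :: "'a::ring_1^'m^'n"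
  shows "(A - B) ** C = A ** C - B ** C"
  by (simp add: matrix_matrix_mult_def vec_eq_iff left_diff_distrib sum_subtractf)

text \<open>The determinant of the embedded \<open>P\<close> is a nonzero element of the integral
  domain R[X], so it cancels after taking determinants of the intertwining relation.\<close>

lemma charpoly_similar:
  fixes P A B :: "real^'n^'n"
  assumes P: "invertible P" and eq: "P ** A = B ** P"
  shows "charpoly A = charpoly B"
proof -
  let ?c = const_poly_matrix and ?X = "mat [:0, 1:] :: real poly^'n^'n"
  obtain P' where "P ** P' = mat 1" using P by (auto simp: invertible_def)
  then have "?c P ** ?c P' = mat 1" by (simp add: const_poly_matrix_1 flip: const_poly_matrix_mult)
  then have "det (?c P) * det (?c P') = 1" by (metis det_I det_mul)
  then have nz: "det (?c P) \<noteq> 0" by auto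
  have "?c P ** ?X = ?X ** ?c P"
    by (simp add: matrix_matrix_mult_def mat_def vec_eq_iff if_distrib if_distribR cong: if_cong)
  then have "?c P ** (?X - ?c A) = (?X - ?c B) ** ?c P"
    using eq by (metis matrix_diff_ldistrib matrix_diff_rdistrib const_poly_matrix_mult)
  then have "det (?c P) * charpoly A = charpoly B * det (?c P)"
    unfolding charpoly_eq_det by (metis det_mul)
  then show ?thesis using nz by simp
qed

lemma charpoly_diagonal:
  fixes d :: "'n::finite \<Rightarrow> real"
  shows "charpoly (\<chi> i j. if i = j then d i else 0 :: real^'n^'n) = (\<Prod>i\<in>UNIV. [:- d i, 1:])"
  unfolding charpoly_def by (subst det_diagonal) (simp_all add: if_distrib)

text \<open>Links the eigenvalues of the spectral theorem to the algebraic definition of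
  \<open>mu\<close>, multiplicities included: the orthogonal matrix with rows \<open>u i\<close>
  conjugates \<open>A\<close> to a diagonal one.\<close>

lemma proots_charpoly_eigenbasis:
  fixes A :: "real^'n^'n" and u :: "'n \<Rightarrow> real^'n"
  assumes sym: "transpose A = A" and on: "\<And>i j. u i \<bullet> u j = (if i = j then 1 else 0)"
    and eig: "\<And>i. A *v u i = d i *\<^sub>R u i"
  shows "proots (charpoly A) = image_mset d (mset_set UNIV)"
proof -
  define Q :: "real^'n^'n" where "Q = (\<chi> i. u i)"
  define D :: "real^'n^'n" where "D = (\<chi> i j. if i = j then d i else 0)"
  have QQ: "Q ** transpose Q = mat 1"
    using on by (simp add: Q_def vec_eq_iff matrix_matrix_mult_def transpose_def mat_def inner_vec_def)
  then have "invertible Q" using invertible_right_inverse by blast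
  moreover have "Q ** A = D ** Q"
  proof -
    have "(Q ** A) $ i $ j = (D ** Q) $ i $ j" for i j
    proof -
      have "(Q ** A) $ i $ j = (u i v* A) $ j"
        by (simp add: Q_def matrix_matrix_mult_def vector_matrix_mult_def mult.commute)
      also have "u i v* A = A *v u i" using sym transpose_matrix_vector[of A "u i"] by simp
      also have "(\<dots>) $ j = (D ** Q) $ i $ j"
        by (simp add: eig D_def Q_def matrix_matrix_mult_def mult_delta_left)
      finally show ?thesis .
    qed
    then show ?thesis by (simp add: vec_eq_iff)
  qed
  ultimately have "charpoly A = charpoly D" by (rule charpoly_similar)
  then have "charpoly A = (\<Prod>i\<in>UNIV. [:- d i, 1:])"
    unfolding D_def by (simp only: charpoly_diagonal)
  then have "proots (charpoly A) = (\<Sum>i\<in>UNIV. {#d i#})"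
    by (simp add: proots_prod)
  also have "\<dots> = image_mset d (mset_set UNIV)"
  proof -
    have "(\<Sum>i\<in>S. {#d i#}) = image_mset d (mset_set S)" if "finite S" for S
      using that by (induction S rule: finite_induct) auto
    then show ?thesis by simp
  qed
  finally show ?thesis .
qed

section \<open>Singular values\<close>

lemma matrix_inv_cancel:
  fixes g :: "real^'n^'n"
  assumes "det g \<noteq> 0"
  shows "g ** matrix_inv g = mat 1" "matrix_inv g ** g = mat 1"
proof -
  have "invertible g" using assms invertible_det_nz by blast
  then have "g ** matrix_inv g = mat 1 \<and> matrix_inv g ** g = mat 1"
    unfolding invertible_def matrix_inv_def by (rule someI_ex)
  then show "g ** matrix_inv g = mat 1" "matrix_inv g ** g = mat 1" by auto
qed

lemma matrix_inv_unique:
  fixes g h :: "real^'n^'n"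
  assumes "g ** h = mat 1"
  shows "matrix_inv g = h"
proof -
  have "det g * det h = 1" using assms by (metis det_I det_mul)
  then have "det g \<noteq> 0" by auto
  then show ?thesis
    by (metis assms matrix_inv_cancel(2) matrix_mul_assoc matrix_mul_lid matrix_mul_rid)
qed

lemma matrix_inv_apply:
  fixes g :: "real^'n^'n"
  assumes "det g \<noteq> 0"
  shows "g *v (matrix_inv g *v v) = v" "matrix_inv g *v (g *v v) = v"
  using matrix_inv_cancel[OF assms] by (simp_all add: matrix_vector_mul_assoc)

lemma det_inv:
  fixes h :: "real^'n^'n"
  assumes "det h \<noteq> 0"
  shows "det (matrix_inv h) \<noteq> 0"
proof -
  have "det h * det (matrix_inv h) = 1" using matrix_inv_cancel(1)[OF assms] by (metis det_I det_mul)
  then show ?thesis by auto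
qed

lemma transpose_dot:
  fixes g :: "real^'n^'n"
  shows "(transpose g *v x) \<bullet> y = x \<bullet> (g *v y)"
  by (simp add: dot_lmul_matrix)

lemma norm_matrix_le_onorm:
  fixes g :: "real^'n^'n"
  shows "norm (g *v v) \<le> onorm ((*v) g) * norm v"
  by (simp add: onorm)

lemma onorm_matrix_nonneg:
  fixes g :: "real^'n^'n"
  shows "0 \<le> onorm ((*v) g)"
  by (simp add: onorm_pos_le)

lemma onorm_matrix_uminus:
  fixes g :: "real^'n^'n"
  shows "onorm ((*v) (- g)) = onorm ((*v) g)"
proof -
  have "(*v) (- g) = (\<lambda>v. - (g *v v))"
    by (auto simp: vec_eq_iff matrix_vector_mult_def sum_negf)
  then show ?thesis by (simp add: onorm_neg)
qed

lemma onorm_matrix_transpose: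
  fixes g :: "real^'n^'n"
  shows "onorm ((*v) (transpose g)) = onorm ((*v) g)"
proof -
  have *: "onorm ((*v) (transpose g)) \<le> onorm ((*v) g)" for g :: "real^'n^'n"
  proof (rule onorm_le)
    fix v
    let ?y = "transpose g *v v"
    have "norm ?y * norm ?y = v \<bullet> (g *v ?y)"
      by (metis transpose_dot norm_eq_sqrt_inner real_sqrt_mult_self abs_of_nonneg inner_ge_zero)
    also have "\<dots> \<le> norm v * (onorm ((*v) g) * norm ?y)"
      by (meson norm_cauchy_schwarz norm_matrix_le_onorm mult_left_mono norm_ge_zero order_trans)
    finally have "norm ?y * norm ?y \<le> (onorm ((*v) g) * norm v) * norm ?y" by (simp add: mult_ac)
    then show "norm ?y \<le> onorm ((*v) g) * norm v"
      by (cases "norm ?y = 0") (auto simp: onorm_matrix_nonneg)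
  qed
  show ?thesis using *[of g] *[of "transpose g"] by simp
qed

text \<open>\<open>g\<close> itself conjugates g^T g to g g^T. The upper bound needs this for the
  inverse transpose, which moves functionals.\<close>

lemma mu_transpose:
  fixes g :: "real^'n^'n"
  assumes "det g \<noteq> 0"
  shows "mu i (transpose g) = mu i g"
proof -
  have "charpoly (transpose g ** g) = charpoly (g ** transpose g)"
    using assms invertible_det_nz by (intro charpoly_similar[of g]) (auto simp: matrix_mul_assoc)
  then show ?thesis by (simp add: mu_def ggT_eigs_def)
qed

lemma mu_uminus:
  fixes g :: "real^'n^'n"
  shows "mu i (- g) = mu i g"
proof -
  have "- g ** transpose (- g) = g ** transpose g"
    by (simp add: vec_eq_iff matrix_matrix_mult_def transpose_def)
  then show ?thesis by (simp add: mu_def ggT_eigs_def)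
qed

text \<open>\<open>mu\<close> reads positions of a sorted list, while the eigenbasis is indexed by
  an unordered type. The indices \<open>m\<close>, \<open>l\<close> and the number \<open>D\<close>
  transport just the largest, the smallest and the second entry; \<open>D\<close> may equal
  \<open>d m\<close>.\<close>

lemma singular_value_decomposition:
  fixes g :: "real^'n^'n"
  assumes det: "det g \<noteq> 0" and n: "2 \<le> CARD('n)"
  obtains u :: "'n \<Rightarrow> real^'n" and d m l D
  where "\<And>i j. u i \<bullet> u j = (if i = j then 1 else 0)"
    "\<And>i. g *v (transpose g *v u i) = d i *\<^sub>R u i" "\<And>i. 0 < d i"
    "\<And>i. d i \<le> d m" "\<And>i. d l \<le> d i" "\<And>i. i \<noteq> m \<Longrightarrow> d i \<le> D" "0 < D" "D \<le> d m"
    "mu 1 g = ln (sqrt (d m))" "mu 2 g = ln (sqrt D)" "mu CARD('n) g = ln (sqrt (d l))"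
proof -
  let ?A = "g ** transpose g"
  have sym: "transpose ?A = ?A" by (simp add: matrix_transpose_mul)
  obtain u :: "'n \<Rightarrow> real^'n" and d where on: "\<And>i j. u i \<bullet> u j = (if i = j then 1 else 0)"
    and eig: "\<And>i. ?A *v u i = d i *\<^sub>R u i"
    using symmetric_matrix_eigenbasis[OF sym] by blast
  have eig': "g *v (transpose g *v u i) = d i *\<^sub>R u i" for i
    unfolding matrix_vector_mul_assoc by (rule eig)
  have dpos: "0 < d i" for i
  proof -
    have "d i = (transpose g *v u i) \<bullet> (transpose g *v u i)"
      using on[of i i] eig'[of i] transpose_dot[of g "u i" "transpose g *v u i"] by simp
    moreover have "transpose g *v u i \<noteq> 0"
    proof
      assume "transpose g *v u i = 0"
      then have "u i = 0" using matrix_inv_apply(2)[of "transpose g" "u i"] det by simp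
      then show False using on[of i i] by simp
    qed
    ultimately show ?thesis by simp
  qed
  define xs where "xs = ggT_eigs g"
  have ms: "mset xs = image_mset d (mset_set UNIV)"
    unfolding xs_def ggT_eigs_def using proots_charpoly_eigenbasis[OF sym on eig] by simp
  have srt: "sorted (rev xs)" by (simp add: xs_def ggT_eigs_def)
  have len: "length xs = CARD('n)" using arg_cong[OF ms, of size] by simp
  have set: "set xs = range d" using arg_cong[OF ms, of set_mset] by simp
  have mono: "xs ! j \<le> xs ! i" if "i \<le> j" "j < length xs" for i j
    using sorted_rev_nth_mono[OF srt that] .
  have in_xs: "xs ! i \<in> range d" if "i < CARD('n)" for i
    using that len set by (metis nth_mem)
  obtain m where m: "xs ! 0 = d m" using in_xs[of 0] n by auto
  obtain l where l: "xs ! (CARD('n) - 1) = d l" using in_xs[of "CARD('n) - 1"] n by auto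
  have ge: "d i \<le> d m" for i
  proof -
    obtain k where "k < length xs" "xs ! k = d i" using set by (metis in_set_conv_nth rangeI)
    then show ?thesis using mono[of 0 k] m by simp
  qed
  have le: "d l \<le> d i" for i
  proof -
    obtain k where "k < length xs" "xs ! k = d i" using set by (metis in_set_conv_nth rangeI)
    then show ?thesis using mono[of k "CARD('n) - 1"] l len by simp
  qed
  \<comment> \<open>Deleting one occurrence of \<open>d m\<close> from the multiset, rather than the
    value, keeps a repeated top eigenvalue in the tail.\<close>
  have snd: "d i \<le> xs ! 1" if "i \<noteq> m" for i
  proof -
    obtain ys where xs: "xs = d m # ys" using m len n by (cases xs) auto
    have "mset_set (UNIV :: 'n set) = add_mset m (mset_set (UNIV - {m}))"
      using mset_set.remove[of UNIV m] by simp
    then have "mset ys = image_mset d (mset_set (UNIV - {m}))" using ms xs by simp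
    then have "d i \<in> set ys" using that by (metis (no_types, lifting) DiffI UNIV_I empty_iff finite
          finite_set_mset_mset_set image_eqI insert_iff set_image_mset set_mset_mset)
    then obtain k where "k < length ys" "ys ! k = d i" by (metis in_set_conv_nth)
    then show ?thesis using mono[of 1 "Suc k"] xs by simp
  qed
  have D: "0 < xs ! 1" "xs ! 1 \<le> d m"
    using in_xs[of 1] n dpos mono[of 0 1] m len by auto
  show ?thesis
    using that[OF on eig' dpos ge le snd D] m l n
    by (simp add: mu_def flip: xs_def)
qed

text \<open>The last claim is the source of the gap in the upper bound: once the top left singular
  direction is removed, what remains of \<open>g\<close> has norm at most exp (mu 2), a proportion
  exp (- (mu 1 - mu 2)) of the full norm.\<close>

lemma mu_facts:
  fixes g :: "real^'n^'n"
  assumes det: "det g \<noteq> 0" and n: "2 \<le> CARD('n)"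
  shows mu_2_le_mu_1: "mu 2 g \<le> mu 1 g"
    and exp_mu_1: "exp (mu 1 g) = onorm ((*v) g)"
    and exp_mu_card: "exp (- mu CARD('n) g) = onorm ((*v) (matrix_inv g))"
    and matrix_image_near_line:
      "\<exists>e. norm e = 1 \<and> (\<forall>v. norm (g *v v - (e \<bullet> (g *v v)) *\<^sub>R e) \<le> exp (mu 2 g) * norm v)"
proof -
  obtain u :: "'n \<Rightarrow> real^'n" and d m l D
    where on: "\<And>i j. u i \<bullet> u j = (if i = j then 1 else 0)"
    and eig: "\<And>i. g *v (transpose g *v u i) = d i *\<^sub>R u i" and dpos: "\<And>i. 0 < d i"
    and dm: "\<And>i. d i \<le> d m" and dl: "\<And>i. d l \<le> d i" and dD: "\<And>i. i \<noteq> m \<Longrightarrow> d i \<le> D"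
    and D: "0 < D" "D \<le> d m"
    and mu: "mu 1 g = ln (sqrt (d m))" "mu 2 g = ln (sqrt D)" "mu CARD('n) g = ln (sqrt (d l))"
    using singular_value_decomposition[OF det n] by blast
  note expand = orthonormal_family_expansion[of u, OF on]
  have tr: "(transpose g *v x) \<bullet> (transpose g *v u i) = d i * (x \<bullet> u i)" for x i
    using transpose_dot[of g x "transpose g *v u i"] eig by simp
  \<comment> \<open>The right singular vectors; in them the norms of g^T x and of g v become
    diagonal sums.\<close>
  define f where "f i = (transpose g *v u i) /\<^sub>R sqrt (d i)" for i
  have fon: "f i \<bullet> f j = (if i = j then 1 else 0)" for i j
    using tr[of "u i" j] on dpos[of i] by (auto simp: f_def field_simps)
  have yu: "(x \<bullet> (transpose g *v u i)) = sqrt (d i) * (x \<bullet> f i)" for x i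
    using dpos[of i] by (simp add: f_def)
  have trn: "(norm (transpose g *v x))\<^sup>2 = (\<Sum>i\<in>UNIV. d i * (x \<bullet> u i)\<^sup>2)" for x
  proof -
    have cancel: "sqrt (d i) * ((transpose g *v x) \<bullet> f i) = sqrt (d i) * (sqrt (d i) * (x \<bullet> u i))" for i
      using yu[of "transpose g *v x" i] tr[of x i] dpos[of i] by (simp flip: mult.assoc)
    have "(transpose g *v x) \<bullet> f i = sqrt (d i) * (x \<bullet> u i)" for i
    proof -
      have "sqrt (d i) \<noteq> 0" using dpos[of i] by simp
      then show ?thesis using cancel[of i] mult_left_cancel by blast
    qed
    then show ?thesis
      unfolding power2_norm_eq_inner
      by (subst orthonormal_family_expansion(2)[of f, OF fon])
         (use dpos in \<open>auto intro!: sum.cong simp: power_mult_distrib less_imp_le simp flip: power2_eq_square\<close>)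
  qed
  have nsum: "(norm x)\<^sup>2 = (\<Sum>i\<in>UNIV. (x \<bullet> u i)\<^sup>2)" for x
    unfolding power2_norm_eq_inner using expand(2)[of x x] by (simp add: power2_eq_square)
  show "mu 2 g \<le> mu 1 g" using mu D by simp
  have up: "norm (transpose g *v x) \<le> sqrt (d m) * norm x" for x
  proof (rule power2_le_imp_le)
    show "(norm (transpose g *v x))\<^sup>2 \<le> (sqrt (d m) * norm x)\<^sup>2"
      unfolding trn unfolding power_mult_distrib nsum sum_distrib_left
      using dpos[of m] dm by (auto intro!: sum_mono mult_right_mono)
  qed (use dpos[of m] in auto)
  have low: "sqrt (d l) * norm x \<le> norm (transpose g *v x)" for x
  proof (rule power2_le_imp_le)
    show "(sqrt (d l) * norm x)\<^sup>2 \<le> (norm (transpose g *v x))\<^sup>2"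
      unfolding trn unfolding power_mult_distrib nsum sum_distrib_left
      using dpos[of l] dl by (auto intro!: sum_mono mult_right_mono)
  qed auto
  have nu: "norm (u i) = 1" for i using on[of i i] by (simp add: norm_eq_sqrt_inner)
  have nt: "norm (transpose g *v u i) = sqrt (d i)" for i
    using tr[of "u i" i] on[of i i] by (simp add: norm_eq_sqrt_inner)
  have "onorm ((*v) (transpose g)) = sqrt (d m)"
  proof (rule antisym)
    show "onorm ((*v) (transpose g)) \<le> sqrt (d m)" by (rule onorm_le) (rule up)
    show "sqrt (d m) \<le> onorm ((*v) (transpose g))"
      using norm_matrix_le_onorm[of "transpose g" "u m"] nt nu by simp
  qed
  then show "exp (mu 1 g) = onorm ((*v) g)"
    using mu dpos[of m] by (simp add: onorm_matrix_transpose)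
  \<comment> \<open>\<open>transpose g\<close> scales norms by at least sqrt (d l), with equality at
    \<open>u l\<close>, so the norm of its inverse is exactly 1 / sqrt (d l).\<close>
  define h where "h = transpose (matrix_inv g)"
  have "h ** transpose g = mat 1" "transpose g ** h = mat 1"
    unfolding h_def by (simp_all add: matrix_inv_cancel[OF det] flip: matrix_transpose_mul)
  then have hg: "h *v (transpose g *v x) = x" "transpose g *v (h *v x) = x" for x
    unfolding matrix_vector_mul_assoc by simp_all
  have "onorm ((*v) h) = 1 / sqrt (d l)"
  proof (rule antisym)
    show "onorm ((*v) h) \<le> 1 / sqrt (d l)"
    proof (rule onorm_le)
      fix x show "norm (h *v x) \<le> 1 / sqrt (d l) * norm x"
        using low[of "h *v x"] hg(2)[of x] dpos[of l] by (simp add: field_simps)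
    qed
    show "1 / sqrt (d l) \<le> onorm ((*v) h)"
      using norm_matrix_le_onorm[of h "transpose g *v u l"] hg(1)[of "u l"] nt[of l] nu[of l] dpos[of l]
      by (simp add: field_simps)
  qed
  then show "exp (- mu CARD('n) g) = onorm ((*v) (matrix_inv g))"
    using mu dpos[of l] by (simp add: h_def onorm_matrix_transpose exp_minus divide_inverse)
  have "norm (g *v v - (u m \<bullet> (g *v v)) *\<^sub>R u m) \<le> exp (mu 2 g) * norm v" for v
  proof (rule power2_le_imp_le)
    let ?y = "g *v v" and ?z = "g *v v - (u m \<bullet> (g *v v)) *\<^sub>R u m"
    have yi: "?y \<bullet> u i = sqrt (d i) * (v \<bullet> f i)" for i
      using yu[of v i] transpose_dot[of g "u i" v] by (simp add: inner_commute)
    have zi: "(?z \<bullet> u i)\<^sup>2 \<le> D * (v \<bullet> f i)\<^sup>2" for i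
    proof (cases "i = m")
      case True
      then have "?z \<bullet> u i = 0"
        using on[of m m] by (simp add: inner_diff_left inner_commute[of "u m" "g *v v"])
      then show ?thesis using D by simp
    next
      case False
      then have "?z \<bullet> u i = ?y \<bullet> u i" using on[of m i] by (simp add: inner_diff_left)
      then show ?thesis using yi[of i] dpos[of i] dD[OF False]
        by (simp add: power_mult_distrib mult_right_mono)
    qed
    have "(norm ?z)\<^sup>2 \<le> (\<Sum>i\<in>UNIV. D * (v \<bullet> f i)\<^sup>2)"
      unfolding nsum by (intro sum_mono zi)
    also have "\<dots> = D * (norm v)\<^sup>2"
      unfolding power2_norm_eq_inner orthonormal_family_expansion(2)[of f v v, OF fon]
      by (simp add: power2_eq_square sum_distrib_left)
    finally show "(norm ?z)\<^sup>2 \<le> (exp (mu 2 g) * norm v)\<^sup>2"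
      using mu D by (simp add: power_mult_distrib)
  qed simp
  then show "\<exists>e. norm e = 1 \<and> (\<forall>v. norm (g *v v - (e \<bullet> (g *v v)) *\<^sub>R e) \<le> exp (mu 2 g) * norm v)"
    using nu by blast
qed

text \<open>Each unit vector is within 2 \<epsilon> of \<open>e\<close> or of \<open>- e\<close>,
  and \<open>pdist\<close> is blind to signs.\<close>

lemma pdist_le_of_near_line:
  fixes y y' e :: "real^'n"
  assumes e: "norm e = 1" and "y \<noteq> 0" "y' \<noteq> 0"
    and "norm (y - (e \<bullet> y) *\<^sub>R e) \<le> \<epsilon> * norm y" "norm (y' - (e \<bullet> y') *\<^sub>R e) \<le> \<epsilon> * norm y'"
  shows "pdist y y' \<le> 4 * \<epsilon>"
proof -
  have *: "\<exists>\<sigma>\<in>{1,-1::real}. norm (y /\<^sub>R norm y - \<sigma> *\<^sub>R e) \<le> 2 * \<epsilon>"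
    if y: "y \<noteq> 0" and b: "norm (y - (e \<bullet> y) *\<^sub>R e) \<le> \<epsilon> * norm y" for y
  proof -
    define a where "a = y /\<^sub>R norm y"
    define \<alpha> where "\<alpha> = e \<bullet> a"
    define \<sigma> :: real where "\<sigma> = (if 0 \<le> \<alpha> then 1 else -1)"
    have aa: "a \<bullet> a = 1"
      using y by (simp add: a_def dot_square_norm field_simps power2_eq_square)
    have ee: "e \<bullet> e = 1" using e by (simp add: dot_square_norm)
    have "a - \<alpha> *\<^sub>R e = (y - (e \<bullet> y) *\<^sub>R e) /\<^sub>R norm y"
      by (simp add: a_def \<alpha>_def scaleR_diff_right)
    then have "norm (a - \<alpha> *\<^sub>R e) = norm (y - (e \<bullet> y) *\<^sub>R e) / norm y"
      using y by (simp only: norm_scaleR) (simp add: divide_inverse mult_ac)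
    then have n: "norm (a - \<alpha> *\<^sub>R e) \<le> \<epsilon>"
      using b y by (simp add: pos_divide_le_eq)
    have n2: "(norm (a - \<alpha> *\<^sub>R e))\<^sup>2 = 1 - \<alpha>\<^sup>2"
      unfolding power2_norm_eq_inner using aa ee
      by (simp add: inner_diff inner_commute power2_eq_square \<alpha>_def)
    have al: "0 \<le> \<sigma> * \<alpha>" "\<sigma> * \<alpha> \<le> 1" "(\<sigma> * \<alpha>)\<^sup>2 = \<alpha>\<^sup>2" "\<sigma>\<^sup>2 = 1"
    proof -
      have "\<bar>\<alpha>\<bar> \<le> 1"
        using Cauchy_Schwarz_ineq2[of e a] e aa by (simp add: \<alpha>_def norm_eq_sqrt_inner)
      then show "0 \<le> \<sigma> * \<alpha>" "\<sigma> * \<alpha> \<le> 1" "(\<sigma> * \<alpha>)\<^sup>2 = \<alpha>\<^sup>2" "\<sigma>\<^sup>2 = 1"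
        by (auto simp: \<sigma>_def)
    qed
    have "(norm (a - \<sigma> *\<^sub>R e))\<^sup>2 = 2 - 2 * (\<sigma> * \<alpha>)"
      unfolding power2_norm_eq_inner using aa ee al(4)
      by (simp add: inner_diff inner_commute power2_eq_square \<alpha>_def)
    \<comment> \<open>A number in [0, 1] dominates its square. This trades the distance to the
      vector for the distance to the line, up to a factor sqrt 2.\<close>
    also have "\<dots> \<le> 2 * (1 - (\<sigma> * \<alpha>)\<^sup>2)"
      using mult_left_mono[OF al(2) al(1)] by (simp add: power2_eq_square)
    also have "\<dots> = 2 * (norm (a - \<alpha> *\<^sub>R e))\<^sup>2" using n2 al by simp
    also have "\<dots> \<le> 2 * \<epsilon>\<^sup>2" using n by (simp add: power_mono)
    also have "\<dots> \<le> (2 * \<epsilon>)\<^sup>2" by (simp add: power2_eq_square)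
    finally have "norm (a - \<sigma> *\<^sub>R e) \<le> 2 * \<epsilon>"
      by (rule power2_le_imp_le) (use n norm_ge_zero[of "a - \<alpha> *\<^sub>R e"] in linarith)
    moreover have "\<sigma> \<in> {1, -1}" by (simp add: \<sigma>_def)
    ultimately show ?thesis unfolding a_def by blast
  qed
  obtain \<sigma> \<sigma>' :: real where \<sigma>: "\<sigma> \<in> {1,-1}" "norm (y /\<^sub>R norm y - \<sigma> *\<^sub>R e) \<le> 2 * \<epsilon>"
    "\<sigma>' \<in> {1,-1}" "norm (y' /\<^sub>R norm y' - \<sigma>' *\<^sub>R e) \<le> 2 * \<epsilon>"
    using *[OF assms(2,4)] *[OF assms(3,5)] by blast
  show ?thesis
  proof (cases "\<sigma> = \<sigma>'")
    case True
    then have "norm (y /\<^sub>R norm y - y' /\<^sub>R norm y') \<le> 4 * \<epsilon>"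
      using norm_triangle_ineq4[of "y /\<^sub>R norm y - \<sigma> *\<^sub>R e" "y' /\<^sub>R norm y' - \<sigma> *\<^sub>R e"] \<sigma> by simp
    then show ?thesis by (simp add: pdist_def)
  next
    case False
    then have "\<sigma>' = - \<sigma>" using \<sigma> by auto
    then have "norm (y /\<^sub>R norm y + y' /\<^sub>R norm y') \<le> 4 * \<epsilon>"
      using norm_triangle_ineq[of "y /\<^sub>R norm y - \<sigma> *\<^sub>R e" "y' /\<^sub>R norm y' + \<sigma> *\<^sub>R e"] \<sigma> by simp
    then show ?thesis by (simp add: pdist_def)
  qed
qed

lemma pdist2_nonneg: "0 \<le> pdist2 P Q"
  unfolding pdist2_def pdist_def by (rule max.coboundedI1) simp

section \<open>Hausdorff measures and critical exponents\<close>

lemma ediam_le: "(\<And>p q. p \<in> A \<Longrightarrow> q \<in> A \<Longrightarrow> d p q \<le> r) \<Longrightarrow> ediam d A \<le> ereal r"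
  unfolding ediam_def by (rule SUP_least) auto

lemma le_ediam: "p \<in> A \<Longrightarrow> q \<in> A \<Longrightarrow> ereal (d p q) \<le> ediam d A"
  unfolding ediam_def by (rule SUP_upper2[of "(p, q)"]) auto

text \<open>Restates nullity through real radii and finite partial sums. Empty sets are treated
  apart because their \<open>ediam\<close> is minus infinity.\<close>

lemma hausdorff_measure_zeroI:
  assumes "\<And>\<epsilon> \<eta>. 0 < \<epsilon> \<Longrightarrow> 0 < \<eta> \<Longrightarrow>
    \<exists>V r. A \<subseteq> (\<Union>i::nat. V i) \<and> (\<forall>i. 0 \<le> r i \<and> r i \<le> \<epsilon>) \<and>
      (\<forall>i. \<forall>p\<in>V i. \<forall>q\<in>V i. d p q \<le> r i) \<and> (\<forall>n. (\<Sum>i<n. r i powr s) \<le> \<eta>)"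
    and nonneg: "\<And>p q. 0 \<le> d p q" and "0 < s"
  shows "hausdorff_measure d s A = 0"
proof -
  have "hausdorff_content d s \<epsilon> A \<le> 0" if "0 < \<epsilon>" for \<epsilon>
  proof (rule ennreal_le_epsilon)
    fix \<eta> :: real assume "0 < \<eta>"
    then obtain V r where cov: "A \<subseteq> (\<Union>i::nat. V i)" and r: "\<And>i. 0 \<le> r i" "\<And>i. r i \<le> \<epsilon>"
      and diam: "\<And>i p q. p \<in> V i \<Longrightarrow> q \<in> V i \<Longrightarrow> d p q \<le> r i"
      and sum: "\<And>n. (\<Sum>i<n. r i powr s) \<le> \<eta>"
      using assms(1)[OF \<open>0 < \<epsilon>\<close>] by metis
    have ed: "ediam d (V i) \<le> ereal (r i)" for i by (intro ediam_le diam)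
    have tm: "(if V i = {} then 0 else ennreal (real_of_ereal (ediam d (V i)) powr s))
        \<le> ennreal (r i powr s)" for i
    proof (cases "V i = {}")
      case False
      then obtain p where "p \<in> V i" by blast
      then have "0 \<le> ediam d (V i)" using le_ediam[of p "V i" p d] nonneg[of p p]
        by (metis ereal_less_eq(5) order_trans)
      with ed[of i] have "0 \<le> real_of_ereal (ediam d (V i))" "real_of_ereal (ediam d (V i)) \<le> r i"
        by (cases "ediam d (V i)"; simp)+
      then show ?thesis using False \<open>0 < s\<close> by (auto intro!: ennreal_leI powr_mono2)
    qed simp
    have "hausdorff_content d s \<epsilon> A \<le>
        (\<Sum>i. if V i = {} then 0 else ennreal (real_of_ereal (ediam d (V i)) powr s))"
      unfolding hausdorff_content_def
    proof (rule INF_lower)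
      have "ediam d (V i) \<le> ereal \<epsilon>" for i
        using order_trans[OF ed[of i], of "ereal \<epsilon>"] r(2)[of i] by simp
      then show "V \<in> {U. A \<subseteq> (\<Union>i. U i) \<and> (\<forall>i. ediam d (U i) \<le> ereal \<epsilon>)}"
        using cov by simp
    qed
    also have "\<dots> \<le> (\<Sum>i. ennreal (r i powr s))" by (intro suminf_le tm summableI)
    also have "\<dots> \<le> ennreal \<eta>"
    proof (rule suminf_le_const)
      show "summable (\<lambda>i. ennreal (r i powr s))" by (rule summableI)
      show "(\<Sum>i<n. ennreal (r i powr s)) \<le> ennreal \<eta>" for n
        using sum[of n] by (subst sum_ennreal) (auto intro: ennreal_leI)
    qed
    finally show "hausdorff_content d s \<epsilon> A \<le> 0 + ennreal \<eta>" by simp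
  qed
  then show ?thesis by (auto simp: hausdorff_measure_def)
qed

text \<open>The covering half of Borel-Cantelli: the sets outside a large finite part of
  \<open>G\<close> still cover \<open>A\<close>, and the tail of the convergent series controls both
  their sum and each single diameter.\<close>

lemma hausdorff_measure_limsup_zero:
  fixes D :: "'b \<Rightarrow> real"
  assumes summ: "(\<lambda>g. D g powr s) summable_on G" and "0 < s" and D: "\<And>g. g \<in> G \<Longrightarrow> 0 \<le> D g"
    and diam: "\<And>g p q. g \<in> G \<Longrightarrow> p \<in> S g \<Longrightarrow> q \<in> S g \<Longrightarrow> d p q \<le> D g"
    and cov: "\<And>F. finite F \<Longrightarrow> F \<subseteq> G \<Longrightarrow> A \<subseteq> (\<Union>g\<in>G - F. S g)"
    and nonneg: "\<And>p q. 0 \<le> d p q" and "countable G"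
  shows "hausdorff_measure d s A = 0"
proof (rule hausdorff_measure_zeroI)
  fix \<epsilon> \<eta> :: real assume "0 < \<epsilon>" "0 < \<eta>"
  \<comment> \<open>A tail below \<epsilon>^s forces every single \<open>D g\<close> in it below
    \<epsilon>.\<close>
  define \<theta> where "\<theta> = min \<eta> (\<epsilon> powr s)"
  have "0 < \<theta>" using \<open>0 < \<epsilon>\<close> \<open>0 < \<eta>\<close> by (simp add: \<theta>_def)
  obtain F where F: "finite F" "F \<subseteq> G"
    and tail: "\<And>H. finite H \<Longrightarrow> H \<subseteq> G - F \<Longrightarrow> (\<Sum>g\<in>H. D g powr s) \<le> \<theta>"
  proof -
    let ?f = "\<lambda>g. D g powr s"
    have "(?f has_sum infsum ?f G) G" using summ by simp
    then have "\<forall>\<^sub>F X in finite_subsets_at_top G. dist (sum ?f X) (infsum ?f G) < \<theta>"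
      unfolding has_sum_def using \<open>0 < \<theta>\<close> by (rule tendstoD)
    then obtain F where F: "finite F" "F \<subseteq> G" "dist (sum ?f F) (infsum ?f G) < \<theta>"
      by (auto simp: eventually_finite_subsets_at_top)
    have "sum ?f H \<le> \<theta>" if H: "finite H" "H \<subseteq> G - F" for H
    proof -
      have "sum ?f F + sum ?f H = sum ?f (F \<union> H)" using F H by (subst sum.union_disjoint) auto
      also have "\<dots> \<le> infsum ?f G" using F H summ by (intro finite_sum_le_infsum) auto
      finally show ?thesis using F by (simp add: dist_real_def)
    qed
    with F that show ?thesis by blast
  qed
  define e where "e = to_nat_on G"
  have e: "inj_on e G" unfolding e_def using \<open>countable G\<close> by (rule inj_on_to_nat_on)
  \<comment> \<open>Covers are indexed by the natural numbers, so \<open>G\<close> is enumerated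
    injectively; an index that no element hits gets the empty set and radius 0.\<close>
  define V where "V i = (\<Union>g\<in>{g\<in>G - F. e g = i}. S g)" for i
  define r where "r i = (if i \<in> e ` (G - F) then D (inv_into G e i) else 0)" for i
  have re: "r (e g) = D g" if "g \<in> G - F" for g using that e by (simp add: r_def)
  show "\<exists>V r. A \<subseteq> (\<Union>i::nat. V i) \<and> (\<forall>i. 0 \<le> r i \<and> r i \<le> \<epsilon>) \<and>
      (\<forall>i. \<forall>p\<in>V i. \<forall>q\<in>V i. d p q \<le> r i) \<and> (\<forall>n. (\<Sum>i<n. r i powr s) \<le> \<eta>)"
  proof (intro exI conjI allI ballI)
    show "A \<subseteq> (\<Union>i. V i)" using cov[OF F] by (fastforce simp: V_def)
    show "0 \<le> r i" for i using D by (auto simp: r_def e)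
    show "r i \<le> \<epsilon>" for i
    proof (cases "i \<in> e ` (G - F)")
      case True
      then obtain g where g: "g \<in> G - F" "i = e g" by blast
      have "D g powr s \<le> \<epsilon> powr s" using tail[of "{g}"] g by (simp add: \<theta>_def)
      then have "D g \<le> \<epsilon>"
        using powr_less_mono2[of s \<epsilon> "D g"] \<open>0 < s\<close> \<open>0 < \<epsilon>\<close> by (meson leI less_imp_le not_less)
      then show ?thesis using re g by simp
    qed (use \<open>0 < \<epsilon>\<close> in \<open>simp add: r_def\<close>)
    show "d p q \<le> r i" if "p \<in> V i" "q \<in> V i" for i p q
    proof -
      obtain g g' where "g \<in> G - F" "g' \<in> G - F" "e g = i" "e g' = i" "p \<in> S g" "q \<in> S g'"
        using \<open>p \<in> V i\<close> \<open>q \<in> V i\<close> by (auto simp: V_def)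
      moreover from this have "g = g'" using e by (auto simp: inj_on_def)
      ultimately show ?thesis using diam[of g p q] re[of g] by simp
    qed
    show "(\<Sum>i<n. r i powr s) \<le> \<eta>" for n
    proof -
      define H where "H = {g \<in> G - F. e g < n}"
      have "inj_on e H" using e by (rule inj_on_subset) (auto simp: H_def)
      moreover have "e ` H \<subseteq> {..<n}" by (auto simp: H_def)
      ultimately have "finite H" using finite_imageD finite_subset by blast
      have "(\<Sum>i<n. r i powr s) = (\<Sum>i\<in>e ` H. r i powr s)"
        by (rule sum.mono_neutral_right) (use \<open>0 < s\<close> in \<open>auto simp: H_def r_def\<close>)
      also have "\<dots> = (\<Sum>g\<in>H. D g powr s)"
        using \<open>inj_on e H\<close> re by (subst sum.reindex) (auto intro!: sum.cong simp: H_def)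
      also have "\<dots> \<le> \<eta>"
        using tail[OF \<open>finite H\<close>] by (auto simp: H_def \<theta>_def)
      finally show ?thesis .
    qed
  qed
qed fact+

lemma hausdorff_measure_zeroD:
  assumes zero: "hausdorff_measure d s A = 0" and "0 < s" "0 < \<eta>"
    and nonneg: "\<And>p q. 0 \<le> d p q"
  obtains V :: "nat \<Rightarrow> 'a set" and r where "A \<subseteq> (\<Union>i. V i)" "\<And>i. 0 < r i"
    "\<And>i p q. p \<in> V i \<Longrightarrow> q \<in> V i \<Longrightarrow> d p q \<le> r i"
    "\<And>I. finite I \<Longrightarrow> (\<Sum>i\<in>I. r i powr s) \<le> \<eta>"
proof -
  \<comment> \<open>Scale 1 only keeps the diameters finite; small radii are forced later by the
    small sum.\<close>
  have "hausdorff_content d s 1 A \<le> hausdorff_measure d s A"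
    unfolding hausdorff_measure_def by (rule SUP_upper) simp
  then have "hausdorff_content d s 1 A < ennreal (\<eta> / 2)" using zero \<open>0 < \<eta>\<close>
    by (simp add: ennreal_zero_less_divide)
  then obtain V :: "nat \<Rightarrow> 'a set" where V: "A \<subseteq> (\<Union>i. V i)" "\<And>i. ediam d (V i) \<le> ereal 1"
    and lt: "(\<Sum>i. if V i = {} then 0 else ennreal (real_of_ereal (ediam d (V i)) powr s)) < ennreal (\<eta> / 2)"
    unfolding hausdorff_content_def INF_less_iff by auto
  define b where "b i = (if V i = {} then 0 else real_of_ereal (ediam d (V i)) powr s)" for i
  have b0: "0 \<le> b i" for i by (simp add: b_def)
  have "(if V i = {} then 0 else ennreal (real_of_ereal (ediam d (V i)) powr s)) = ennreal (b i)" for i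
    by (simp add: b_def)
  with lt have lt': "(\<Sum>i. ennreal (b i)) < ennreal (\<eta> / 2)" by simp
  have bsum: "(\<Sum>i\<in>I. b i) \<le> \<eta> / 2" if "finite I" for I
  proof -
    have "(\<Sum>i\<in>I. ennreal (b i)) \<le> (\<Sum>i. ennreal (b i))"
      using that by (intro sum_le_suminf summableI) auto
    with lt' have "ennreal (\<Sum>i\<in>I. b i) \<le> ennreal (\<eta> / 2)"
      using b0 by (simp add: sum_ennreal)
    then show ?thesis using \<open>0 < \<eta>\<close> by (simp add: ennreal_le_iff)
  qed
  \<comment> \<open>The summand with (1/2)^i makes every radius positive, as the ray parameters
    built from the radii must be. It costs at most \<open>\<eta> / 2\<close> in total, the half left
    free by the choice of the cover.\<close>
  define r where "r i = (b i + \<eta> / 4 * (1/2) ^ i) powr (1/s)" for i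
  have pos: "0 < b i + \<eta> / 4 * (1/2) ^ i" for i
    using b0[of i] \<open>0 < \<eta>\<close> by (simp add: add_nonneg_pos)
  show ?thesis
  proof (rule that[OF V(1)])
    show "0 < r i" for i using pos[of i] by (simp add: r_def)
    show "d p q \<le> r i" if "p \<in> V i" "q \<in> V i" for i p q
    proof -
      have "ereal (d p q) \<le> ediam d (V i)" by (rule le_ediam) fact+
      with V(2)[of i] have le: "d p q \<le> real_of_ereal (ediam d (V i))"
        using nonneg[of p q] by (cases "ediam d (V i)") auto
      also have "\<dots> = b i powr (1/s)"
      proof -
        have "(x powr s) powr (1/s) = x" if "0 \<le> x" for x :: real
          using that \<open>0 < s\<close> by (simp add: powr_powr)
        then show ?thesis using \<open>p \<in> V i\<close> order_trans[OF nonneg[of p q] le] by (auto simp: b_def)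
      qed
      also have "\<dots> \<le> r i" unfolding r_def
        using b0[of i] \<open>0 < s\<close> \<open>0 < \<eta>\<close> by (intro powr_mono2) auto
      finally show ?thesis .
    qed
    show "(\<Sum>i\<in>I. r i powr s) \<le> \<eta>" if "finite I" for I
    proof -
      have "(\<Sum>i\<in>I. r i powr s) = (\<Sum>i\<in>I. b i) + \<eta> / 4 * (\<Sum>i\<in>I. (1/2) ^ i)"
        using pos \<open>0 < s\<close> by (simp add: r_def powr_powr less_imp_le sum.distrib sum_distrib_left)
      also have "(\<Sum>i\<in>I. (1/2::real) ^ i) \<le> (\<Sum>i. (1/2) ^ i)"
        using that by (intro sum_le_suminf summable_geometric) auto
      also have "\<dots> = 2" by (simp add: suminf_geometric)
      finally show ?thesis using bsum[OF that] \<open>0 < \<eta>\<close> by (simp add: field_simps)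
    qed
  qed
qed

section \<open>Critical exponents and convergence of Poincare series\<close>

lemma crit_exp_nonneg: "0 \<le> crit_exp \<Gamma> f"
  unfolding crit_exp_def
proof (rule le_Limsup)
  \<comment> \<open>For \<open>k = 0\<close> this rests on the value
    \<open>ln 0 = 0\<close>.\<close>
  have "0 \<le> ln (real k)" for k by (cases "k = 0") auto
  then show "\<forall>\<^sub>F R in at_top. 0 \<le> (if finite {g \<in> \<Gamma>. f g \<le> R}
      then ereal (ln (real (card {g \<in> \<Gamma>. f g \<le> R})) / R) else \<infinity>)"
    by (intro eventually_mono[OF eventually_gt_at_top[of 0]]) auto
qed simp

text \<open>With s' between the exponent and \<open>s\<close>, the counting function is O(exp (s'
  R)). Slicing by the integer part of \<open>f\<close> compares the series with a geometric one of
  ratio exp (s' - s). The finite sublevel sets also exhaust \<open>\<Gamma>\<close>, which makes it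
  countable.\<close>

lemma summable_on_of_crit_exp_less:
  assumes lt: "crit_exp \<Gamma> f < ereal s" and f: "\<And>g. g \<in> \<Gamma> \<Longrightarrow> 0 \<le> f g"
  shows "(\<lambda>g. exp (- s * f g)) summable_on \<Gamma>" and "countable \<Gamma>"
proof -
  obtain s' where s': "crit_exp \<Gamma> f < ereal s'" "s' < s"
    using ereal_dense2[OF lt] by auto
  have "0 < s'" using crit_exp_nonneg[of \<Gamma> f] s'(1) by (metis ereal_less(2) le_less_trans)
  have "\<forall>\<^sub>F R in at_top. (if finite {g \<in> \<Gamma>. f g \<le> R}
      then ereal (ln (real (card {g \<in> \<Gamma>. f g \<le> R})) / R) else \<infinity>) < ereal s'"
    using s'(1) unfolding crit_exp_def by (rule Limsup_lessD)
  then obtain R0 where R0: "\<And>R. R \<ge> R0 \<Longrightarrow> (if finite {g \<in> \<Gamma>. f g \<le> R}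
      then ereal (ln (real (card {g \<in> \<Gamma>. f g \<le> R})) / R) else \<infinity>) < ereal s'"
    by (auto simp: eventually_at_top_linorder)
  have fin: "finite {g \<in> \<Gamma>. f g \<le> R}" for R
  proof (rule finite_subset)
    show "finite {g \<in> \<Gamma>. f g \<le> max R R0}"
      using R0[of "max R R0"] by (auto split: if_splits)
  qed auto
  define R1 where "R1 = max R0 1"
  have card: "real (card {g \<in> \<Gamma>. f g \<le> R}) \<le> exp (s' * R)" if "R \<ge> R1" for R
  proof (cases "card {g \<in> \<Gamma>. f g \<le> R} = 0")
    case False
    have "ln (real (card {g \<in> \<Gamma>. f g \<le> R})) / R < s'"
      using R0[of R] fin that by (simp add: R1_def)
    then have "ln (real (card {g \<in> \<Gamma>. f g \<le> R})) \<le> s' * R"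
      using that by (simp add: R1_def divide_less_eq split: if_splits)
    then show ?thesis using False by (metis exp_le_cancel_iff exp_ln of_nat_0_less_iff not_gr_zero)
  qed simp
  \<comment> \<open>Shifting \<open>R\<close> by \<open>R1\<close> extends the bound to small
    \<open>R\<close> at the price of a constant factor.\<close>
  have card': "real (card {g \<in> \<Gamma>. f g \<le> R}) \<le> exp (s' * R1) * exp (s' * R)"
    if "R \<ge> 0" for R
  proof -
    have "real (card {g \<in> \<Gamma>. f g \<le> R}) \<le> real (card {g \<in> \<Gamma>. f g \<le> R + R1})"
      by (intro of_nat_mono card_mono[OF fin]) (auto simp: R1_def)
    also have "\<dots> \<le> exp (s' * (R + R1))" using that by (intro card) simp
    also have "exp (s' * (R + R1)) = exp (s' * R1) * exp (s' * R)"
      by (simp add: distrib_left exp_add)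
    finally show ?thesis .
  qed
  define q where "q = exp (s' - s)"
  have q: "0 < q" "q < 1" using s' by (auto simp: q_def)
  define B where "B = exp (s' * R1) * exp s' / (1 - q)"
  have "(\<Sum>g\<in>G. exp (- s * f g)) \<le> B" if G: "finite G" "G \<subseteq> \<Gamma>" for G
  proof -
    define N where "N = Suc (Max (insert 0 ((\<lambda>g. nat \<lfloor>f g\<rfloor>) ` G)))"
    have mem: "nat \<lfloor>f g\<rfloor> \<in> {..<N}" if "g \<in> G" for g
      unfolding N_def using that G by (auto simp: less_Suc_eq_le intro!: Max_ge)
    have "(\<Sum>g\<in>G. exp (- s * f g)) = (\<Sum>m<N. \<Sum>g | g \<in> G \<and> nat \<lfloor>f g\<rfloor> = m. exp (- s * f g))"
      using mem G by (subst sum.group) auto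
    also have "\<dots> \<le> (\<Sum>m<N. exp (s' * R1) * exp s' * q ^ m)"
    proof (rule sum_mono)
      fix m
      let ?S = "{g. g \<in> G \<and> nat \<lfloor>f g\<rfloor> = m}"
      have fl: "real m \<le> f g \<and> f g \<le> real m + 1" if "g \<in> ?S" for g
      proof -
        have "0 \<le> f g" using that f G by auto
        then have "\<lfloor>f g\<rfloor> = int m" using that by auto
        then show ?thesis by linarith
      qed
      have "0 < s" using \<open>0 < s'\<close> s' by simp
      have "(\<Sum>g\<in>?S. exp (- s * f g)) \<le> real (card ?S) * exp (- s * real m)"
        using fl \<open>0 < s\<close> by (intro sum_bounded_above) simp
      also have "real (card ?S) \<le> real (card {g \<in> \<Gamma>. f g \<le> real m + 1})"
        using fl G by (intro of_nat_mono card_mono fin) auto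
      also have "\<dots> \<le> exp (s' * R1) * exp (s' * (real m + 1))" by (intro card') simp
      finally have "(\<Sum>g\<in>?S. exp (- s * f g)) \<le> exp (s' * R1) * exp (s' * (real m + 1)) * exp (- s * real m)"
        by simp
      also have "\<dots> = exp (s' * R1) * exp s' * q ^ m"
      proof -
        have "q ^ m = exp (real m * (s' - s))" unfolding q_def by (rule exp_of_nat_mult[symmetric])
        moreover have "exp (s' * (real m + 1)) * exp (- s * real m) = exp s' * exp (real m * (s' - s))"
          unfolding mult_exp_exp by (simp add: algebra_simps)
        ultimately show ?thesis by (simp add: mult.assoc)
      qed
      finally show "(\<Sum>g\<in>?S. exp (- s * f g)) \<le> exp (s' * R1) * exp s' * q ^ m" .
    qed
    also have "\<dots> \<le> exp (s' * R1) * exp s' * (\<Sum>m. q ^ m)"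
      unfolding sum_distrib_left[symmetric] using q
      by (intro mult_left_mono sum_le_suminf summable_geometric) auto
    also have "\<dots> = B" using q by (simp add: B_def suminf_geometric)
    finally show ?thesis .
  qed
  then show "(\<lambda>g. exp (- s * f g)) summable_on \<Gamma>"
    by (intro nonneg_bounded_partial_sums_imp_summable_on[where C = B])
      (auto simp: eventually_finite_subsets_at_top)
  show "countable \<Gamma>"
  proof (rule countable_subset)
    show "\<Gamma> \<subseteq> (\<Union>n::nat. {g \<in> \<Gamma>. f g \<le> real n})"
      by (auto simp: real_arch_simple)
    show "countable (\<Union>n::nat. {g \<in> \<Gamma>. f g \<le> real n})"
      by (rule countable_UN[OF countableI_type countable_finite[OF fin]])
  qed
qed

text \<open>Chebyshev: every element with f g at most \<open>R\<close> contributes at least exp (- t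
  R), so bounded partial sums bound the counting function by a multiple of exp (t R).\<close>

lemma crit_exp_le:
  assumes fin: "\<And>R. finite {g \<in> \<Gamma>. f g \<le> R}" and "0 \<le> t"
    and B: "\<And>R. (\<Sum>g | g \<in> \<Gamma> \<and> f g \<le> R. exp (- t * f g)) \<le> B"
  shows "crit_exp \<Gamma> f \<le> ereal t"
proof -
  \<comment> \<open>At least 1, so that \<open>ln B'\<close> is nonnegative; this covers empty
    sublevel sets, where \<open>ln 0 = 0\<close>.\<close>
  define B' where "B' = max B 1"
  have le: "ln (real (card {g \<in> \<Gamma>. f g \<le> R})) / R \<le> ln B' / R + t" if "0 < R" for R
  proof (cases "card {g \<in> \<Gamma>. f g \<le> R} = 0")
    case True
    then show ?thesis using that \<open>0 \<le> t\<close> by (simp add: B'_def)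
  next
    case False
    have "real (card {g \<in> \<Gamma>. f g \<le> R}) * exp (- t * R) \<le> (\<Sum>g | g \<in> \<Gamma> \<and> f g \<le> R. exp (- t * f g))"
      using \<open>0 \<le> t\<close> by (intro sum_bounded_below) (auto intro: mult_left_mono)
    also have "\<dots> \<le> B'" using B[of R] by (simp add: B'_def)
    finally have "real (card {g \<in> \<Gamma>. f g \<le> R}) \<le> B' * exp (t * R)"
      by (simp add: exp_minus field_simps)
    then have "ln (real (card {g \<in> \<Gamma>. f g \<le> R})) \<le> ln (B' * exp (t * R))"
      using False by (intro ln_mono) (auto simp: B'_def)
    also have "\<dots> = ln B' + t * R" by (simp add: ln_mult B'_def)
    finally show ?thesis using that by (simp add: field_simps)
  qed
  have "((\<lambda>R. ereal (ln B' / R + t)) \<longlongrightarrow> ereal (0 + t)) at_top"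
    unfolding lim_ereal
    by (intro tendsto_add tendsto_divide_0[OF tendsto_const] filterlim_at_top_imp_at_infinity
        filterlim_ident tendsto_const)
  then have lim: "Limsup at_top (\<lambda>R. ereal (ln B' / R + t)) = ereal (0 + t)"
    by (rule lim_imp_Limsup[rotated]) (rule trivial_limit_at_top_linorder)
  have "crit_exp \<Gamma> f \<le> Limsup at_top (\<lambda>R. ereal (ln B' / R + t))"
    unfolding crit_exp_def using fin le
    by (intro Limsup_mono eventually_mono[OF eventually_gt_at_top[of 0]]) auto
  then show ?thesis unfolding lim by simp
qed

section \<open>Hilbert geometry of a convex domain\<close>

locale convex_chart =
  fixes w :: "real^'n" and U :: "(real^'n) set"
  assumes chart: "properly_convex_chart w U"
begin

text \<open>On the cone projective maps become linear and convex combinations become sums, so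
  distances and norms can be estimated through the vector order that it defines.\<close>

definition T :: "(real^'n) set" where
  "T = {v. 0 < w \<bullet> v \<and> v /\<^sub>R (w \<bullet> v) \<in> U}"

lemma U_nonempty: "U \<noteq> {}" and convex_U: "convex U" and bounded_U: "bounded U"
  and openin_U: "openin (top_of_set {v. w \<bullet> v = 1}) U"
  using chart by (auto simp: properly_convex_chart_def)

lemma w_U: "u \<in> U \<Longrightarrow> w \<bullet> u = 1"
  using chart by (auto simp: properly_convex_chart_def)

lemma w_T: "v \<in> T \<Longrightarrow> 0 < w \<bullet> v"
  by (simp add: T_def)

lemma T_iff_U: "w \<bullet> v = 1 \<Longrightarrow> v \<in> T \<longleftrightarrow> v \<in> U"
  by (simp add: T_def)

lemma U_subset_T: "U \<subseteq> T"
  using T_iff_U w_U by blast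

lemma T_scale:
  assumes "v \<in> T" "0 < a"
  shows "a *\<^sub>R v \<in> T"
proof -
  have "(a *\<^sub>R v) /\<^sub>R (w \<bullet> (a *\<^sub>R v)) = v /\<^sub>R (w \<bullet> v)"
    using assms by (simp add: field_simps)
  then show ?thesis using assms by (simp only: T_def mem_Collect_eq) simp
qed

lemma T_normalize: "v \<in> T \<Longrightarrow> (1 / (w \<bullet> v)) *\<^sub>R v \<in> U"
  by (simp add: T_def inverse_eq_divide)

lemma T_add:
  assumes "v \<in> T" "v' \<in> T"
  shows "v + v' \<in> T"
proof -
  define s s' where "s = w \<bullet> v" and "s' = w \<bullet> v'"
  have s: "0 < s" "0 < s'" using assms by (auto simp: s_def s'_def T_def)
  have "(s / (s + s')) *\<^sub>R (v /\<^sub>R s) + (s' / (s + s')) *\<^sub>R (v' /\<^sub>R s') \<in> U"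
    using assms s by (intro convexD[OF convex_U]) (auto simp: T_def s_def s'_def simp flip: add_divide_distrib)
  also have "(s / (s + s')) *\<^sub>R (v /\<^sub>R s) + (s' / (s + s')) *\<^sub>R (v' /\<^sub>R s') = (v + v') /\<^sub>R (s + s')"
  proof -
    have "s / (s + s') * inverse s = inverse (s + s')" "s' / (s + s') * inverse s' = inverse (s + s')"
      using s by (auto simp: field_simps)
    then show ?thesis by (simp only: scaleR_scaleR scaleR_add_right)
  qed
  finally show ?thesis using s by (simp add: T_def s_def s'_def inner_add_right)
qed

lemma open_T: "open T"
proof -
  obtain O' where O': "open O'" "U = {v. w \<bullet> v = 1} \<inter> O'"
    using openin_U by (auto simp: openin_open)
  let ?H = "{v. 0 < w \<bullet> v}" and ?f = "\<lambda>v. v /\<^sub>R (w \<bullet> v)"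
  have "open ?H" by (simp add: open_halfspace_gt)
  moreover have "continuous_on ?H ?f" by (intro continuous_intros) auto
  ultimately have "open (?H \<inter> ?f -` O')" using O'(1) by (intro continuous_open_preimage)
  also have "?H \<inter> ?f -` O' = T"
  proof -
    have "v \<in> U \<longleftrightarrow> w \<bullet> v = 1 \<and> v \<in> O'" for v using O'(2) by blast
    then show ?thesis by (auto simp: T_def)
  qed
  finally show ?thesis .
qed

text \<open>On the closed cone the norm is controlled by the linear form \<open>w\<close>, hence
  monotone up to a constant when cone vectors are added. This is how boundedness of the domain
  enters the estimates.\<close>

lemma exists_norm_bound:
  obtains B where "0 < B" "\<And>v. v \<in> closure T \<Longrightarrow> norm v \<le> B * (w \<bullet> v)"
proof -
  obtain B where B: "0 < B" "\<And>u. u \<in> U \<Longrightarrow> norm u \<le> B"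
    using bounded_U by (auto simp: bounded_pos)
  have "closure T \<subseteq> {v. norm v \<le> B * (w \<bullet> v)}"
  proof (rule closure_minimal)
    show "T \<subseteq> {v. norm v \<le> B * (w \<bullet> v)}"
    proof safe
      fix v assume v: "v \<in> T"
      then have "v /\<^sub>R (w \<bullet> v) \<in> U" by (simp add: T_def)
      from B(2)[OF this] show "norm v \<le> B * (w \<bullet> v)"
        using w_T[OF v] by (simp add: field_simps)
    qed
    show "closed {v. norm v \<le> B * (w \<bullet> v)}" by (intro closed_Collect_le continuous_intros)
  qed
  with B that show ?thesis by blast
qed

lemma T_add_closure:
  assumes "p \<in> T" "q \<in> closure T"
  shows "p + q \<in> T"
proof -
  obtain e where e: "0 < e" "ball p e \<subseteq> T"
    using open_T assms(1) by (auto simp: open_contains_ball)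
  obtain q' where q': "q' \<in> T" "dist q' q < e"
    using assms(2) e(1) by (auto simp: closure_approachable)
  have "p + (q - q') \<in> T" using e q' by (auto simp: dist_norm norm_minus_commute subset_eq)
  from T_add[OF this q'(1)] show ?thesis by simp
qed

text \<open>Membership in the closure is tested along one interior direction, which reduces the
  algebra of the closed cone to that of \<open>T\<close>.\<close>

lemma closure_T_iff:
  assumes "p \<in> T"
  shows "q \<in> closure T \<longleftrightarrow> (\<forall>\<epsilon>>0. q + \<epsilon> *\<^sub>R p \<in> T)"
proof safe
  fix \<epsilon> :: real assume "q \<in> closure T" "0 < \<epsilon>"
  then show "q + \<epsilon> *\<^sub>R p \<in> T"
    using T_add_closure[OF T_scale[OF assms]] by (simp add: add.commute)
next
  assume *: "\<forall>\<epsilon>>0. q + \<epsilon> *\<^sub>R p \<in> T"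
  have "((\<lambda>\<epsilon>. q + \<epsilon> *\<^sub>R p) \<longlongrightarrow> q + 0 *\<^sub>R p) (at_right 0)"
    by (intro tendsto_intros)
  then have "((\<lambda>\<epsilon>. q + \<epsilon> *\<^sub>R p) \<longlongrightarrow> q) (at_right 0)"
    by simp
  moreover have "\<forall>\<^sub>F \<epsilon> in at_right (0::real). q + \<epsilon> *\<^sub>R p \<in> closure T"
    using * closure_subset by (auto simp: eventually_at_filter intro!: always_eventually)
  ultimately show "q \<in> closure T"
    by (rule Lim_in_closed_set[OF closed_closure, rotated 2]) auto
qed

lemma closure_T_add:
  assumes "p \<in> closure T" "q \<in> closure T"
  shows "p + q \<in> closure T"
proof -
  obtain u where u: "u \<in> T" using U_nonempty U_subset_T by blast
  have "p + q + \<epsilon> *\<^sub>R u \<in> T" if "0 < \<epsilon>" for \<epsilon>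
  proof -
    have "p + (\<epsilon>/2) *\<^sub>R u \<in> T" "q + (\<epsilon>/2) *\<^sub>R u \<in> T"
      using assms that closure_T_iff[OF u] by auto
    from T_add[OF this] show ?thesis
      by (simp add: algebra_simps flip: scaleR_add_left)
  qed
  then show ?thesis using closure_T_iff[OF u] by blast
qed

lemma zero_in_closure_T: "0 \<in> closure T"
proof -
  obtain u where u: "u \<in> T" using U_nonempty U_subset_T by blast
  then show ?thesis using closure_T_iff[OF u] T_scale by simp
qed

lemma closure_T_scale:
  assumes "p \<in> closure T" "0 \<le> a"
  shows "a *\<^sub>R p \<in> closure T"
proof (cases "a = 0")
  case False
  with assms have a: "0 < a" by simp
  obtain u where u: "u \<in> T" using U_nonempty U_subset_T by blast
  have "a *\<^sub>R p + \<epsilon> *\<^sub>R u \<in> T" if "0 < \<epsilon>" for \<epsilon>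
  proof -
    have "p + (\<epsilon> / a) *\<^sub>R u \<in> T" using assms that a closure_T_iff[OF u] by simp
    from T_scale[OF this a] a show ?thesis by (simp add: scaleR_add_right)
  qed
  then show ?thesis using closure_T_iff[OF u] by blast
qed (simp add: zero_in_closure_T)

lemma w_closure_U: "x \<in> closure U \<Longrightarrow> w \<bullet> x = 1"
  using closure_minimal[of U "{v. w \<bullet> v = 1}"] w_U by (auto simp: closed_hyperplane)

lemma closure_U_subset: "closure U \<subseteq> closure T"
  by (rule closure_mono[OF U_subset_T])

lemma nonneg_closure_T:
  assumes "\<And>u. u \<in> U \<Longrightarrow> 0 \<le> \<phi> \<bullet> u" "v \<in> closure T"
  shows "0 \<le> \<phi> \<bullet> v"
proof -
  have "closure T \<subseteq> {v. 0 \<le> \<phi> \<bullet> v}"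
  proof (rule closure_minimal)
    show "T \<subseteq> {v. 0 \<le> \<phi> \<bullet> v}"
    proof safe
      fix v assume v: "v \<in> T"
      then show "0 \<le> \<phi> \<bullet> v" using assms(1)[OF T_normalize[OF v]] w_T[OF v]
        by (simp add: zero_le_divide_iff)
    qed
    show "closed {v. 0 \<le> \<phi> \<bullet> v}" by (simp add: closed_halfspace_ge)
  qed
  then show ?thesis using assms(2) by auto
qed

section \<open>Uniform positivity on compact subsets of the domain\<close>

lemma compact_margin:
  assumes "compact Q" "Q \<subseteq> U"
  obtains e where "0 < e" "\<And>q v. q \<in> Q \<Longrightarrow> norm v < e \<Longrightarrow> q + v \<in> T"
proof -
  obtain e where "0 < e" "(\<Union>x\<in>Q. ball x e) \<subseteq> T"
    using compact_subset_open_imp_ball_epsilon_subset[OF assms(1) open_T] assms(2) U_subset_T by auto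
  then show ?thesis by (intro that[of e]) (force simp: dist_norm)+
qed

text \<open>Move \<open>q\<close> by half the margin against the direction of \<phi>. The moved
  point is still in the cone, and nonnegativity there leaves a proportion of
  \<open>norm \<phi>\<close> at \<open>q\<close>.\<close>

lemma functional_lower_bound:
  assumes "compact Q" "Q \<subseteq> U"
  obtains c where "0 < c" "\<And>\<phi> q. (\<And>u. u \<in> U \<Longrightarrow> 0 \<le> \<phi> \<bullet> u) \<Longrightarrow> q \<in> Q \<Longrightarrow> c * norm \<phi> \<le> \<phi> \<bullet> q"
proof -
  obtain e where e: "0 < e" "\<And>q v. q \<in> Q \<Longrightarrow> norm v < e \<Longrightarrow> q + v \<in> T"
    using compact_margin[OF assms] by blast
  show ?thesis
  proof (rule that[of "e/2"])
    show "e/2 * norm \<phi> \<le> \<phi> \<bullet> q"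
      if \<phi>: "\<And>u. u \<in> U \<Longrightarrow> 0 \<le> \<phi> \<bullet> u" and q: "q \<in> Q" for \<phi> q
    proof (cases "\<phi> = 0")
      case False
      have "q + - (e / (2 * norm \<phi>)) *\<^sub>R \<phi> \<in> T"
        using e(1) False by (intro e(2) q) simp
      then have "0 \<le> \<phi> \<bullet> (q + - (e / (2 * norm \<phi>)) *\<^sub>R \<phi>)"
        by (intro nonneg_closure_T[OF \<phi>]) (use closure_subset in auto)
      also have "\<dots> = \<phi> \<bullet> q - e / 2 * norm \<phi>"
        using False by (simp add: inner_add_right inner_diff_right dot_square_norm power2_eq_square)
      finally show ?thesis by simp
    qed simp
  qed (use e in simp)
qed

text \<open>For small y both \<open>q + y\<close> and \<open>q - y\<close> lie in the cone, so 2 h y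
  is a difference of cone vectors whose \<open>w\<close>-values add up to twice that of h q. Such
  values therefore control the full operator norm.\<close>

lemma positive_map_lower_bound:
  assumes "compact Q" "Q \<subseteq> U"
  obtains c where "0 < c"
    "\<And>h q. (\<And>v. v \<in> T \<Longrightarrow> h *v v \<in> T) \<Longrightarrow> q \<in> Q \<Longrightarrow> c * onorm ((*v) h) \<le> w \<bullet> (h *v q)"
proof -
  obtain e where e: "0 < e" "\<And>q v. q \<in> Q \<Longrightarrow> norm v < e \<Longrightarrow> q + v \<in> T"
    using compact_margin[OF assms] by blast
  obtain B where B: "0 < B" "\<And>v. v \<in> closure T \<Longrightarrow> norm v \<le> B * (w \<bullet> v)"
    using exists_norm_bound by blast
  show ?thesis
  proof (rule that[of "e / (2 * B)"])
    fix h :: "real^'n^'n" and q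
    assume h: "\<And>v. v \<in> T \<Longrightarrow> h *v v \<in> T" and q: "q \<in> Q"
    have wq: "0 < w \<bullet> (h *v q)" using h[of q] q assms(2) U_subset_T w_T by blast
    have "onorm ((*v) h) \<le> 2 * B / e * (w \<bullet> (h *v q))"
    proof (rule onorm_le)
      fix v :: "real^'n"
      show "norm (h *v v) \<le> 2 * B / e * (w \<bullet> (h *v q)) * norm v"
      proof (cases "v = 0")
        case False
        define y where "y = (e / (2 * norm v)) *\<^sub>R v"
        have ny: "norm y < e" using e(1) False by (simp add: y_def)
        have "q + y \<in> T" "q + - y \<in> T" using e(2)[OF q, of y] e(2)[OF q, of "- y"] ny by auto
        then have hT: "h *v (q + y) \<in> closure T" "h *v (q - y) \<in> closure T"
          using h closure_subset by auto
        have "2 * norm (h *v y) = norm (h *v (q + y) - h *v (q - y))"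
          by (simp add: matrix_vector_right_distrib matrix_vector_mult_diff_distrib flip: scaleR_2)
        also have "\<dots> \<le> B * (w \<bullet> (h *v (q + y))) + B * (w \<bullet> (h *v (q - y)))"
          using B(2)[OF hT(1)] B(2)[OF hT(2)] norm_triangle_ineq4[of "h *v (q + y)" "h *v (q - y)"] by linarith
        also have "\<dots> = 2 * (B * (w \<bullet> (h *v q)))"
          by (simp add: matrix_vector_right_distrib matrix_vector_mult_diff_distrib
              inner_add_right inner_diff_right algebra_simps)
        finally have "norm (h *v y) \<le> B * (w \<bullet> (h *v q))" by simp
        moreover have "norm (h *v y) = e / (2 * norm v) * norm (h *v v)"
          using e(1) by (simp add: y_def matrix_vector_mult_scaleR)
        ultimately show ?thesis using e(1) False by (simp add: field_simps)
      qed simp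
    qed
    then show "e / (2 * B) * onorm ((*v) h) \<le> w \<bullet> (h *v q)"
      using e(1) B(1) by (simp add: field_simps)
  qed (use e(1) B(1) in simp)
qed

text \<open>Separate \<open>y\<close> from the whole cone instead of from \<open>U\<close>. Scaling
  cone vectors up forces the functional to be nonnegative on \<open>T\<close>, scaling them down
  forces the level \<open>b\<close> to be at most 0, so the functional vanishes at
  \<open>y\<close>.\<close>

lemma supporting_functional:
  assumes "y \<in> closure U" "y \<notin> U"
  obtains \<phi> where "\<phi> \<noteq> 0" "\<phi> \<bullet> y = 0" "\<And>u. u \<in> U \<Longrightarrow> 0 < \<phi> \<bullet> u"
proof -
  have yT: "y \<notin> T" using assms w_closure_U T_iff_U by blast
  have "convex T"
  proof (rule convexI)
    fix x y :: "real^'n" and u v :: real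
    assume *: "x \<in> T" "y \<in> T" "0 \<le> u" "0 \<le> v" "u + v = 1"
    show "u *\<^sub>R x + v *\<^sub>R y \<in> T"
    proof (cases "u = 0 \<or> v = 0")
      case True then show ?thesis using * by auto
    next
      case False then show ?thesis using * by (intro T_add T_scale) auto
    qed
  qed
  moreover obtain u0 where u0: "u0 \<in> T" using U_nonempty U_subset_T by blast
  ultimately obtain a b where a: "a \<noteq> 0" "a \<bullet> y \<le> b" "\<And>v. v \<in> T \<Longrightarrow> b \<le> a \<bullet> v"
    using separating_hyperplane_sets[of "{y}" T] yT by auto
  have aT: "0 \<le> a \<bullet> v" if v: "v \<in> T" for v
  proof (rule ccontr)
    assume neg: "\<not> 0 \<le> a \<bullet> v"
    define k where "k = (\<bar>b\<bar> + 1) / - (a \<bullet> v)"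
    have "0 < k" unfolding k_def using neg by (intro divide_pos_pos) linarith+
    then have "b \<le> k * (a \<bullet> v)" using a(3)[OF T_scale[OF v]] by simp
    also have "\<dots> = - (\<bar>b\<bar> + 1)" using neg by (auto simp: k_def)
    finally show False by linarith
  qed
  have "b \<le> 0"
  proof (rule ccontr)
    assume "\<not> b \<le> 0"
    then have b: "0 < b" by simp
    then have pos: "0 < a \<bullet> u0" using a(3)[OF u0] by simp
    have "b \<le> a \<bullet> ((b / (2 * (a \<bullet> u0))) *\<^sub>R u0)"
      using b pos by (intro a(3) T_scale u0) simp
    then show False using b pos by simp
  qed
  moreover have "0 \<le> a \<bullet> y"
    using nonneg_closure_T[of a y] aT assms(1) closure_U_subset U_subset_T by blast
  ultimately have "a \<bullet> y = 0" using a(2) by simp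
  moreover have "0 < a \<bullet> u" if "u \<in> U" for u
  proof (rule functional_lower_bound[of "{u}"])
    fix c :: real
    assume c: "0 < c" "\<And>\<phi> q. (\<And>u. u \<in> U \<Longrightarrow> 0 \<le> \<phi> \<bullet> u) \<Longrightarrow> q \<in> {u} \<Longrightarrow> c * norm \<phi> \<le> \<phi> \<bullet> q"
    have "0 < c * norm a" using a(1) c(1) by simp
    also have "\<dots> \<le> a \<bullet> u" by (rule c(2)) (use aT U_subset_T in auto)
    finally show ?thesis .
  qed (use that in auto)
  ultimately show ?thesis using that a(1) by blast
qed

section \<open>The Hilbert distance through the order of the cone\<close>

definition ext :: "real^'n \<Rightarrow> real^'n \<Rightarrow> real" where
  "ext x y = Sup {s. 0 \<le> s \<and> x + s *\<^sub>R (x - y) \<in> U}"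

lemma ext_facts:
  assumes "x \<in> U" "y \<in> U" "x \<noteq> y"
  shows ext_pos: "0 < ext x y"
    and ext_upper: "\<And>s. 0 \<le> s \<Longrightarrow> x + s *\<^sub>R (x - y) \<in> U \<Longrightarrow> s \<le> ext x y"
    and ext_closure: "x + ext x y *\<^sub>R (x - y) \<in> closure U"
proof -
  let ?S = "{s. 0 \<le> s \<and> x + s *\<^sub>R (x - y) \<in> U}"
  obtain B where B: "\<And>u. u \<in> U \<Longrightarrow> norm u \<le> B"
    using bounded_U by (auto simp: bounded_iff)
  have "s \<le> (B + norm x) / norm (x - y)" if "s \<in> ?S" for s
  proof -
    have "norm (s *\<^sub>R (x - y)) \<le> norm (x + s *\<^sub>R (x - y)) + norm x"
      by (metis add_diff_cancel_left' norm_triangle_ineq4 add.commute)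
    then have "s * norm (x - y) \<le> B + norm x" using that B[of "x + s *\<^sub>R (x - y)"] by auto
    then show ?thesis using assms by (simp add: pos_le_divide_eq)
  qed
  then have bdd: "bdd_above ?S" by (auto simp: bdd_above_def)
  show up: "s \<le> ext x y" if "0 \<le> s" "x + s *\<^sub>R (x - y) \<in> U" for s
    unfolding ext_def using that bdd by (intro cSup_upper) auto
  obtain e where e: "0 < e" "\<And>v. norm v < e \<Longrightarrow> x + v \<in> T"
  proof (rule compact_margin[of "{x}"])
    fix e :: real assume "0 < e" "\<And>q v. q \<in> {x} \<Longrightarrow> norm v < e \<Longrightarrow> q + v \<in> T"
    then show ?thesis using that[of e] by blast
  qed (use assms in auto)
  define s where "s = e / (2 * norm (x - y))"
  have s: "0 < s" using e assms by (simp add: s_def)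
  have "x + s *\<^sub>R (x - y) \<in> T" using e(1) assms by (intro e(2)) (simp add: s_def)
  moreover have "w \<bullet> (x + s *\<^sub>R (x - y)) = 1"
    using assms w_U by (simp add: inner_add_right inner_diff_right)
  ultimately have "x + s *\<^sub>R (x - y) \<in> U" using T_iff_U by blast
  with s up[of s] show "0 < ext x y" by simp
  have "?S \<noteq> {}" using assms by (auto intro!: exI[of _ 0])
  then have "ext x y \<in> closure ?S" unfolding ext_def using bdd by (rule closure_contains_Sup)
  then have "x + ext x y *\<^sub>R (x - y) \<in> (\<lambda>s. x + s *\<^sub>R (x - y)) ` closure ?S"
    by blast
  also have "\<dots> \<subseteq> closure ((\<lambda>s. x + s *\<^sub>R (x - y)) ` ?S)"
    by (rule image_closure_subset[OF _ closed_closure closure_subset]) (intro continuous_intros)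
  also have "\<dots> \<subseteq> closure U" by (rule closure_mono) auto
  finally show "x + ext x y *\<^sub>R (x - y) \<in> closure U" .
qed

text \<open>The exponential of the Funk distance: the least m with m y - x in the closed cone, by
  \<open>M_attained\<close> and \<open>M_least\<close>. The diagonal is separate because
  \<open>ext x x\<close> is then the \<open>Sup\<close> of an unbounded set.\<close>

definition M :: "real^'n \<Rightarrow> real^'n \<Rightarrow> real" where
  "M x y = (if x = y then 1 else 1 + 1 / ext y x)"

lemma M_ge_1: "x \<in> U \<Longrightarrow> y \<in> U \<Longrightarrow> 1 \<le> M x y"
  using ext_pos[of y x] by (auto simp: M_def less_imp_le)

lemma M_attained:
  assumes "x \<in> U" "y \<in> U"
  shows "M x y *\<^sub>R y - x \<in> closure T"
proof (cases "x = y")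
  case True
  then show ?thesis by (simp add: M_def zero_in_closure_T)
next
  case False
  let ?b = "ext y x"
  have b: "0 < ?b" and "y + ?b *\<^sub>R (y - x) \<in> closure T"
    using ext_pos[of y x] ext_closure[of y x] assms False closure_U_subset by auto
  then have "(1 / ?b) *\<^sub>R (y + ?b *\<^sub>R (y - x)) \<in> closure T"
    by (intro closure_T_scale) auto
  also have "(1 / ?b) *\<^sub>R (y + ?b *\<^sub>R (y - x)) = M x y *\<^sub>R y - x"
    using b False by (simp add: M_def scaleR_add_left scaleR_add_right scaleR_diff_right)
  finally show ?thesis .
qed

lemma M_least:
  assumes "x \<in> U" "y \<in> U" "m *\<^sub>R y - x \<in> closure T"
  shows "M x y \<le> m"
proof -
  obtain B where B: "0 < B" "\<And>v. v \<in> closure T \<Longrightarrow> norm v \<le> B * (w \<bullet> v)"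
    using exists_norm_bound by blast
  have wm: "w \<bullet> (m *\<^sub>R y - x) = m - 1" using assms w_U by (simp add: inner_diff_right)
  have nb: "norm (m *\<^sub>R y - x) \<le> B * (m - 1)" using B(2)[OF assms(3)] by (simp add: wm)
  have m1: "1 \<le> m"
  proof -
    have "0 \<le> B * (m - 1)" by (rule order_trans[OF norm_ge_zero nb])
    then show ?thesis using B(1) by (simp add: zero_le_mult_iff)
  qed
  show ?thesis
  proof (cases "x = y")
    case True
    then show ?thesis using m1 by (simp add: M_def)
  next
    case False
    have "m \<noteq> 1"
    proof
      assume "m = 1"
      with nb have "norm (y - x) \<le> 0" by simp
      with False show False by simp
    qed
    with m1 have m: "0 < m - 1" by simp
    \<comment> \<open>\<open>ext\<close> is a supremum over the open domain, the hypothesis concerns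
      the closed cone. Enlarging \<open>m\<close> to m' adds an interior vector; density brings m'
      back to \<open>m\<close> at the end.\<close>
    have ext_ge: "1 / (m' - 1) \<le> ext y x" if m': "m < m'" for m'
    proof (rule ext_upper)
      have "(m' - m) *\<^sub>R y + (m *\<^sub>R y - x) \<in> T"
        using assms m' U_subset_T by (intro T_add_closure T_scale) auto
      also have "(m' - m) *\<^sub>R y + (m *\<^sub>R y - x) = (m' - 1) *\<^sub>R y + (y - x)"
        by (simp add: scaleR_diff_left)
      finally have "(1 / (m' - 1)) *\<^sub>R ((m' - 1) *\<^sub>R y + (y - x)) \<in> T"
        using m' m by (intro T_scale) auto
      also have "(1 / (m' - 1)) *\<^sub>R ((m' - 1) *\<^sub>R y + (y - x)) = y + (1 / (m' - 1)) *\<^sub>R (y - x)"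
      proof -
        have "1 / (m' - 1) * (m' - 1) = 1" using m' m by simp
        then show ?thesis by (simp only: scaleR_add_right scaleR_scaleR scaleR_one)
      qed
      finally show "y + (1 / (m' - 1)) *\<^sub>R (y - x) \<in> U"
        using assms w_U by (subst T_iff_U[symmetric]) (simp_all add: inner_add_right inner_diff_right)
    qed (use assms False m m' in auto)
    have "M x y \<le> m'" if m': "m < m'" for m'
    proof -
      have "1 / ext y x \<le> m' - 1"
        using ext_ge[OF m'] m' m ext_pos[of y x] assms False by (simp add: pos_divide_le_eq mult.commute)
      then show ?thesis using False by (simp add: M_def)
    qed
    then show ?thesis by (rule dense_ge)
  qed
qed

lemma M_functional:
  assumes "x \<in> U" "y \<in> U" "\<And>u. u \<in> U \<Longrightarrow> 0 \<le> \<phi> \<bullet> u"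
  shows "\<phi> \<bullet> x \<le> M x y * (\<phi> \<bullet> y)"
  using nonneg_closure_T[OF assms(3) M_attained[OF assms(1,2)]] by (simp add: inner_diff_right)

lemma M_submult:
  assumes "x \<in> U" "y \<in> U" "z \<in> U"
  shows "M x z \<le> M x y * M y z"
proof (rule M_least)
  have "M x y *\<^sub>R (M y z *\<^sub>R z - y) + (M x y *\<^sub>R y - x) \<in> closure T"
    using assms M_ge_1[of x y] by (intro closure_T_add closure_T_scale M_attained) auto
  then show "(M x y * M y z) *\<^sub>R z - x \<in> closure T" by (simp add: scaleR_diff_right)
qed (use assms in auto)

text \<open>The cross-ratio factors over the two exits of the line, and each factor 1 + 1 / ext is a
  Funk ratio. The metric can then be handled by cone inequalities and positive functionals.\<close>

lemma hilbert_dist_eq_ln_M: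
  assumes "x \<in> U" "y \<in> U"
  shows "hilbert_dist U x y = ln (M x y * M y x) / 2"
proof (cases "x = y")
  case True
  then show ?thesis by (simp add: hilbert_dist_def M_def)
next
  case False
  define s t where "s = ext x y" and "t = ext y x"
  have st: "0 < s" "0 < t" using ext_pos assms False by (auto simp: s_def t_def)
  define a b where "a = x + s *\<^sub>R (x - y)" and "b = y + t *\<^sub>R (y - x)"
  define r where "r = norm (x - y)"
  have r: "0 < r" using False by (simp add: r_def)
  have "x - b = (1 + t) *\<^sub>R (x - y)" "a - y = (1 + s) *\<^sub>R (x - y)" "a - x = s *\<^sub>R (x - y)" "y - b = t *\<^sub>R (x - y)"
    by (simp_all add: a_def b_def algebra_simps)
  then have "dist x b = (1 + t) * r" "dist a y = (1 + s) * r" "dist a x = s * r" "dist y b = t * r"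
    using st by (simp_all add: dist_norm r_def)
  then have "(dist x b * dist a y) / (dist a x * dist y b) = (1 + 1/t) * (1 + 1/s)"
    using st r by (simp add: field_simps)
  also have "\<dots> = M x y * M y x" using False by (simp add: M_def s_def t_def)
  finally show ?thesis
    using False unfolding hilbert_dist_def Let_def a_def b_def s_def t_def ext_def by simp
qed

lemma hilbert_dist_sym: "x \<in> U \<Longrightarrow> y \<in> U \<Longrightarrow> hilbert_dist U x y = hilbert_dist U y x"
  by (simp add: hilbert_dist_eq_ln_M mult.commute)

lemma hilbert_dist_upper:
  assumes "x \<in> U" "y \<in> U" "m *\<^sub>R y - x \<in> closure T" "m' *\<^sub>R x - y \<in> closure T"
  shows "2 * hilbert_dist U x y \<le> ln (m * m')"
proof -
  have "M x y \<le> m" "M y x \<le> m'" using M_least assms by auto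
  then have "M x y * M y x \<le> m * m'"
    using M_ge_1[OF assms(1,2)] M_ge_1[OF assms(2,1)] by (intro mult_mono) auto
  moreover have "0 < M x y * M y x" using M_ge_1[OF assms(1,2)] M_ge_1[OF assms(2,1)] by simp
  ultimately show ?thesis using assms by (simp add: hilbert_dist_eq_ln_M)
qed

lemma hilbert_dist_lower:
  assumes "x \<in> U" "y \<in> U" "\<And>u. u \<in> U \<Longrightarrow> 0 < \<phi> \<bullet> u" "\<And>u. u \<in> U \<Longrightarrow> 0 < \<psi> \<bullet> u"
  shows "ln (((\<phi> \<bullet> x) / (\<phi> \<bullet> y)) * ((\<psi> \<bullet> y) / (\<psi> \<bullet> x))) \<le> 2 * hilbert_dist U x y"
proof -
  have "(\<phi> \<bullet> x) / (\<phi> \<bullet> y) \<le> M x y" "(\<psi> \<bullet> y) / (\<psi> \<bullet> x) \<le> M y x"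
    using M_functional[of x y \<phi>] M_functional[of y x \<psi>] assms
      by (simp_all add: pos_divide_le_eq less_imp_le)
  moreover have "0 < (\<phi> \<bullet> x) / (\<phi> \<bullet> y)" "0 < (\<psi> \<bullet> y) / (\<psi> \<bullet> x)"
    using assms by auto
  ultimately have "((\<phi> \<bullet> x) / (\<phi> \<bullet> y)) * ((\<psi> \<bullet> y) / (\<psi> \<bullet> x)) \<le> M x y * M y x"
    by (intro mult_mono) auto
  moreover have "0 < ((\<phi> \<bullet> x) / (\<phi> \<bullet> y)) * ((\<psi> \<bullet> y) / (\<psi> \<bullet> x))"
    using assms by simp
  ultimately have "ln (((\<phi> \<bullet> x) / (\<phi> \<bullet> y)) * ((\<psi> \<bullet> y) / (\<psi> \<bullet> x))) \<le> ln (M x y * M y x)"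
    by (intro ln_mono)
  then show ?thesis using hilbert_dist_eq_ln_M[OF assms(1,2)] by simp
qed

text \<open>Explicit cone vectors give the upper bounds \<open>k\<close> and m / k for the two
  ratios. Their product is \<open>m\<close>, so \<open>M_submult\<close> leaves no room for either
  to be smaller.\<close>

lemma M_segment:
  assumes "x \<in> U" "y \<in> U" "0 \<le> \<tau>" "\<tau> \<le> 1" and v: "v = (1 - \<tau>) *\<^sub>R x + \<tau> *\<^sub>R y"
  shows "v \<in> U" "M v y = \<tau> + (1 - \<tau>) * M x y" "M x v = M x y / (\<tau> + (1 - \<tau>) * M x y)"
proof -
  show vU: "v \<in> U" unfolding v using assms convex_U by (intro convexD) auto
  define m where "m = M x y"
  have m: "1 \<le> m" using M_ge_1 assms by (simp add: m_def)
  define k where "k = \<tau> + (1 - \<tau>) * m"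
  have "(1 - \<tau>) * 1 \<le> (1 - \<tau>) * m" using assms m by (intro mult_left_mono) auto
  then have k: "1 \<le> k" by (simp add: k_def)
  have cl: "m *\<^sub>R y - x \<in> closure T" using M_attained assms by (simp add: m_def)
  have "M v y \<le> k"
  proof (rule M_least[OF vU assms(2)])
    have "(1 - \<tau>) *\<^sub>R (m *\<^sub>R y - x) \<in> closure T"
      using cl assms by (intro closure_T_scale) auto
    then show "k *\<^sub>R y - v \<in> closure T" by (simp add: k_def v algebra_simps)
  qed
  moreover have "M x v \<le> m / k"
  proof (rule M_least[OF assms(1) vU])
    have "(\<tau> / k) *\<^sub>R (m *\<^sub>R y - x) \<in> closure T"
      using cl assms k by (intro closure_T_scale) auto
    also have "(\<tau> / k) *\<^sub>R (m *\<^sub>R y - x) = (m / k) *\<^sub>R v - x"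
    proof -
      have "m / k * (1 - \<tau>) - 1 = - (\<tau> / k)"
        using k by (simp add: field_simps) (simp add: k_def algebra_simps)
      then have "(m / k * (1 - \<tau>)) *\<^sub>R x - x = - (\<tau> / k) *\<^sub>R x"
        by (metis scaleR_diff_left scaleR_one)
      moreover have "(m / k) *\<^sub>R v - x = ((m / k * (1 - \<tau>)) *\<^sub>R x - x) + (\<tau> / k * m) *\<^sub>R y"
        by (simp add: v scaleR_add_right mult.commute)
      ultimately show ?thesis by (simp add: scaleR_diff_right)
    qed
    finally show "(m / k) *\<^sub>R v - x \<in> closure T" .
  qed
  moreover have "m \<le> M x v * M v y" using M_submult[OF assms(1) vU assms(2)] by (simp add: m_def)
  moreover have "1 \<le> M x v" "1 \<le> M v y" using M_ge_1 assms vU by auto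
  ultimately show "M v y = \<tau> + (1 - \<tau>) * M x y" "M x v = M x y / (\<tau> + (1 - \<tau>) * M x y)"
    unfolding m_def[symmetric] k_def[symmetric]
  proof -
    assume *: "M v y \<le> k" "M x v \<le> m / k" "m \<le> M x v * M v y" "1 \<le> M x v" "1 \<le> M v y"
    have a: "k * M x v \<le> m" using *(2) k by (simp add: field_simps)
    have b: "M x v * M v y \<le> M x v * k" using * by (intro mult_left_mono) auto
    have eq: "M x v * k = m" using a b *(3) by (simp add: mult.commute)
    then show "M x v = m / k" using k by (simp add: field_simps)
    have "M x v * M v y = M x v * k" using b *(3) eq by linarith
    then show "M v y = k" using *(4) by simp
  qed
qed

text \<open>Written out in \<tau> so that continuity along the segment is visible, for the
  intermediate value argument in \<open>gromov_segment_far\<close>.\<close>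

lemma hilbert_dist_segment:
  assumes "x \<in> U" "y \<in> U" "0 \<le> \<tau>" "\<tau> \<le> 1"
  shows "hilbert_dist U ((1 - \<tau>) *\<^sub>R x + \<tau> *\<^sub>R y) y =
    ln ((\<tau> + (1 - \<tau>) * M x y) * (M y x / ((1 - \<tau>) + \<tau> * M y x))) / 2"
proof -
  let ?v = "(1 - \<tau>) *\<^sub>R x + \<tau> *\<^sub>R y"
  have "?v \<in> U" "M ?v y = \<tau> + (1 - \<tau>) * M x y" using M_segment(1,2)[OF assms refl] by auto
  moreover have "M y ?v = M y x / ((1 - \<tau>) + \<tau> * M y x)"
    using M_segment(3)[OF assms(2,1), of "1 - \<tau>" ?v] assms by (simp add: add.commute)
  ultimately show ?thesis using assms by (simp add: hilbert_dist_eq_ln_M)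
qed

text \<open>Both Funk ratios are multiplicative along a segment, which makes straight segments
  geodesic.\<close>

lemma hilbert_dist_segment_add:
  assumes "x \<in> U" "y \<in> U" "0 \<le> \<tau>" "\<tau> \<le> 1" and v: "v = (1 - \<tau>) *\<^sub>R x + \<tau> *\<^sub>R y"
  shows "hilbert_dist U x v + hilbert_dist U v y = hilbert_dist U x y"
proof -
  have vU: "v \<in> U" using M_segment(1)[OF assms] .
  have 1: "M x v * M v y = M x y"
  proof -
    have "M x v = M x y / M v y" using M_segment(2,3)[OF assms] by simp
    then show ?thesis using M_ge_1[OF vU assms(2)] by simp
  qed
  have v': "v = (1 - (1 - \<tau>)) *\<^sub>R y + (1 - \<tau>) *\<^sub>R x" using v by simp
  have 2: "M y v * M v x = M y x"
  proof -
    have "M y v = M y x / M v x" using M_segment(2,3)[OF assms(2,1) _ _ v'] assms by simp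
    then show ?thesis using M_ge_1[OF vU assms(1)] by simp
  qed
  have ge: "1 \<le> M x v" "1 \<le> M v y" "1 \<le> M y v" "1 \<le> M v x" using M_ge_1 vU assms by auto
  then have "ln (M x y * M y x) = ln (M x v * M v x) + ln (M v y * M y v)"
    unfolding 1[symmetric] 2[symmetric] by (simp add: ln_mult)
  then show ?thesis using vU assms by (simp add: hilbert_dist_eq_ln_M add_divide_distrib)
qed

text \<open>The point \<open>v\<close> of the segment chosen
  by the intermediate value theorem is the one at which
  the two Gromov products in the hyperbolicity inequality coincide.\<close>
lemma gromov_segment_far:
  assumes hyp: "\<And>x y z. x \<in> U \<Longrightarrow> y \<in> U \<Longrightarrow> z \<in> U \<Longrightarrow>
      min (gromov_product (hilbert_dist U) p x y) (gromov_product (hilbert_dist U) p y z) - \<delta>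
        \<le> gromov_product (hilbert_dist U) p x z"
    and "0 \<le> \<delta>" and U: "p \<in> U" "g \<in> U" "z \<in> U"
    and far: "\<And>v. v \<in> closed_segment g z \<Longrightarrow> hilbert_dist U p z - c \<le> hilbert_dist U p v"
  shows "hilbert_dist U p z + hilbert_dist U z g - (2 * c + 4 * \<delta>) \<le> hilbert_dist U p g"
proof -
  let ?d = "hilbert_dist U"
  \<comment> \<open>Twice the difference of the Gromov products of (g, v) and (v, z) at
    \<open>p\<close>.\<close>
  define f where "f \<tau> = ?d p g + ?d ((1 - \<tau>) *\<^sub>R g + \<tau> *\<^sub>R z) z - ?d p z - ?d ((1 - \<tau>) *\<^sub>R g + \<tau> *\<^sub>R z) g" for \<tau>
  have "0 \<le> c" using far[of z] by simp
  have dzz: "?d u u = 0" for u by (simp add: hilbert_dist_def)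
  show ?thesis
  \<comment> \<open>The two signs are triangle inequalities, for v = g and v = z. Where one fails,
    the claim follows at once from the failed inequality and \<open>far\<close>.\<close>
  proof (cases "0 \<le> f 0 \<and> f 1 \<le> 0")
    case False
    then show ?thesis
    proof (cases "0 \<le> f 0")
      case True
      with False have "0 < f 1" by simp
      then show ?thesis using dzz \<open>0 \<le> c\<close> \<open>0 \<le> \<delta>\<close> by (simp add: f_def)
    next
      case False
      moreover have "?d p z - c \<le> ?d p g" using far[of g] by simp
      ultimately show ?thesis
        using dzz[of g] \<open>0 \<le> \<delta>\<close> hilbert_dist_sym[of g z] U by (simp add: f_def)
    qed
  next
    case True
    have pos: "0 < \<tau> + (1 - \<tau>) * m"
      if "0 \<le> \<tau>" "\<tau> \<le> 1" "1 \<le> m" for \<tau> m :: real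
      using that by (cases "\<tau> = 0") (auto intro!: add_pos_nonneg)
    define m m' where "m = M g z" and "m' = M z g"
    have m: "1 \<le> m" "1 \<le> m'" using M_ge_1 U by (auto simp: m_def m'_def)
    have cont: "continuous_on {0..1} f"
    proof -
      have eq: "f \<tau> = ?d p g + ln ((\<tau> + (1 - \<tau>) * m) * (m' / ((1 - \<tau>) + \<tau> * m'))) / 2 - ?d p z
          - ln (((1 - \<tau>) + \<tau> * m') * (m / (\<tau> + (1 - \<tau>) * m))) / 2" if "\<tau> \<in> {0..1}" for \<tau>
        using hilbert_dist_segment[of g z \<tau>] hilbert_dist_segment[of z g "1 - \<tau>"] U that
        by (simp add: f_def m_def m'_def add.commute)
      have nz: "\<tau> + (1 - \<tau>) * m \<noteq> 0" "(1 - \<tau>) + \<tau> * m' \<noteq> 0" "m' \<noteq> 0" "m \<noteq> 0"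
        if "\<tau> \<in> {0..1}" for \<tau>
        using pos[of \<tau> m] pos[of "1 - \<tau>" m'] m that by auto
      show ?thesis
        by (subst continuous_on_cong[OF refl eq], assumption)
          (intro continuous_intros ballI; use nz in simp)
    qed
    obtain \<tau> where \<tau>: "0 \<le> \<tau>" "\<tau> \<le> 1" "f \<tau> = 0"
      using IVT2'[of f 1 0 0] True cont by auto
    define v where "v = (1 - \<tau>) *\<^sub>R g + \<tau> *\<^sub>R z"
    have vU: "v \<in> U" using M_segment(1)[OF U(2,3) \<tau>(1,2) v_def] .
    have add: "?d g v + ?d v z = ?d g z" using hilbert_dist_segment_add[OF U(2,3) \<tau>(1,2) v_def] .
    have bal: "?d p g + ?d v z = ?d p z + ?d v g" using \<tau>(3) by (simp add: f_def v_def)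
    have "v \<in> closed_segment g z" using \<tau> by (auto simp: v_def closed_segment_def)
    then have "?d p z - c \<le> ?d p v" by (rule far)
    moreover have "min (gromov_product ?d p g v) (gromov_product ?d p v z) - \<delta> \<le> gromov_product ?d p g z"
      by (rule hyp) (use U vU in auto)
    moreover have "?d v g = ?d g v" "?d z g = ?d g z" using hilbert_dist_sym U vU by auto
    \<comment> \<open>Hyperbolicity and \<open>far\<close> give d v z at most c + 2 \<delta>, and
      the balance makes d p g equal to d p z + d g z - 2 d v z.\<close>
    ultimately show ?thesis using bal add \<open>0 \<le> c\<close> \<open>0 \<le> \<delta>\<close>
      unfolding gromov_product_def min_def by (auto split: if_splits simp: field_simps)
  qed
qed

end

section \<open>Shadows and the upper bound\<close>

lemma matrix_mult_uminus:
  fixes A B :: "real^'n^'n"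
  shows "(- A) ** B = - (A ** B)" "A ** (- B) = - (A ** B)"
  by (simp_all add: vec_eq_iff matrix_matrix_mult_def sum_negf)

lemma uminus_matrix_vector_mult:
  fixes A :: "real^'n^'n"
  shows "(- A) *v v = - (A *v v)"
  by (simp add: vec_eq_iff matrix_vector_mult_def sum_negf)

lemma matrix_inv_uminus:
  fixes A :: "real^'n^'n"
  assumes "det A \<noteq> 0"
  shows "det (- A) \<noteq> 0" "matrix_inv (- A) = - matrix_inv A"
proof -
  have *: "(- A) ** (- matrix_inv A) = mat 1"
    using matrix_inv_cancel[OF assms] by (simp add: matrix_mult_uminus)
  then have "det (- A) * det (- matrix_inv A) = 1" by (metis det_I det_mul)
  then show "det (- A) \<noteq> 0" by auto
  show "matrix_inv (- A) = - matrix_inv A" using * by (rule matrix_inv_unique)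
qed

text \<open>The operator norm form of exp (mu_1 - mu_n), by \<open>exp_mu_diff\<close>; it compares
  directly with positive maps on the cone.\<close>

definition cond_number :: "real^'n^'n \<Rightarrow> real" where
  "cond_number g = onorm ((*v) g) * onorm ((*v) (matrix_inv g))"

lemma exp_mu_diff:
  fixes g :: "real^'n^'n"
  assumes "det g \<noteq> 0" "2 \<le> CARD('n)"
  shows "exp (mu 1 g - mu CARD('n) g) = cond_number g"
  using exp_mu_1[OF assms] exp_mu_card[OF assms] by (simp add: cond_number_def exp_diff exp_minus divide_inverse)

lemma onorm_pos_of_det:
  fixes g :: "real^'n^'n"
  assumes "det g \<noteq> 0"
  shows "0 < onorm ((*v) g)"
proof -
  obtain v :: "real^'n" where v: "norm v = 1" using vector_choose_size[of 1] by auto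
  have "g *v (matrix_inv g *v v) = v" using matrix_inv_apply(1)[OF assms] .
  then have "1 \<le> onorm ((*v) g) * norm (matrix_inv g *v v)"
    using norm_matrix_le_onorm[of g "matrix_inv g *v v"] v by simp
  then have "onorm ((*v) g) \<noteq> 0" by auto
  then show ?thesis using onorm_matrix_nonneg[of g] by linarith
qed

text \<open>\<open>K\<close> is a compact set whose translates cover \<open>C\<close>. The base
  point is taken in the relative interior so that open segments from it to points of the closure of
  \<open>C\<close> stay in \<open>C\<close>, hence in translates of \<open>K\<close>. The dimension
  bound makes \<open>mu 2\<close> meaningful.\<close>

locale convex_cocompact = convex_chart w U for w :: "real^'n" and U +
  fixes \<Gamma> :: "(real^'n^'n) set" and C K :: "(real^'n) set" and p :: "real^'n"
  assumes card_ge_2: "2 \<le> CARD('n)" and discrete: "discrete_subgroup_SL \<Gamma>"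
    and data: "spcc_data \<Gamma> w U C" and p: "p \<in> rel_interior C"
    and K: "compact K" "K \<subseteq> C" "C \<subseteq> (\<Union>g\<in>\<Gamma>. pact w g ` K)"
begin

section \<open>Lifting the projective action to the cone\<close>

lemma C_subset_U: "C \<subseteq> U" and convex_C: "convex C"
  and pact_U: "g \<in> \<Gamma> \<Longrightarrow> pact w g ` U = U" and pact_C: "g \<in> \<Gamma> \<Longrightarrow> pact w g ` C = C"
  and w_action: "g \<in> \<Gamma> \<Longrightarrow> u \<in> U \<Longrightarrow> w \<bullet> (g *v u) \<noteq> 0"
  using data by (auto simp: spcc_data_def)

lemma one_in: "mat 1 \<in> \<Gamma>" and det_1: "g \<in> \<Gamma> \<Longrightarrow> det g = 1"
  and mult_in: "g \<in> \<Gamma> \<Longrightarrow> h \<in> \<Gamma> \<Longrightarrow> g ** h \<in> \<Gamma>" and inv_in: "g \<in> \<Gamma> \<Longrightarrow> matrix_inv g \<in> \<Gamma>"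
  using discrete by (auto simp: discrete_subgroup_SL_def)

lemma p_C: "p \<in> C" using p rel_interior_subset by blast

lemma p_U: "p \<in> U" using p_C C_subset_U by blast

lemma base_compact: "compact (insert p K)" "insert p K \<subseteq> U"
  using K p_U C_subset_U by auto

text \<open>Elements of \<open>\<Gamma>\<close> act projectively, so only one of \<open>g\<close> and \<open>- g\<close> preserves the cone \<open>T\<close>.\<close>
definition sg :: "real^'n^'n \<Rightarrow> real^'n^'n" where
  "sg g = (if 0 < w \<bullet> (g *v p) then g else - g)"

lemma sg_cases: "sg g = g \<or> sg g = - g"
  by (simp add: sg_def)

lemma det_sg: "g \<in> \<Gamma> \<Longrightarrow> det (sg g) \<noteq> 0"
  using det_1 matrix_inv_uminus(1)[of g] by (auto simp: sg_def)

text \<open>If the sign changed between \<open>p\<close> and \<open>u\<close>, the form would vanish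
  at some point of the segment, a point of \<open>U\<close> by convexity, which the action on the
  chart forbids.\<close>

lemma w_sg:
  assumes g: "g \<in> \<Gamma>" and u: "u \<in> U"
  shows "0 < w \<bullet> (sg g *v u)"
proof (rule ccontr)
  assume "\<not> ?thesis"
  moreover have nz: "w \<bullet> (sg g *v v) \<noteq> 0" if "v \<in> U" for v
    using w_action[OF g that] by (auto simp: sg_def uminus_matrix_vector_mult)
  ultimately have b: "w \<bullet> (sg g *v u) < 0" using u by force
  have a: "0 < w \<bullet> (sg g *v p)" using nz[OF p_U] by (auto simp: sg_def uminus_matrix_vector_mult)
  define a' b' where "a' = w \<bullet> (sg g *v p)" and "b' = w \<bullet> (sg g *v u)"
  define \<tau> where "\<tau> = a' / (a' - b')"
  have \<tau>: "0 \<le> \<tau>" "\<tau> \<le> 1" and z: "(1 - \<tau>) * a' + \<tau> * b' = 0"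
    using a b by (auto simp: \<tau>_def a'_def b'_def field_simps)
  have "(1 - \<tau>) *\<^sub>R p + \<tau> *\<^sub>R u \<in> U"
    using \<tau> p_U u convex_U by (intro convexD) auto
  from nz[OF this] z show False
    by (simp add: matrix_vector_right_distrib matrix_vector_mult_scaleR inner_add_right a'_def b'_def)
qed

lemma pact_sg: "pact w g u = (1 / (w \<bullet> (sg g *v u))) *\<^sub>R (sg g *v u)"
  by (auto simp: pact_def sg_def uminus_matrix_vector_mult)

lemma sg_apply: "g \<in> \<Gamma> \<Longrightarrow> u \<in> U \<Longrightarrow> sg g *v u = (w \<bullet> (sg g *v u)) *\<^sub>R pact w g u"
  using w_sg[of g u] by (simp add: pact_sg)

lemma sg_T:
  assumes g: "g \<in> \<Gamma>" and v: "v \<in> T"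
  shows "sg g *v v \<in> T"
proof -
  define u where "u = (1 / (w \<bullet> v)) *\<^sub>R v"
  have u: "u \<in> U" using T_normalize[OF v] by (simp add: u_def)
  have "pact w g u \<in> T" using pact_U[OF g] u U_subset_T by blast
  then have "sg g *v u \<in> T" using sg_apply[OF g u] w_sg[OF g u] T_scale by metis
  then have "(w \<bullet> v) *\<^sub>R (sg g *v u) \<in> T" using w_T[OF v] by (rule T_scale)
  also have "(w \<bullet> v) *\<^sub>R (sg g *v u) = sg g *v v"
    using w_T[OF v] by (simp add: u_def matrix_vector_mult_scaleR)
  finally show ?thesis .
qed

text \<open>The inverse of \<open>sg g\<close> is \<open>sg\<close> of the inverse up to sign, and
  the minus sign would place \<open>p\<close> in the opposite cone.\<close>

lemma inv_sg_T:
  assumes g: "g \<in> \<Gamma>" and v: "v \<in> T"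
  shows "matrix_inv (sg g) *v v \<in> T"
proof -
  let ?i = "matrix_inv g"
  have dg: "det g \<noteq> 0" using det_1[OF g] by simp
  have "matrix_inv (sg g) = sg ?i \<or> matrix_inv (sg g) = - sg ?i"
    using matrix_inv_uminus(2)[OF dg] by (auto simp: sg_def)
  moreover have "matrix_inv (sg g) \<noteq> - sg ?i"
  proof
    assume *: "matrix_inv (sg g) = - sg ?i"
    have pT: "p \<in> T" using p_U U_subset_T by blast
    have "p = matrix_inv (sg g) *v (sg g *v p)" using matrix_inv_apply(2)[OF det_sg[OF g]] by simp
    then have "p = - (sg ?i *v (sg g *v p))" by (simp add: * uminus_matrix_vector_mult)
    moreover have "sg ?i *v (sg g *v p) \<in> T" using sg_T[OF inv_in[OF g]] sg_T[OF g] pT by blast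
    ultimately have "w \<bullet> p < 0" using w_T by (metis inner_minus_right neg_less_0_iff_less)
    then show False using w_T[OF pT] by simp
  qed
  ultimately show ?thesis using sg_T[OF inv_in[OF g] v] by simp
qed

lemma positive_map_closure:
  assumes "\<And>v. v \<in> T \<Longrightarrow> h *v v \<in> T" "v \<in> closure T"
  shows "h *v v \<in> closure T"
proof -
  have "(*v) h ` closure T \<subseteq> closure T"
    by (rule image_closure_subset[OF _ closed_closure])
      (use assms(1) closure_subset in \<open>auto intro!: linear_continuous_on\<close>)
  then show ?thesis using assms(2) by blast
qed

lemma closure_C_subset: "closure C \<subseteq> closure U"
  by (rule closure_mono[OF C_subset_U])

lemma ray_meets_translate:
  assumes x: "x \<in> closure C - U" and t: "0 < t" "t < 1"
  obtains g k where "g \<in> \<Gamma>" "k \<in> K" "(1 - t) *\<^sub>R x + t *\<^sub>R p = pact w g k"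
proof -
  have "x \<noteq> p" using x p_U by blast
  have "(1 - t) *\<^sub>R x + t *\<^sub>R p \<in> open_segment x p"
    using \<open>x \<noteq> p\<close> t by (auto simp: in_segment)
  also have "open_segment x p = open_segment p x" by (rule open_segment_commute)
  also have "\<dots> \<subseteq> C"
    using rel_interior_closure_convex_segment[OF convex_C p] x rel_interior_subset by blast
  finally show ?thesis using K(3) that by blast
qed

text \<open>The point \<open>z = (1 - t) x + t p\<close> lies in \<open>g K\<close>, so \<open>h\<^sup>-\<^sup>1 z\<close> is a multiple of a point of
  \<open>K\<close> of size comparable to \<open>1 / \<parallel>h\<parallel>\<close>. As both summands of \<open>h\<^sup>-\<^sup>1 z\<close> lie in the closed cone,
  they are bounded by it.\<close>
lemma shadow_estimates:
  obtains A where "0 < A"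
    "\<And>g k x t. g \<in> \<Gamma> \<Longrightarrow> k \<in> K \<Longrightarrow> x \<in> closure U \<Longrightarrow> 0 < t \<Longrightarrow> t \<le> 1/2 \<Longrightarrow>
      (1 - t) *\<^sub>R x + t *\<^sub>R p = pact w g k \<Longrightarrow>
      norm (matrix_inv (sg g) *v x) * onorm ((*v) (sg g)) \<le> A"
    "\<And>g k x t \<phi>. g \<in> \<Gamma> \<Longrightarrow> k \<in> K \<Longrightarrow> x \<in> closure U \<Longrightarrow> 0 < t \<Longrightarrow> t \<le> 1/2 \<Longrightarrow>
      (1 - t) *\<^sub>R x + t *\<^sub>R p = pact w g k \<Longrightarrow> \<phi> \<bullet> x = 0 \<Longrightarrow> (\<And>u. u \<in> U \<Longrightarrow> 0 < \<phi> \<bullet> u) \<Longrightarrow>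
      norm (transpose (sg g) *v \<phi>) * onorm ((*v) (matrix_inv (sg g))) \<le> A * norm \<phi>"
proof -
  obtain B where B: "0 < B" "\<And>v. v \<in> closure T \<Longrightarrow> norm v \<le> B * (w \<bullet> v)"
    using exists_norm_bound by blast
  obtain c where c: "0 < c"
    "\<And>h q. (\<And>v. v \<in> T \<Longrightarrow> h *v v \<in> T) \<Longrightarrow> q \<in> insert p K \<Longrightarrow> c * onorm ((*v) h) \<le> w \<bullet> (h *v q)"
    using positive_map_lower_bound[OF base_compact] by blast
  obtain c' where c': "0 < c'"
    "\<And>\<phi> q. (\<And>u. u \<in> U \<Longrightarrow> 0 \<le> \<phi> \<bullet> u) \<Longrightarrow> q \<in> insert p K \<Longrightarrow> c' * norm \<phi> \<le> \<phi> \<bullet> q"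
    using functional_lower_bound[OF base_compact] by blast
  have *: "norm (matrix_inv (sg g) *v x) * onorm ((*v) (sg g)) \<le> 2 * B / c \<and>
      (\<phi> \<bullet> x = 0 \<longrightarrow> (\<forall>u\<in>U. 0 < \<phi> \<bullet> u) \<longrightarrow>
        norm (transpose (sg g) *v \<phi>) * onorm ((*v) (matrix_inv (sg g))) \<le> norm p / (c * c') * norm \<phi>)"
    if g: "g \<in> \<Gamma>" and k: "k \<in> K" and x: "x \<in> closure U" and t: "0 < t" "t \<le> 1/2"
      and z: "(1 - t) *\<^sub>R x + t *\<^sub>R p = pact w g k" for g k x t \<phi>
  proof -
    define h where "h = sg g"
    define a where "a = w \<bullet> (h *v k)"
    have kU: "k \<in> U" using k K C_subset_U by blast
    have a: "0 < a" using w_sg[OF g kU] by (simp add: a_def h_def)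
    have ca: "c * onorm ((*v) h) \<le> a" unfolding a_def h_def using sg_T[OF g] k by (intro c(2)) auto
    have zeq: "(1 - t) *\<^sub>R x + t *\<^sub>R p = (1 / a) *\<^sub>R (h *v k)"
      using z by (simp add: pact_sg a_def h_def)
    let ?i = "matrix_inv h"
    have cancel: "?i *v (h *v v) = v" "h *v (?i *v v) = v" for v
      using matrix_inv_apply[OF det_sg[OF g]] by (auto simp: h_def)
    have iT: "?i *v v \<in> closure T" if "v \<in> closure T" for v
      using positive_map_closure[OF inv_sg_T[OF g] that] by (simp add: h_def)
    have ix: "?i *v x \<in> closure T" using iT x closure_U_subset by blast
    have ip: "?i *v p \<in> closure T"
      by (rule iT) (use p_U U_subset_T closure_subset[of T] in auto)
    have "(1 - t) *\<^sub>R (?i *v x) + t *\<^sub>R (?i *v p) = (1 / a) *\<^sub>R k"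
      using arg_cong[OF zeq, of "(*v) ?i"]
      by (simp add: matrix_vector_right_distrib matrix_vector_mult_scaleR cancel)
    from arg_cong[OF this, of "(\<bullet>) w"]
    have sum: "(1 - t) * (w \<bullet> (?i *v x)) + t * (w \<bullet> (?i *v p)) = 1 / a"
      using w_U[OF kU] by (simp add: inner_add_right)
    have wx: "0 \<le> w \<bullet> (?i *v x)" and wp: "0 \<le> w \<bullet> (?i *v p)"
      using nonneg_closure_T[of w] w_U ix ip by auto
    have "(1/2) * (w \<bullet> (?i *v x)) \<le> (1 - t) * (w \<bullet> (?i *v x))"
      using t wx by (intro mult_right_mono) auto
    moreover have "0 \<le> t * (w \<bullet> (?i *v p))" using t wp by simp
    ultimately have "w \<bullet> (?i *v x) \<le> 2 / a" using sum by linarith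
    then have "B * (w \<bullet> (?i *v x)) \<le> B * (2 / a)" using B(1) by (intro mult_left_mono) auto
    then have nx: "norm (?i *v x) \<le> B * (2 / a)" using B(2)[OF ix] by linarith
    have nh: "onorm ((*v) h) \<le> a / c" using ca c(1) by (simp add: pos_le_divide_eq mult.commute)
    have "norm (?i *v x) * onorm ((*v) h) \<le> B * (2 / a) * (a / c)"
      using a B(1) onorm_matrix_nonneg[of h] by (intro mult_mono nx nh) auto
    also have "\<dots> = 2 * B / c" using a by simp
    finally have first: "norm (?i *v x) * onorm ((*v) h) \<le> 2 * B / c" .
    \<comment> \<open>Here the other summand, t h^-1 p, bounds the norm of h^-1 by 1 / (a t c). On
      the other hand \<phi> sees only the part t p of the ray point, so its value at h k is a t
      (\<phi> . p). The factor a t cancels in the product.\<close>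
    have second: "norm (transpose h *v \<phi>) * onorm ((*v) ?i) \<le> norm p / (c * c') * norm \<phi>"
      if \<phi>: "\<phi> \<bullet> x = 0" "\<forall>u\<in>U. 0 < \<phi> \<bullet> u"
    proof -
      have "0 \<le> (1 - t) * (w \<bullet> (?i *v x))" using t wx by simp
      then have f1: "t * (w \<bullet> (?i *v p)) \<le> 1 / a" using sum by linarith
      have f2: "c * onorm ((*v) ?i) \<le> w \<bullet> (?i *v p)"
        unfolding h_def using inv_sg_T[OF g] by (intro c(2)) auto
      have "t * (c * onorm ((*v) ?i)) \<le> t * (w \<bullet> (?i *v p))"
        using t by (intro mult_left_mono f2) auto
      then have "t * (c * onorm ((*v) ?i)) \<le> 1 / a" using f1 by (rule order_trans)
      then have "(t * (c * onorm ((*v) ?i))) * a \<le> 1" by (simp only: pos_le_divide_eq[OF a])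
      then have "onorm ((*v) ?i) * (a * t * c) \<le> 1" by (simp only: mult_ac)
      moreover have "0 < a * t * c" using t c(1) a by simp
      ultimately have i: "onorm ((*v) ?i) \<le> 1 / (a * t * c)" by (simp only: pos_le_divide_eq)
      have "c' * norm (transpose h *v \<phi>) \<le> (transpose h *v \<phi>) \<bullet> k"
      proof (rule c'(2))
        fix u assume "u \<in> U"
        then have "u \<in> T" using U_subset_T by blast
        then have "h *v u \<in> closure T"
          using sg_T[OF g, of u] closure_subset[of T] unfolding h_def by blast
        moreover have "0 \<le> \<phi> \<bullet> v"
          if "v \<in> U" for v using \<phi>(2) that by (simp add: less_imp_le)
        ultimately have "0 \<le> \<phi> \<bullet> (h *v u)"
          using nonneg_closure_T[of \<phi> "h *v u"] by blast
        then show "0 \<le> (transpose h *v \<phi>) \<bullet> u" by (simp only: transpose_dot)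
      qed (use k in simp)
      also have "\<dots> = \<phi> \<bullet> (h *v k)" by (rule transpose_dot)
      also have "h *v k = a *\<^sub>R ((1 - t) *\<^sub>R x + t *\<^sub>R p)" using zeq a by simp
      also have "\<phi> \<bullet> \<dots> = a * t * (\<phi> \<bullet> p)"
        using \<phi>(1) by (simp add: inner_add_right)
      also have "\<dots> \<le> a * t * (norm \<phi> * norm p)"
        using a t by (intro mult_left_mono norm_cauchy_schwarz) auto
      finally have *: "c' * norm (transpose h *v \<phi>) \<le> a * t * (norm \<phi> * norm p)" .
      have "norm (transpose h *v \<phi>) \<le> a * t * (norm \<phi> * norm p) / c'"
        by (subst pos_le_divide_eq[OF c'(1)]) (use * in \<open>simp only: mult.commute\<close>)
      then have "norm (transpose h *v \<phi>) * onorm ((*v) ?i) \<le> a * t * (norm \<phi> * norm p) / c' * (1 / (a * t * c))"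
        using i a t c(1) c'(1) onorm_matrix_nonneg[of ?i] by (intro mult_mono) auto
      also have "\<dots> = norm p / (c * c') * norm \<phi>"
        using a t by (simp add: mult.commute)
      finally show ?thesis .
    qed
    show ?thesis using first second unfolding h_def by blast
  qed
  define A where "A = 2 * B / c + norm p / (c * c')"
  have A: "0 < A" "2 * B / c \<le> A" "norm p / (c * c') \<le> A"
    using B(1) c(1) c'(1) by (auto simp: A_def add_pos_nonneg)
  show ?thesis
  proof (rule that[OF A(1)])
    fix g k x t assume "g \<in> \<Gamma>" "k \<in> K" "x \<in> closure U" "0 < t" "t \<le> 1/2"
      "(1 - t) *\<^sub>R x + t *\<^sub>R p = pact w g k"
    from conjunct1[OF *[OF this]] A(2) show "norm (matrix_inv (sg g) *v x) * onorm ((*v) (sg g)) \<le> A"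
      by linarith
  next
    fix g k x t \<phi> assume H: "g \<in> \<Gamma>" "k \<in> K" "x \<in> closure U" "0 < t" "t \<le> 1/2"
      "(1 - t) *\<^sub>R x + t *\<^sub>R p = pact w g k" "\<phi> \<bullet> x = 0" "\<And>u. u \<in> U \<Longrightarrow> 0 < \<phi> \<bullet> u"
    have "norm (transpose (sg g) *v \<phi>) * onorm ((*v) (matrix_inv (sg g))) \<le> norm p / (c * c') * norm \<phi>"
      using *[OF H(1-6), of \<phi>] H(7,8) by blast
    also have "\<dots> \<le> A * norm \<phi>" using A(3) by (intro mult_right_mono) auto
    finally show "norm (transpose (sg g) *v \<phi>) * onorm ((*v) (matrix_inv (sg g))) \<le> A * norm \<phi>" .
  qed
qed

text \<open>The shadow of g K seen from \<open>p\<close>, lifted to tangent pairs. The bound t <=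
  1/2 keeps the weight of \<open>x\<close> in the ray point at least 1/2, which the estimate of h^-1
  x needs.\<close>

definition shadow :: "real^'n^'n \<Rightarrow> ((real^'n) \<times> (real^'n)) set" where
  "shadow g = {(x, \<phi>) \<in> sym_boundary_image U C.
     \<exists>t k. 0 < t \<and> t \<le> 1/2 \<and> k \<in> K \<and> (1 - t) *\<^sub>R x + t *\<^sub>R p = pact w g k}"

section \<open>Diameters of shadows and the covering they form\<close>

lemma mu_sg: "mu i (sg g) = mu i g"
  by (simp add: sg_def mu_uminus)

lemma mu_inv_sg: "g \<in> \<Gamma> \<Longrightarrow> mu i (matrix_inv (sg g)) = mu i (matrix_inv g)"
  using det_1 matrix_inv_uminus(2)[of g] by (simp add: sg_def mu_uminus)

text \<open>Write x = h (h^-1 x) and \<phi> = h' (h^T \<phi>) with h' the inverse transpose. By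
  \<open>shadow_estimates\<close> the preimages have size O(1 / norm h) and O(norm \<phi> / norm
  h'), so \<open>matrix_image_near_line\<close> puts every x near one line and every \<phi> near
  another, both depending on \<open>g\<close> only.\<close>

lemma shadow_diameter:
  obtains D where "0 < D" "\<And>g P Q. g \<in> \<Gamma> \<Longrightarrow> P \<in> shadow g \<Longrightarrow> Q \<in> shadow g \<Longrightarrow>
    pdist2 P Q \<le> D * (exp (- (mu 1 g - mu 2 g)) + exp (- (mu 1 (matrix_inv g) - mu 2 (matrix_inv g))))"
proof -
  obtain A where A: "0 < A"
    "\<And>g k x t. g \<in> \<Gamma> \<Longrightarrow> k \<in> K \<Longrightarrow> x \<in> closure U \<Longrightarrow> 0 < t \<Longrightarrow> t \<le> 1/2 \<Longrightarrow>
      (1 - t) *\<^sub>R x + t *\<^sub>R p = pact w g k \<Longrightarrow>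
      norm (matrix_inv (sg g) *v x) * onorm ((*v) (sg g)) \<le> A"
    "\<And>g k x t \<phi>. g \<in> \<Gamma> \<Longrightarrow> k \<in> K \<Longrightarrow> x \<in> closure U \<Longrightarrow> 0 < t \<Longrightarrow> t \<le> 1/2 \<Longrightarrow>
      (1 - t) *\<^sub>R x + t *\<^sub>R p = pact w g k \<Longrightarrow> \<phi> \<bullet> x = 0 \<Longrightarrow> (\<And>u. u \<in> U \<Longrightarrow> 0 < \<phi> \<bullet> u) \<Longrightarrow>
      norm (transpose (sg g) *v \<phi>) * onorm ((*v) (matrix_inv (sg g))) \<le> A * norm \<phi>"
    using shadow_estimates by blast
  define D where "D = 4 * A * norm w + 4 * A"
  have D: "0 < D" using A(1) by (simp add: D_def add_nonneg_pos)
  have "pdist2 P Q \<le> D * (exp (- (mu 1 g - mu 2 g)) + exp (- (mu 1 (matrix_inv g) - mu 2 (matrix_inv g))))"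
    if g: "g \<in> \<Gamma>" and P: "P \<in> shadow g" and Q: "Q \<in> shadow g" for g P Q
  proof -
    define h where "h = sg g"
    have dh: "det h \<noteq> 0" using det_sg[OF g] by (simp add: h_def)
    define h' where "h' = transpose (matrix_inv h)"
    have dh': "det h' \<noteq> 0" using det_inv[OF dh] by (simp add: h'_def)
    define a b where "a = exp (- (mu 1 g - mu 2 g))"
      and "b = exp (- (mu 1 (matrix_inv g) - mu 2 (matrix_inv g)))"
    have a: "exp (mu 2 h) = a * onorm ((*v) h)"
      unfolding exp_mu_1[OF dh card_ge_2, symmetric] a_def mult_exp_exp by (simp add: h_def mu_sg)
    have mu': "mu i h' = mu i (matrix_inv g)" for i
      using mu_transpose[OF det_inv[OF dh], of i] mu_inv_sg[OF g] by (simp add: h'_def h_def)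
    have b: "exp (mu 2 h') = b * onorm ((*v) (matrix_inv h))"
    proof -
      have "onorm ((*v) (matrix_inv h)) = exp (mu 1 h')"
        using exp_mu_1[OF dh' card_ge_2] by (simp add: h'_def onorm_matrix_transpose)
      then show ?thesis by (simp add: b_def mu' flip: exp_add)
    qed
    obtain e where e: "norm e = 1"
      "\<And>v. norm (h *v v - (e \<bullet> (h *v v)) *\<^sub>R e) \<le> exp (mu 2 h) * norm v"
      using matrix_image_near_line[OF dh card_ge_2] by blast
    obtain e' where e': "norm e' = 1"
      "\<And>v. norm (h' *v v - (e' \<bullet> (h' *v v)) *\<^sub>R e') \<le> exp (mu 2 h') * norm v"
      using matrix_image_near_line[OF dh' card_ge_2] by blast
    have near: "x \<noteq> 0 \<and> norm (x - (e \<bullet> x) *\<^sub>R e) \<le> (A * norm w * a) * norm x \<and>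
        \<phi> \<noteq> 0 \<and> norm (\<phi> - (e' \<bullet> \<phi>) *\<^sub>R e') \<le> (A * b) * norm \<phi>" if mem: "(x, \<phi>) \<in> shadow g" for x \<phi>
    proof -
      obtain t k where tk: "0 < t" "t \<le> 1/2" "k \<in> K" "(1 - t) *\<^sub>R x + t *\<^sub>R p = pact w g k"
        and x: "x \<in> closure C - U" and \<phi>: "\<phi> \<noteq> 0" "\<phi> \<bullet> x = 0" "\<And>u. u \<in> U \<Longrightarrow> 0 < \<phi> \<bullet> u"
        using mem by (auto simp: shadow_def sym_boundary_image_def)
      have xU: "x \<in> closure U" using x closure_C_subset by blast
      have 1: "norm (matrix_inv h *v x) * onorm ((*v) h) \<le> A"
        using A(2)[OF g tk(3) xU tk(1,2,4)] by (simp add: h_def)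
      have 2: "norm (transpose h *v \<phi>) * onorm ((*v) (matrix_inv h)) \<le> A * norm \<phi>"
        using A(3)[OF g tk(3) xU tk(1,2,4) \<phi>(2,3)] by (simp add: h_def)
      \<comment> \<open>Converts the absolute error at \<open>x\<close> into the relative one that
        \<open>pdist_le_of_near_line\<close> asks for; this is where \<open>norm w\<close> enters
        the constant.\<close>
      have "1 \<le> norm w * norm x" using norm_cauchy_schwarz[of w x] w_closure_U[OF xU] by simp
      then have "x \<noteq> 0" by auto
      have "norm (x - (e \<bullet> x) *\<^sub>R e) \<le> a * onorm ((*v) h) * norm (matrix_inv h *v x)"
        using e(2)[of "matrix_inv h *v x"] matrix_inv_apply(1)[OF dh] a by simp
      also have "\<dots> = a * (norm (matrix_inv h *v x) * onorm ((*v) h))" by simp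
      also have "\<dots> \<le> a * A" using 1 by (intro mult_left_mono) (auto simp: a_def)
      also have "\<dots> = (A * a) * 1" by simp
      also have "\<dots> \<le> (A * a) * (norm w * norm x)"
        using \<open>1 \<le> norm w * norm x\<close> A(1) by (intro mult_left_mono) (auto simp: a_def)
      finally have x1: "norm (x - (e \<bullet> x) *\<^sub>R e) \<le> (A * norm w * a) * norm x"
        by (simp add: mult_ac)
      have "h' *v (transpose h *v \<phi>) = \<phi>"
      proof -
        have "h' ** transpose h = mat 1"
          unfolding h'_def by (simp add: matrix_inv_cancel[OF dh] flip: matrix_transpose_mul)
        then show ?thesis unfolding matrix_vector_mul_assoc by simp
      qed
      then have "norm (\<phi> - (e' \<bullet> \<phi>) *\<^sub>R e') \<le> b * onorm ((*v) (matrix_inv h)) * norm (transpose h *v \<phi>)"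
        using e'(2)[of "transpose h *v \<phi>"] b by (simp only:)
      also have "\<dots> = b * (norm (transpose h *v \<phi>) * onorm ((*v) (matrix_inv h)))"
        by (simp only: mult_ac)
      also have "\<dots> \<le> b * (A * norm \<phi>)"
        using 2 by (intro mult_left_mono) (auto simp: b_def)
      finally show ?thesis using x1 \<open>x \<noteq> 0\<close> \<phi>(1) by (simp add: mult_ac)
    qed
    obtain x \<phi> y \<psi> where PQ: "P = (x, \<phi>)" "Q = (y, \<psi>)" by (metis surj_pair)
    have "pdist x y \<le> 4 * (A * norm w * a)" "pdist \<phi> \<psi> \<le> 4 * (A * b)"
      using near[of x \<phi>] near[of y \<psi>] P Q PQ
      by (auto intro: pdist_le_of_near_line[OF e(1)] pdist_le_of_near_line[OF e'(1)])
    moreover have "4 * (A * norm w * a) \<le> D * (a + b)" "4 * (A * b) \<le> D * (a + b)"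
    proof -
      have *: "0 \<le> A * norm w * a" "0 \<le> A * norm w * b" "0 \<le> A * a" "0 \<le> A * b"
        using A(1) by (auto simp: a_def b_def)
      have "D * (a + b) = 4 * (A * norm w * a) + 4 * (A * norm w * b) + 4 * (A * a) + 4 * (A * b)"
        by (simp add: D_def algebra_simps)
      then show "4 * (A * norm w * a) \<le> D * (a + b)" "4 * (A * b) \<le> D * (a + b)"
        using * by linarith+
    qed
    ultimately show ?thesis by (simp add: pdist2_def PQ a_def b_def)
  qed
  then show ?thesis using that[OF D] by blast
qed

text \<open>If the ray from \<open>p\<close> to x met only translates by elements of
  \<open>F\<close> near its end, it would end in a finite union of compact subsets of
  \<open>U\<close>, and x would belong to \<open>U\<close>.\<close>

lemma shadows_cover:
  assumes "finite F" "F \<subseteq> \<Gamma>"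
  shows "sym_boundary_image U C \<subseteq> (\<Union>g\<in>\<Gamma> - F. shadow g)"
proof
  fix P assume "P \<in> sym_boundary_image U C"
  moreover obtain x \<phi> where P: "P = (x, \<phi>)" by (metis surj_pair)
  ultimately have x: "x \<in> closure C - U" by (auto simp: sym_boundary_image_def)
  show "P \<in> (\<Union>g\<in>\<Gamma> - F. shadow g)"
  proof (rule ccontr)
    assume not_in: "P \<notin> (\<Union>g\<in>\<Gamma> - F. shadow g)"
    define Z where "Z = (\<Union>g\<in>F. pact w g ` K)"
    have "continuous_on K (pact w g)" if "g \<in> \<Gamma>" for g
    proof -
      have "w \<bullet> (g *v k) \<noteq> 0"
        if "k \<in> K" for k using w_action[OF \<open>g \<in> \<Gamma>\<close>] that K C_subset_U
          by blast
      then show ?thesis unfolding pact_def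
        by (intro continuous_intros linear_continuous_on matrix_vector_mul_bounded_linear) auto
    qed
    then have "compact Z"
      unfolding Z_def using assms K by (intro compact_UN compact_continuous_image) auto
    moreover have "Z \<subseteq> U" unfolding Z_def using assms pact_U K C_subset_U by blast
    moreover have "(1 - t) *\<^sub>R x + t *\<^sub>R p \<in> Z" if t: "0 < t" "t \<le> 1/2" for t
    proof -
      obtain g k where gk: "g \<in> \<Gamma>" "k \<in> K" "(1 - t) *\<^sub>R x + t *\<^sub>R p = pact w g k"
        using ray_meets_translate[OF x t(1)] t(2) by auto
      then have "P \<in> shadow g"
        using t \<open>P \<in> sym_boundary_image U C\<close> P by (auto simp: shadow_def)
      then have "g \<in> F" using not_in gk(1) by blast
      then show ?thesis using gk by (auto simp: Z_def)
    qed
    then have "\<forall>\<^sub>F t in at_right 0. (1 - t) *\<^sub>R x + t *\<^sub>R p \<in> Z"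
      by (auto simp: eventually_at_right_field intro!: exI[of _ "1/2"])
    moreover have "((\<lambda>t. (1 - t) *\<^sub>R x + t *\<^sub>R p) \<longlongrightarrow> (1 - 0) *\<^sub>R x + 0 *\<^sub>R p) (at_right 0)"
      by (intro tendsto_intros)
    ultimately have "(1 - 0) *\<^sub>R x + 0 *\<^sub>R p \<in> Z"
      by (intro Lim_in_closed_set[of Z]) (auto intro: compact_imp_closed)
    then show False using \<open>Z \<subseteq> U\<close> x by auto
  qed
qed

lemma bij_inv: "bij_betw matrix_inv \<Gamma> \<Gamma>"
proof (rule bij_betw_byWitness[where f' = matrix_inv])
  have "matrix_inv (matrix_inv g) = g" if "g \<in> \<Gamma>" for g
    using matrix_inv_cancel(2)[of g] det_1[OF that] by (intro matrix_inv_unique) simp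
  then show "\<forall>g\<in>\<Gamma>. matrix_inv (matrix_inv g) = g" "\<forall>g\<in>\<Gamma>. matrix_inv (matrix_inv g) = g"
    by auto
qed (use inv_in in auto)

theorem hausdorff_dim_upper: "hausdorff_dim pdist2 (sym_boundary_image U C) \<le> delta12 \<Gamma>"
proof (rule dense_ge)
  fix b assume b: "delta12 \<Gamma> < b"
  show "hausdorff_dim pdist2 (sym_boundary_image U C) \<le> b"
  proof (cases "b = \<infinity>")
    case False
    have "0 \<le> delta12 \<Gamma>" unfolding delta12_def by (rule crit_exp_nonneg)
    with b have "0 < b" by (rule le_less_trans[rotated])
    with False obtain s where s: "b = ereal s" "0 < s" by (cases b) auto
    define f where "f g = mu 1 g - mu 2 g" for g :: "real^'n^'n"
    have f: "0 \<le> f g" if "g \<in> \<Gamma>" for g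
      using mu_2_le_mu_1[OF _ card_ge_2, of g] det_1[OF that] by (simp add: f_def)
    have lt: "crit_exp \<Gamma> f < ereal s" using b s by (simp add: delta12_def f_def[abs_def])
    have sum: "(\<lambda>g. exp (- s * f g)) summable_on \<Gamma>" and count: "countable \<Gamma>"
      using summable_on_of_crit_exp_less[OF lt f] by auto
    have sum': "(\<lambda>g. exp (- s * f (matrix_inv g))) summable_on \<Gamma>"
      using sum summable_on_reindex_bij_betw[OF bij_inv, of "\<lambda>g. exp (- s * f g)"] by simp
    obtain D where D: "0 < D" "\<And>g P Q. g \<in> \<Gamma> \<Longrightarrow> P \<in> shadow g \<Longrightarrow> Q \<in> shadow g \<Longrightarrow>
        pdist2 P Q \<le> D * (exp (- f g) + exp (- f (matrix_inv g)))"
      using shadow_diameter unfolding f_def by blast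
    define E where "E g = D * (exp (- f g) + exp (- f (matrix_inv g)))" for g
    have "(\<lambda>g. E g powr s) summable_on \<Gamma>"
    proof (rule summable_on_comparison_test)
      show "(\<lambda>g. (2 * D) powr s * (exp (- s * f g) + exp (- s * f (matrix_inv g)))) summable_on \<Gamma>"
        by (intro summable_on_cmult_right summable_on_add sum sum')
      fix g
      \<comment> \<open>A sum of two terms is at most twice the maximum, and the s-th power of the
        maximum is at most the sum of the s-th powers, whatever s > 0.\<close>
      define m where "m = max (exp (- f g)) (exp (- f (matrix_inv g)))"
      have m: "0 < m" by (simp add: m_def less_max_iff_disj)
      have "E g \<le> D * (m + m)"
        unfolding E_def m_def using D(1) by (intro mult_left_mono add_mono) auto
      moreover have "0 \<le> E g" using D(1) by (simp add: E_def)
      ultimately have "E g powr s \<le> (2 * D * m) powr s" using s by (intro powr_mono2) auto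
      also have "\<dots> = (2 * D) powr s * m powr s" using D(1) m by (simp add: powr_mult)
      also have "m powr s \<le> exp (- s * f g) + exp (- s * f (matrix_inv g))"
        by (auto simp: m_def max_def exp_powr_real mult.commute)
      finally show "E g powr s \<le> (2 * D) powr s * (exp (- s * f g) + exp (- s * f (matrix_inv g)))"
        by (simp add: mult_left_mono)
    qed simp
    then have "hausdorff_measure pdist2 s (sym_boundary_image U C) = 0"
    proof (rule hausdorff_measure_limsup_zero[where S = shadow])
      show "0 \<le> E g" for g using D(1) by (simp add: E_def)
    qed (use s D(2) shadows_cover pdist2_nonneg count in \<open>auto simp: E_def\<close>)
    then have "hausdorff_dim pdist2 (sym_boundary_image U C) \<le> ereal s"
      unfolding hausdorff_dim_def using s by (intro INF_lower) simp
    then show ?thesis using s by simp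
  qed simp
qed

end

section \<open>Hyperbolicity along shadows\<close>

lemma cond_number_uminus:
  fixes g :: "real^'n^'n"
  assumes "det g \<noteq> 0"
  shows "cond_number (- g) = cond_number g"
  by (simp add: cond_number_def matrix_inv_uminus(2)[OF assms] onorm_matrix_uminus)

lemma cond_number_nonneg: "0 \<le> cond_number g"
  unfolding cond_number_def by (intro mult_nonneg_nonneg onorm_matrix_nonneg)

lemma matrix_inv_mult:
  fixes g h :: "real^'n^'n"
  assumes "det g \<noteq> 0" "det h \<noteq> 0"
  shows "matrix_inv (g ** h) = matrix_inv h ** matrix_inv g"
proof (rule matrix_inv_unique)
  have "g ** h ** (matrix_inv h ** matrix_inv g) = g ** (h ** matrix_inv h) ** matrix_inv g"
    by (simp add: matrix_mul_assoc)
  then show "g ** h ** (matrix_inv h ** matrix_inv g) = mat 1"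
    by (simp only: matrix_inv_cancel(1)[OF assms(1)] matrix_inv_cancel(1)[OF assms(2)] matrix_mul_rid)
qed

text \<open>The Leibniz formula has \<open>N\<close> terms, each at most \<epsilon>, whence
  \<epsilon> = 1 / (N + 1). This bounds the operator norm of matrices of determinant 1 from
  below.\<close>

lemma det_small_of_onorm_small:
  obtains \<epsilon> where "0 < \<epsilon>" "\<And>A :: real^'n^'n. onorm ((*v) A) < \<epsilon> \<Longrightarrow> \<bar>det A\<bar> < 1"
proof -
  let ?P = "{\<sigma>. \<sigma> permutes (UNIV :: 'n set)}"
  define N where "N = real (card ?P)"
  define \<epsilon> where "\<epsilon> = 1 / (N + 1)"
  have N: "0 \<le> N" by (simp add: N_def)
  have e: "0 < \<epsilon>" "\<epsilon> \<le> 1" using N by (auto simp: \<epsilon>_def)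
  have "\<bar>det A\<bar> < 1" if "onorm ((*v) A) < \<epsilon>" for A :: "real^'n^'n"
  proof -
    have ent: "\<bar>A $ i $ j\<bar> \<le> \<epsilon>" for i j
      using matrix_component_le_onorm[of A i j] that by linarith
    have term_le: "\<bar>of_int (sign \<sigma>) * (\<Prod>i\<in>UNIV. A $ i $ \<sigma> i)\<bar> \<le> \<epsilon>" for \<sigma>
    proof -
      have "\<bar>of_int (sign \<sigma>) * (\<Prod>i\<in>UNIV. A $ i $ \<sigma> i)\<bar> = (\<Prod>i\<in>UNIV. \<bar>A $ i $ \<sigma> i\<bar>)"
        by (simp add: abs_mult sign_def abs_prod)
      also have "\<dots> \<le> (\<Prod>i\<in>(UNIV::'n set). \<epsilon>)"
        using ent by (intro prod_mono) auto
      also have "\<dots> = \<epsilon> ^ CARD('n)" by simp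
      also have "\<dots> \<le> \<epsilon> ^ 1" using e by (intro power_decreasing) (auto simp: Suc_le_eq)
      finally show ?thesis by simp
    qed
    have "\<bar>det A\<bar> \<le> (\<Sum>\<sigma>\<in>?P. \<bar>of_int (sign \<sigma>) * (\<Prod>i\<in>UNIV. A $ i $ \<sigma> i)\<bar>)"
      unfolding det_def by (rule sum_abs)
    also have "\<dots> \<le> N * \<epsilon>"
      unfolding N_def using term_le by (intro sum_bounded_above) auto
    also have "\<dots> < 1" using N by (simp add: \<epsilon>_def)
    finally show ?thesis .
  qed
  with e(1) that show ?thesis by blast
qed

lemma norm_matrix_le_card_onorm:
  fixes A :: "real^'n^'n"
  shows "norm A \<le> real CARD('n) * real CARD('n) * onorm ((*v) A)"
proof -
  have "norm A \<le> (\<Sum>i\<in>UNIV. norm (A $ i))"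
    unfolding norm_vec_def by (rule L2_set_le_sum) simp
  also have "\<dots> \<le> (\<Sum>i\<in>(UNIV::'n set). real CARD('n) * onorm ((*v) A))"
  proof (rule sum_mono)
    fix i
    have "norm (A $ i) \<le> (\<Sum>j\<in>UNIV. \<bar>A $ i $ j\<bar>)" by (rule norm_le_l1_cart)
    also have "\<dots> \<le> (\<Sum>j\<in>(UNIV::'n set). onorm ((*v) A))"
      by (intro sum_mono matrix_component_le_onorm)
    finally show "norm (A $ i) \<le> real CARD('n) * onorm ((*v) A)" by simp
  qed
  finally show ?thesis by simp
qed

lemma onorm_le_norm_matrix:
  fixes A :: "real^'n^'n"
  shows "onorm ((*v) A) \<le> real CARD('n) * real CARD('n) * norm A"
proof (rule onorm_le_matrix_component)
  fix i j
  have "\<bar>A $ i $ j\<bar> \<le> norm (A $ i)" by (rule component_le_norm_cart)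
  also have "\<dots> \<le> norm A" by (rule Finite_Cartesian_Product.norm_nth_le)
  finally show "\<bar>A $ i $ j\<bar> \<le> norm A" .
qed

context convex_cocompact
begin

text \<open>With determinant 1 neither norm in the product is below \<epsilon>, so bounded condition
  numbers bound \<open>g\<close> and its inverse. An infinite set would accumulate, and two close
  elements give g^-1 g' close to the identity, so discreteness there separates all of them by one
  distance.\<close>

lemma finite_cond_number_le: "finite {g \<in> \<Gamma>. cond_number g \<le> R}"
proof (rule ccontr)
  let ?G = "{g \<in> \<Gamma>. cond_number g \<le> R}" and ?n = "real CARD('n)"
  assume inf: "infinite ?G"
  obtain \<epsilon> where \<epsilon>: "0 < \<epsilon>" "\<And>A :: real^'n^'n. onorm ((*v) A) < \<epsilon> \<Longrightarrow> \<bar>det A\<bar> < 1"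
    using det_small_of_onorm_small by blast
  define R' where "R' = \<bar>R\<bar> / \<epsilon> + 1"
  have R': "0 < R'" using \<epsilon> by (simp add: R'_def add_nonneg_pos)
  have bounds: "onorm ((*v) g) \<le> R' \<and> onorm ((*v) (matrix_inv g)) \<le> R'"
    if g: "g \<in> ?G" for g
  proof -
    have "\<epsilon> \<le> onorm ((*v) g)" "\<epsilon> \<le> onorm ((*v) (matrix_inv g))"
      using \<epsilon>(2)[of g] \<epsilon>(2)[of "matrix_inv g"] det_1[of g] det_1[of "matrix_inv g"] inv_in[of g] g
      by (auto simp: not_less[symmetric])
    moreover have "onorm ((*v) g) * onorm ((*v) (matrix_inv g)) \<le> \<bar>R\<bar>"
    proof -
      have "cond_number g \<le> R" using g by simp
      then show ?thesis unfolding cond_number_def by linarith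
    qed
    ultimately have "\<epsilon> * onorm ((*v) (matrix_inv g)) \<le> \<bar>R\<bar>" "onorm ((*v) g) * \<epsilon> \<le> \<bar>R\<bar>"
      using \<epsilon>(1) mult_right_mono[of \<epsilon> "onorm ((*v) g)" "onorm ((*v) (matrix_inv g))"]
        mult_left_mono[of \<epsilon> "onorm ((*v) (matrix_inv g))" "onorm ((*v) g)"] by linarith+
    then have "onorm ((*v) (matrix_inv g)) \<le> \<bar>R\<bar> / \<epsilon>" "onorm ((*v) g) \<le> \<bar>R\<bar> / \<epsilon>"
      using \<epsilon>(1) by (simp_all add: pos_le_divide_eq mult.commute)
    then show ?thesis by (simp add: R'_def)
  qed
  have "bounded ?G"
  proof (rule boundedI)
    fix g assume "g \<in> ?G"
    then have "?n * ?n * onorm ((*v) g) \<le> ?n * ?n * R'" using bounds by (intro mult_left_mono) auto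
    with norm_matrix_le_card_onorm[of g] show "norm g \<le> ?n * ?n * R'" by linarith
  qed
  then have "compact (closure ?G)" by (simp add: compact_closure)
  then have "\<exists>a\<in>closure ?G. a islimpt ?G"
    unfolding compact_eq_Bolzano_Weierstrass using inf closure_subset[of ?G] by blast
  then obtain a where a: "a islimpt ?G" by blast
  obtain e where e: "0 < e" "\<And>h. h \<in> \<Gamma> \<Longrightarrow> dist h (mat 1) < e \<Longrightarrow> h = mat 1"
    using discrete one_in by (auto simp: discrete_subgroup_SL_def)
  \<comment> \<open>Each passage between \<open>norm\<close> and the operator norm costs n^2, and
    \<open>R'\<close> bounds the inverse.\<close>
  define S where "S = ?n * ?n * (R' * (?n * ?n))"
  have S: "0 < S" unfolding S_def using R' by (intro mult_pos_pos) auto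
  define \<eta> where "\<eta> = e / (2 * S)"
  have \<eta>: "0 < \<eta>" using e(1) S by (simp add: \<eta>_def)
  have sep: "g = g'" if g: "g \<in> ?G" "g' \<in> ?G" "dist g g' < \<eta>" for g g'
  proof -
    have dg: "det g \<noteq> 0" using det_1 g by auto
    let ?h = "matrix_inv g ** g'"
    have "?h - mat 1 = matrix_inv g ** (g' - g)"
      by (simp add: matrix_diff_ldistrib matrix_inv_cancel[OF dg])
    then have eq: "(*v) (?h - mat 1) = (*v) (matrix_inv g) \<circ> (*v) (g' - g)"
      by (auto simp: fun_eq_iff matrix_vector_mul_assoc)
    have "onorm ((*v) (?h - mat 1)) \<le> onorm ((*v) (matrix_inv g)) * onorm ((*v) (g' - g))"
      unfolding eq by (rule onorm_compose) auto
    also have "\<dots> \<le> R' * (?n * ?n * norm (g' - g))"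
      using bounds[OF g(1)] onorm_le_norm_matrix[of "g' - g"] R' onorm_matrix_nonneg[of "g' - g"]
      by (intro mult_mono) auto
    finally have "?n * ?n * onorm ((*v) (?h - mat 1)) \<le> ?n * ?n * (R' * (?n * ?n * norm (g' - g)))"
      by (intro mult_left_mono) auto
    then have "norm (?h - mat 1) \<le> ?n * ?n * (R' * (?n * ?n * norm (g' - g)))"
      by (rule order_trans[OF norm_matrix_le_card_onorm])
    then have "dist ?h (mat 1) \<le> S * norm (g' - g)"
      by (simp only: dist_norm mult.assoc S_def)
    also have "\<dots> \<le> S * \<eta>"
      using g(3) S by (intro mult_left_mono) (simp_all add: dist_norm norm_minus_commute)
    also have "\<dots> = e / 2" using S by (simp add: \<eta>_def)
    also have "\<dots> < e" using e(1) by simp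
    finally have "dist ?h (mat 1) < e" .
    moreover have "?h \<in> \<Gamma>" by (intro mult_in inv_in) (use g in auto)
    ultimately have "?h = mat 1" by (intro e(2))
    then have "g = g ** ?h" by simp
    also have "\<dots> = g'" by (simp only: matrix_mul_assoc matrix_inv_cancel[OF dg] matrix_mul_lid)
    finally show "g = g'" .
  qed
  define X where "X = ?G \<inter> ball a (\<eta> / 2)"
  have inf': "infinite X" unfolding X_def
    by (rule a[unfolded islimpt_eq_infinite_ball, rule_format]) (use \<eta> in simp)
  obtain g where g1: "g \<in> X" using infinite_imp_nonempty[OF inf'] by blast
  have "infinite (X - {g})" using inf' by simp
  from infinite_imp_nonempty[OF this] obtain g' where "g' \<in> X" "g \<noteq> g'" by blast
  with g1 have g: "g \<in> ?G \<inter> ball a (\<eta>/2)" "g' \<in> ?G \<inter> ball a (\<eta>/2)" "g \<noteq> g'"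
    by (simp_all add: X_def)
  then have "dist g g' < \<eta>" using dist_triangle_half_r[of a g \<eta> g'] by auto
  then show False using sep g by blast
qed

text \<open>Positivity at \<open>p\<close> and at the orbit point bounds norm h by b / c and norm
  h^-1 by 1 / (b c); the scale \<open>b\<close> cancels in the condition number.\<close>

lemma finite_orbit_compact:
  assumes "compact Q" "Q \<subseteq> U"
  shows "finite {g \<in> \<Gamma>. pact w g p \<in> Q}"
proof -
  obtain c where c: "0 < c"
    "\<And>h q. (\<And>v. v \<in> T \<Longrightarrow> h *v v \<in> T) \<Longrightarrow> q \<in> insert p Q \<Longrightarrow> c * onorm ((*v) h) \<le> w \<bullet> (h *v q)"
    using positive_map_lower_bound[of "insert p Q"] assms p_U by auto
  have "{g \<in> \<Gamma>. pact w g p \<in> Q} \<subseteq> {g \<in> \<Gamma>. cond_number g \<le> 1 / (c * c)}"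
  proof safe
    fix g assume g: "g \<in> \<Gamma>" "pact w g p \<in> Q"
    define h b where "h = sg g" and "b = w \<bullet> (h *v p)"
    have b: "0 < b" using w_sg[OF g(1) p_U] by (simp add: b_def h_def)
    have "matrix_inv h *v pact w g p = (1 / b) *\<^sub>R p"
      using matrix_inv_apply(2)[OF det_sg[OF g(1)]]
      by (simp add: pact_sg matrix_vector_mult_scaleR h_def b_def)
    then have "w \<bullet> (matrix_inv h *v pact w g p) = 1 / b" using w_U[OF p_U] by simp
    moreover have "c * onorm ((*v) (matrix_inv h)) \<le> w \<bullet> (matrix_inv h *v pact w g p)"
      unfolding h_def using inv_sg_T[OF g(1)] g(2) by (intro c(2)) auto
    ultimately have 1: "c * onorm ((*v) (matrix_inv h)) \<le> 1 / b" by simp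
    have 2: "c * onorm ((*v) h) \<le> b"
      unfolding h_def b_def using sg_T[OF g(1)] by (intro c(2)) auto
    have "(c * onorm ((*v) h)) * (c * onorm ((*v) (matrix_inv h))) \<le> b * (1 / b)"
      using 1 2 c(1) b onorm_matrix_nonneg[of "matrix_inv h"] by (intro mult_mono) auto
    then have "cond_number h * (c * c) \<le> 1" using b by (simp add: cond_number_def mult_ac)
    then have "cond_number h \<le> 1 / (c * c)" using c(1) by (simp add: pos_le_divide_eq)
    moreover have "cond_number h = cond_number g"
      using cond_number_uminus[of g] det_1[OF g(1)] by (simp add: h_def sg_def)
    ultimately show "cond_number g \<le> 1 / (c * c)" by simp
  qed
  then show ?thesis using finite_cond_number_le finite_subset by blast
qed

section \<open>Hilbert distances compared with condition numbers\<close>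

lemma pact_in_U: "g \<in> \<Gamma> \<Longrightarrow> u \<in> U \<Longrightarrow> pact w g u \<in> U"
  using pact_U by blast

text \<open>Use \<open>w\<close> composed with the inverse lifts of \<open>b\<close> and of
  \<open>a\<close> as test functionals. The normalizations cancel and leave values of two positive
  maps at points of \<open>insert p K\<close>, each bounded below by an operator norm.\<close>

lemma cond_number_le_hilbert:
  obtains c where "0 < c" "\<And>a b q q'. a \<in> \<Gamma> \<Longrightarrow> b \<in> \<Gamma> \<Longrightarrow> q \<in> insert p K \<Longrightarrow> q' \<in> insert p K \<Longrightarrow>
    c * cond_number (matrix_inv a ** b) \<le> exp (2 * hilbert_dist U (pact w a q) (pact w b q'))"
proof -
  obtain c where c: "0 < c"
    "\<And>h q. (\<And>v. v \<in> T \<Longrightarrow> h *v v \<in> T) \<Longrightarrow> q \<in> insert p K \<Longrightarrow> c * onorm ((*v) h) \<le> w \<bullet> (h *v q)"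
    using positive_map_lower_bound[OF base_compact] by blast
  have "c * c * cond_number (matrix_inv a ** b) \<le> exp (2 * hilbert_dist U (pact w a q) (pact w b q'))"
    if ab: "a \<in> \<Gamma>" "b \<in> \<Gamma>" and q: "q \<in> insert p K" "q' \<in> insert p K" for a b q q'
  proof -
    have qU: "q \<in> U" "q' \<in> U" using q base_compact by auto
    define ha hb where "ha = sg a" and "hb = sg b"
    have d: "det ha \<noteq> 0" "det hb \<noteq> 0" "det a \<noteq> 0" "det b \<noteq> 0"
      using det_sg ab det_1 by (auto simp: ha_def hb_def)
    define \<alpha> \<beta> where "\<alpha> = w \<bullet> (ha *v q)" and "\<beta> = w \<bullet> (hb *v q')"
    have ab0: "0 < \<alpha>" "0 < \<beta>"
      using w_sg ab qU by (auto simp: \<alpha>_def \<beta>_def ha_def hb_def)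
    define \<phi> \<psi> where "\<phi> = transpose (matrix_inv hb) *v w" and "\<psi> = transpose (matrix_inv ha) *v w"
    have ev: "\<phi> \<bullet> v = w \<bullet> (matrix_inv hb *v v)" "\<psi> \<bullet> v = w \<bullet> (matrix_inv ha *v v)" for v
      unfolding \<phi>_def \<psi>_def by (rule transpose_dot)+
    have pos: "0 < \<phi> \<bullet> u" "0 < \<psi> \<bullet> u" if "u \<in> U" for u
      unfolding ev ha_def hb_def using inv_sg_T ab that U_subset_T w_T by blast+
    let ?x = "pact w a q" and ?y = "pact w b q'"
    have x: "?x = (1 / \<alpha>) *\<^sub>R (ha *v q)" "?y = (1 / \<beta>) *\<^sub>R (hb *v q')"
      by (simp_all add: pact_sg \<alpha>_def \<beta>_def ha_def hb_def)
    have A: "\<phi> \<bullet> ?x = (w \<bullet> ((matrix_inv hb ** ha) *v q)) / \<alpha>"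
      unfolding ev x by (simp add: matrix_vector_mult_scaleR matrix_vector_mul_assoc)
    have B: "\<psi> \<bullet> ?y = (w \<bullet> ((matrix_inv ha ** hb) *v q')) / \<beta>"
      unfolding ev x by (simp add: matrix_vector_mult_scaleR matrix_vector_mul_assoc)
    have C': "\<phi> \<bullet> ?y = 1 / \<beta>" "\<psi> \<bullet> ?x = 1 / \<alpha>"
      unfolding ev x using matrix_inv_apply(2)[OF d(1)] matrix_inv_apply(2)[OF d(2)] w_U qU
      by (simp_all add: matrix_vector_mult_scaleR)
    define X Y where "X = w \<bullet> ((matrix_inv hb ** ha) *v q)" and "Y = w \<bullet> ((matrix_inv ha ** hb) *v q')"
    have prod: "((\<phi> \<bullet> ?x) / (\<phi> \<bullet> ?y)) * ((\<psi> \<bullet> ?y) / (\<psi> \<bullet> ?x)) = X * Y"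
      unfolding A B C' X_def Y_def using ab0 by simp
    have xy: "?x \<in> U" "?y \<in> U" using pact_in_U ab qU by auto
    have XY0: "0 < X" "0 < Y" using pos(1)[OF xy(1)] pos(2)[OF xy(2)] A B ab0
      by (auto simp: X_def Y_def zero_less_divide_iff)
    have "ln (X * Y) \<le> 2 * hilbert_dist U ?x ?y"
      using hilbert_dist_lower[OF xy pos(1) pos(2)] prod by simp
    then have le: "X * Y \<le> exp (2 * hilbert_dist U ?x ?y)"
      using XY0 by (metis exp_le_cancel_iff exp_ln mult_pos_pos)
    have bX: "c * onorm ((*v) (matrix_inv hb ** ha)) \<le> X" unfolding X_def
      by (rule c(2)) (use inv_sg_T[OF ab(2)] sg_T[OF ab(1)] q in \<open>auto simp: ha_def hb_def simp flip: matrix_vector_mul_assoc\<close>)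
    have bY: "c * onorm ((*v) (matrix_inv ha ** hb)) \<le> Y" unfolding Y_def
      by (rule c(2)) (use inv_sg_T[OF ab(1)] sg_T[OF ab(2)] q in \<open>auto simp: ha_def hb_def simp flip: matrix_vector_mul_assoc\<close>)
    have pm: "onorm ((*v) (matrix_inv hb ** ha)) = onorm ((*v) (matrix_inv b ** a))"
      "onorm ((*v) (matrix_inv ha ** hb)) = onorm ((*v) (matrix_inv a ** b))"
      using sg_cases[of a] sg_cases[of b] d
      by (auto simp: ha_def hb_def matrix_inv_uminus matrix_mult_uminus onorm_matrix_uminus)
    have "cond_number (matrix_inv a ** b) = onorm ((*v) (matrix_inv a ** b)) * onorm ((*v) (matrix_inv b ** a))"
    proof -
      have "matrix_inv (matrix_inv a) = a"
        using matrix_inv_cancel(2)[OF d(3)] by (rule matrix_inv_unique)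
      then have "matrix_inv (matrix_inv a ** b) = matrix_inv b ** a"
        using matrix_inv_mult[OF det_inv[OF d(3)] d(4)] by simp
      then show ?thesis by (simp add: cond_number_def)
    qed
    then have "c * c * cond_number (matrix_inv a ** b)
        = (c * onorm ((*v) (matrix_inv hb ** ha))) * (c * onorm ((*v) (matrix_inv ha ** hb)))"
      by (simp add: pm mult_ac)
    also have "\<dots> \<le> X * Y"
      using bX bY XY0 c(1) onorm_matrix_nonneg[of "matrix_inv ha ** hb"] by (intro mult_mono) auto
    also note le
    finally show ?thesis .
  qed
  moreover have "0 < c * c" using c(1) by simp
  ultimately show ?thesis using that by blast
qed

text \<open>A point of the compact set, scaled by \<kappa> m, dominates all vectors of norm at most
  m B in the cone order. Applied to h^-1 p and to h q this yields the two inequalities for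
  \<open>hilbert_dist_upper\<close>, and the scale \<open>b\<close> cancels.\<close>

lemma hilbert_le_cond_number:
  obtains A where "0 < A" "\<And>g q. g \<in> \<Gamma> \<Longrightarrow> q \<in> insert p K \<Longrightarrow>
    exp (2 * hilbert_dist U p (pact w g q)) \<le> A * cond_number g"
proof -
  obtain e where e: "0 < e" "\<And>q v. q \<in> insert p K \<Longrightarrow> norm v < e \<Longrightarrow> q + v \<in> T"
    using compact_margin[OF base_compact] by blast
  obtain B where B: "0 < B" "\<And>u. u \<in> U \<Longrightarrow> norm u \<le> B"
    using bounded_U by (auto simp: bounded_pos)
  \<comment> \<open>A vector of norm at most m B, divided by \<kappa> m, has norm at most e / 2 and
    stays within the margin.\<close>
  define \<kappa> where "\<kappa> = 2 * B / e"
  have \<kappa>: "0 < \<kappa>" using B(1) e(1) by (simp add: \<kappa>_def)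
  have dom: "(\<kappa> * m) *\<^sub>R q - v \<in> T"
    if "q \<in> insert p K" "0 < m" "norm v \<le> m * B" for q v m
  proof -
    have "norm v / (\<kappa> * m) \<le> e / 2"
      using that(2,3) B(1) e(1) by (simp add: \<kappa>_def field_simps)
    moreover have "norm (- (1 / (\<kappa> * m)) *\<^sub>R v) = norm v / (\<kappa> * m)"
      using \<kappa> that(2) by simp
    ultimately have "norm (- (1 / (\<kappa> * m)) *\<^sub>R v) < e" using e(1) by linarith
    from e(2)[OF that(1) this] have "(\<kappa> * m) *\<^sub>R (q + - (1 / (\<kappa> * m)) *\<^sub>R v) \<in> T"
      by (rule T_scale) (use \<kappa> that(2) in simp)
    also have "(\<kappa> * m) *\<^sub>R (q + - (1 / (\<kappa> * m)) *\<^sub>R v) = (\<kappa> * m) *\<^sub>R q - v"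
      using \<kappa> that(2) by (simp add: scaleR_diff_right)
    finally show ?thesis .
  qed
  have "exp (2 * hilbert_dist U p (pact w g q)) \<le> (\<kappa> * \<kappa>) * cond_number g"
    if g: "g \<in> \<Gamma>" and q: "q \<in> insert p K" for g q
  proof -
    have qU: "q \<in> U" using q base_compact by auto
    define h b where "h = sg g" and "b = w \<bullet> (h *v q)"
    have dh: "det h \<noteq> 0" using det_sg[OF g] by (simp add: h_def)
    have b: "0 < b" using w_sg[OF g qU] by (simp add: b_def h_def)
    define n n' where "n = onorm ((*v) h)" and "n' = onorm ((*v) (matrix_inv h))"
    have n: "0 < n" "0 < n'" using onorm_pos_of_det[OF dh] onorm_pos_of_det[OF det_inv[OF dh]]
      by (auto simp: n_def n'_def)
    let ?y = "pact w g q"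
    have y: "?y = (1 / b) *\<^sub>R (h *v q)" by (simp add: pact_sg h_def b_def)
    have "norm (matrix_inv h *v p) \<le> n' * B"
      unfolding n'_def
      by (rule order_trans[OF norm_matrix_le_onorm mult_left_mono[OF B(2)[OF p_U] onorm_matrix_nonneg]])
    then have "(\<kappa> * n') *\<^sub>R q - matrix_inv h *v p \<in> T" using n by (intro dom q)
    then have "h *v ((\<kappa> * n') *\<^sub>R q - matrix_inv h *v p) \<in> T"
      unfolding h_def by (rule sg_T[OF g])
    also have "h *v ((\<kappa> * n') *\<^sub>R q - matrix_inv h *v p) = (\<kappa> * n' * b) *\<^sub>R ?y - p"
      using b matrix_inv_apply(1)[OF dh] by (simp add: y matrix_vector_mult_diff_distrib matrix_vector_mult_scaleR)
    finally have 1: "(\<kappa> * n' * b) *\<^sub>R ?y - p \<in> closure T"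
      using closure_subset[of T] by blast
    have "norm (h *v q) \<le> n * B"
      unfolding n_def
      by (rule order_trans[OF norm_matrix_le_onorm mult_left_mono[OF B(2)[OF qU] onorm_matrix_nonneg]])
    then have "(\<kappa> * n) *\<^sub>R p - h *v q \<in> T" using n by (intro dom) auto
    then have "(1 / b) *\<^sub>R ((\<kappa> * n) *\<^sub>R p - h *v q) \<in> T"
      using b by (intro T_scale) auto
    also have "(1 / b) *\<^sub>R ((\<kappa> * n) *\<^sub>R p - h *v q) = (\<kappa> * n / b) *\<^sub>R p - ?y"
      by (simp add: y scaleR_diff_right)
    finally have 2: "(\<kappa> * n / b) *\<^sub>R p - ?y \<in> closure T"
      using closure_subset[of T] by blast
    have "2 * hilbert_dist U p ?y \<le> ln ((\<kappa> * n' * b) * (\<kappa> * n / b))"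
      using 1 2 by (intro hilbert_dist_upper p_U pact_in_U g qU)
    then have "exp (2 * hilbert_dist U p ?y) \<le> exp (ln ((\<kappa> * n' * b) * (\<kappa> * n / b)))"
      by simp
    also have "\<dots> = (\<kappa> * n' * b) * (\<kappa> * n / b)" using \<kappa> n b by simp
    also have "\<dots> = (\<kappa> * \<kappa>) * cond_number h"
      using b by (simp add: cond_number_def n_def n'_def)
    also have "cond_number h = cond_number g"
      using cond_number_uminus[of g] det_1[OF g] by (simp add: h_def sg_def)
    finally show ?thesis .
  qed
  moreover have "0 < \<kappa> * \<kappa>" using \<kappa> by simp
  ultimately show ?thesis using that by blast
qed

section \<open>Depth near the boundary, seen from the base point\<close>

lemma pact_one: "pact w (mat 1) p = p"
  using w_U[OF p_U] by (simp add: pact_def)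

text \<open>The test functionals are \<phi> and \<open>w\<close>. The latter is 1 at both points, so
  only the ratio of the values of \<phi> remains, and the value at \<open>p\<close> is bounded
  below.\<close>

lemma hilbert_far:
  obtains c where "0 < c" "\<And>\<phi> v m. norm \<phi> = 1 \<Longrightarrow> (\<And>u. u \<in> U \<Longrightarrow> 0 < \<phi> \<bullet> u) \<Longrightarrow> v \<in> U \<Longrightarrow>
    \<phi> \<bullet> v \<le> m \<Longrightarrow> c / m \<le> exp (2 * hilbert_dist U p v)"
proof -
  obtain c where c: "0 < c"
    "\<And>\<phi> q. (\<And>u. u \<in> U \<Longrightarrow> 0 \<le> \<phi> \<bullet> u) \<Longrightarrow> q \<in> insert p K \<Longrightarrow> c * norm \<phi> \<le> \<phi> \<bullet> q"
    using functional_lower_bound[OF base_compact] by blast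
  have "c / m \<le> exp (2 * hilbert_dist U p v)"
    if \<phi>: "norm \<phi> = 1" "\<And>u. u \<in> U \<Longrightarrow> 0 < \<phi> \<bullet> u" and v: "v \<in> U" "\<phi> \<bullet> v \<le> m" for \<phi> v m
  proof -
    have pv: "0 < \<phi> \<bullet> p" "0 < \<phi> \<bullet> v" using \<phi> v p_U by auto
    have "c \<le> \<phi> \<bullet> p" using c(2)[of \<phi> p] \<phi> by (simp add: less_imp_le)
    then have "c / m \<le> (\<phi> \<bullet> p) / (\<phi> \<bullet> v)"
      using pv v(2) c(1) by (intro frac_le) auto
    also have "\<dots> = exp (ln (((\<phi> \<bullet> p) / (\<phi> \<bullet> v)) * ((w \<bullet> v) / (w \<bullet> p))))"
      using pv w_U[OF v(1)] w_U[OF p_U] by simp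
    also have "\<dots> \<le> exp (2 * hilbert_dist U p v)"
      using hilbert_dist_lower[OF p_U v(1) \<phi>(2), of w] w_U by simp
    finally show ?thesis .
  qed
  with c(1) that show ?thesis by blast
qed

text \<open>The ray point dominates t p in the cone order, and by the margin a fixed multiple of
  \<open>p\<close> dominates the ray point.\<close>

lemma hilbert_near:
  obtains A where "0 < A" "\<And>x t. x \<in> closure U \<Longrightarrow> 0 < t \<Longrightarrow> t < 1 \<Longrightarrow> (1 - t) *\<^sub>R x + t *\<^sub>R p \<in> U \<Longrightarrow>
    exp (2 * hilbert_dist U p ((1 - t) *\<^sub>R x + t *\<^sub>R p)) \<le> A / t"
proof -
  obtain e where e: "0 < e" "\<And>q v. q \<in> insert p K \<Longrightarrow> norm v < e \<Longrightarrow> q + v \<in> T"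
    using compact_margin[OF base_compact] by blast
  obtain B where B: "0 < B" "\<And>u. u \<in> U \<Longrightarrow> norm u \<le> B"
    using bounded_U by (auto simp: bounded_pos)
  define A where "A = 2 * B / e"
  have A: "0 < A" using B(1) e(1) by (simp add: A_def)
  have "exp (2 * hilbert_dist U p z) \<le> A / t"
    if x: "x \<in> closure U" and t: "0 < t" "t < 1" and z: "z \<in> U" "z = (1 - t) *\<^sub>R x + t *\<^sub>R p" for x t z
  proof -
    have "(1 / t) *\<^sub>R z - p = ((1 - t) / t) *\<^sub>R x"
      using t by (simp add: z(2) scaleR_add_right)
    moreover have "\<dots> \<in> closure T" using x closure_U_subset t by (intro closure_T_scale) auto
    ultimately have 1: "(1 / t) *\<^sub>R z - p \<in> closure T" by simp
    have "norm (- (1 / A) *\<^sub>R z) < e"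
    proof -
      have "norm z / A \<le> B / A" using B(2)[OF z(1)] A by (intro divide_right_mono) auto
      also have "\<dots> = e / 2" using B(1) by (simp add: A_def)
      finally have "norm z / A \<le> e / 2" .
      moreover have "norm (- (1 / A) *\<^sub>R z) = norm z / A" using A by simp
      ultimately show ?thesis using e(1) by linarith
    qed
    from e(2)[OF _ this, of p] have "A *\<^sub>R (p + - (1 / A) *\<^sub>R z) \<in> T"
      using A by (intro T_scale) auto
    also have "A *\<^sub>R (p + - (1 / A) *\<^sub>R z) = A *\<^sub>R p - z"
      using A by (simp add: scaleR_diff_right)
    finally have 2: "A *\<^sub>R p - z \<in> closure T" using closure_subset[of T] by blast
    have "2 * hilbert_dist U p z \<le> ln ((1 / t) * A)"
      using 1 2 by (intro hilbert_dist_upper p_U z)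
    then have "exp (2 * hilbert_dist U p z) \<le> exp (ln ((1 / t) * A))" by simp
    also have "\<dots> = A / t" using A t by simp
    finally show ?thesis .
  qed
  with A that show ?thesis by blast
qed

text \<open>If \<open>\<phi>\<close> is tangent at \<open>x\<close> and is of order \<open>r\<^sup>2\<close> at both \<open>z\<close> and the orbit point \<open>g p\<close>,
  then it is of order \<open>r\<^sup>2\<close> on the segment between them, which therefore stays as far from
  \<open>p\<close> as \<open>z\<close> is. Hyperbolicity then forces \<open>z\<close> to lie near a geodesic from \<open>p\<close> to \<open>g p\<close>.\<close>
lemma cond_number_supermultiplicative:
  fixes R :: real
  assumes "0 < R"
  obtains E where "0 < E" "\<And>x \<phi> r a k g. x \<in> closure C - U \<Longrightarrow> norm \<phi> = 1 \<Longrightarrow> \<phi> \<bullet> x = 0 \<Longrightarrow>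
    (\<And>u. u \<in> U \<Longrightarrow> 0 < \<phi> \<bullet> u) \<Longrightarrow> 0 < r \<Longrightarrow> r < 1 \<Longrightarrow> a \<in> \<Gamma> \<Longrightarrow> k \<in> K \<Longrightarrow>
    (1 - r\<^sup>2) *\<^sub>R x + r\<^sup>2 *\<^sub>R p = pact w a k \<Longrightarrow> g \<in> \<Gamma> \<Longrightarrow> \<phi> \<bullet> pact w g p < R * r\<^sup>2 \<Longrightarrow>
    cond_number a * cond_number (matrix_inv a ** g) \<le> E * cond_number g"
proof -
  obtain c where c: "0 < c" "\<And>a b q q'. a \<in> \<Gamma> \<Longrightarrow> b \<in> \<Gamma> \<Longrightarrow> q \<in> insert p K \<Longrightarrow> q' \<in> insert p K \<Longrightarrow>
    c * cond_number (matrix_inv a ** b) \<le> exp (2 * hilbert_dist U (pact w a q) (pact w b q'))"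
    using cond_number_le_hilbert by blast
  obtain A where A: "0 < A" "\<And>g q. g \<in> \<Gamma> \<Longrightarrow> q \<in> insert p K \<Longrightarrow>
    exp (2 * hilbert_dist U p (pact w g q)) \<le> A * cond_number g"
    using hilbert_le_cond_number by blast
  obtain f where f: "0 < f" "\<And>\<phi> v m. norm \<phi> = 1 \<Longrightarrow> (\<And>u. u \<in> U \<Longrightarrow> 0 < \<phi> \<bullet> u) \<Longrightarrow> v \<in> U \<Longrightarrow>
    \<phi> \<bullet> v \<le> m \<Longrightarrow> f / m \<le> exp (2 * hilbert_dist U p v)"
    using hilbert_far by blast
  obtain N where N: "0 < N" "\<And>x t. x \<in> closure U \<Longrightarrow> 0 < t \<Longrightarrow> t < 1 \<Longrightarrow> (1 - t) *\<^sub>R x + t *\<^sub>R p \<in> U \<Longrightarrow>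
    exp (2 * hilbert_dist U p ((1 - t) *\<^sub>R x + t *\<^sub>R p)) \<le> N / t"
    using hilbert_near by blast
  obtain \<delta> where \<delta>: "0 \<le> \<delta>" "\<And>v x y z. v \<in> U \<Longrightarrow> x \<in> U \<Longrightarrow> y \<in> U \<Longrightarrow> z \<in> U \<Longrightarrow>
      min (gromov_product (hilbert_dist U) v x y) (gromov_product (hilbert_dist U) v y z) - \<delta>
        \<le> gromov_product (hilbert_dist U) v x z"
  proof -
    have "gromov_hyperbolic_on U (hilbert_dist U)" using data by (simp add: spcc_data_def)
    then show ?thesis using that unfolding gromov_hyperbolic_on_def by blast
  qed
  \<comment> \<open>Bounds \<phi> / r^2 at both ends of the segment: by \<open>R\<close> at the
    orbit point and by \<open>norm p\<close> at z, where \<phi> equals r^2 (\<phi> . p).\<close>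
  define m where "m = R + norm p"
  have m: "0 < m" using assms by (simp add: m_def add_pos_nonneg)
  \<comment> \<open>Half the logarithm of the quotient of the upper bound N / r^2 at z and the lower
    bound f / (m r^2) on the segment; r drops out.\<close>
  define c0 where "c0 = ln (N * m / f) / 2"
  \<comment> \<open>The exponent is twice the error 2 c0 + 4 \<delta> of
    \<open>gromov_segment_far\<close>; \<open>A\<close> and \<open>c\<close> convert distances into
    condition numbers.\<close>
  define E where "E = exp (4 * c0 + 8 * \<delta>) * A / (c * c)"
  have E: "0 < E" using A(1) c(1) by (simp add: E_def)
  have "cond_number a * cond_number (matrix_inv a ** g) \<le> E * cond_number g"
    if x: "x \<in> closure C - U" and \<phi>: "norm \<phi> = 1" "\<phi> \<bullet> x = 0" "\<And>u. u \<in> U \<Longrightarrow> 0 < \<phi> \<bullet> u"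
      and r: "0 < r" "r < 1" and a: "a \<in> \<Gamma>" "k \<in> K" and zk: "(1 - r\<^sup>2) *\<^sub>R x + r\<^sup>2 *\<^sub>R p = pact w a k"
      and g: "g \<in> \<Gamma>" "\<phi> \<bullet> pact w g p < R * r\<^sup>2" for x \<phi> r a k g
  proof -
    let ?d = "hilbert_dist U"
    define z y where "z = pact w a k" and "y = pact w g p"
    have kU: "k \<in> U" using a(2) K(2) C_subset_U by blast
    have zU: "z \<in> U" and yU: "y \<in> U"
      using pact_in_U[OF a(1) kU] pact_in_U[OF g(1) p_U] by (auto simp: z_def y_def)
    have r2: "0 < r\<^sup>2" "r\<^sup>2 < 1" using r by (auto simp: power_less_one_iff)
    have near: "exp (2 * ?d p z) \<le> N / r\<^sup>2"
      using N(2)[of x "r\<^sup>2"] x closure_C_subset r2 zk zU by (auto simp: z_def)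
    have \<phi>p: "\<phi> \<bullet> p \<le> norm p"
      using norm_cauchy_schwarz[of \<phi> p] \<phi>(1) by simp
    have "\<phi> \<bullet> z = r\<^sup>2 * (\<phi> \<bullet> p)"
      unfolding z_def zk[symmetric] using \<phi>(2) by (simp add: inner_add_right)
    also have "\<dots> \<le> r\<^sup>2 * m"
      using \<phi>p assms r2 by (intro mult_left_mono) (auto simp: m_def)
    finally have \<phi>z: "\<phi> \<bullet> z \<le> m * r\<^sup>2" by (simp add: mult.commute)
    have "R * r\<^sup>2 \<le> m * r\<^sup>2" using r2 by (intro mult_right_mono) (auto simp: m_def)
    then have \<phi>y: "\<phi> \<bullet> y \<le> m * r\<^sup>2" using g(2) by (simp add: y_def)
    have far: "?d p z - c0 \<le> ?d p v" if v: "v \<in> closed_segment y z" for v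
    proof -
      obtain \<tau> where \<tau>: "0 \<le> \<tau>" "\<tau> \<le> 1" "v = (1 - \<tau>) *\<^sub>R y + \<tau> *\<^sub>R z"
        using v by (auto simp: closed_segment_def)
      have vU: "v \<in> U" using M_segment(1)[OF yU zU \<tau>] .
      have "\<phi> \<bullet> v = (1 - \<tau>) * (\<phi> \<bullet> y) + \<tau> * (\<phi> \<bullet> z)"
        by (simp add: \<tau>(3) inner_add_right)
      also have "\<dots> \<le> (1 - \<tau>) * (m * r\<^sup>2) + \<tau> * (m * r\<^sup>2)"
        using \<tau> \<phi>y \<phi>z by (intro add_mono mult_left_mono) auto
      also have "\<dots> = m * r\<^sup>2" by (simp add: algebra_simps)
      finally have "f / (m * r\<^sup>2) \<le> exp (2 * ?d p v)" by (intro f(2)[OF \<phi>(1,3) vU])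
      then have "(N * m / f) * (f / (m * r\<^sup>2)) \<le> (N * m / f) * exp (2 * ?d p v)"
        using N(1) m f(1) by (intro mult_left_mono) auto
      moreover have "(N * m / f) * (f / (m * r\<^sup>2)) = N / r\<^sup>2" using m f(1) r2 by simp
      ultimately have "exp (2 * ?d p z) \<le> (N * m / f) * exp (2 * ?d p v)" using near by linarith
      also have "N * m / f = exp (2 * c0)" using N(1) m f(1) by (simp add: c0_def)
      finally have "exp (2 * ?d p z) \<le> exp (2 * c0 + 2 * ?d p v)" by (simp add: exp_add)
      then show ?thesis by simp
    qed
    have "?d p z + ?d z y - (2 * c0 + 4 * \<delta>) \<le> ?d p y"
      by (rule gromov_segment_far[OF \<delta>(2)[OF p_U] \<delta>(1) p_U yU zU far])
    then have "exp (2 * ?d p z + 2 * ?d z y) \<le> exp ((4 * c0 + 8 * \<delta>) + 2 * ?d p y)" by simp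
    then have *: "exp (2 * ?d p z) * exp (2 * ?d z y) \<le> exp (4 * c0 + 8 * \<delta>) * exp (2 * ?d p y)"
      by (simp only: exp_add)
    have "c * cond_number a \<le> exp (2 * ?d p z)"
    proof -
      have "matrix_inv (mat 1 :: real^'n^'n) ** a = a"
        using matrix_inv_unique[of "mat 1 :: real^'n^'n" "mat 1"] by simp
      then show ?thesis using c(2)[OF one_in a(1), of p k] a(2) by (simp add: pact_one z_def)
    qed
    moreover have "c * cond_number (matrix_inv a ** g) \<le> exp (2 * ?d z y)"
      using c(2)[OF a(1) g(1), of k p] a(2) by (simp add: z_def y_def)
    ultimately have "(c * cond_number a) * (c * cond_number (matrix_inv a ** g)) \<le> exp (2 * ?d p z) * exp (2 * ?d z y)"
      using c(1) cond_number_nonneg[of "matrix_inv a ** g"] by (intro mult_mono) auto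
    also note *
    also have "exp (4 * c0 + 8 * \<delta>) * exp (2 * ?d p y) \<le> exp (4 * c0 + 8 * \<delta>) * (A * cond_number g)"
      using A(2)[OF g(1), of p] by (intro mult_left_mono) (auto simp: y_def)
    finally show ?thesis using c(1) by (simp add: E_def field_simps)
  qed
  with E that show ?thesis by blast
qed

text \<open>Turns radii into weights: \<phi> is at most r^2 norm p at the ray point, which is
  therefore at depth at least ln (1 / r) - O(1), and the power - s / 2 of
  \<open>cond_number a\<close> is O(r^s).\<close>

lemma cond_number_lower:
  obtains c where "0 < c" "\<And>x \<phi> r a k. x \<in> closure C - U \<Longrightarrow> norm \<phi> = 1 \<Longrightarrow> \<phi> \<bullet> x = 0 \<Longrightarrow>
    (\<And>u. u \<in> U \<Longrightarrow> 0 < \<phi> \<bullet> u) \<Longrightarrow> 0 < r \<Longrightarrow> r < 1 \<Longrightarrow> a \<in> \<Gamma> \<Longrightarrow> k \<in> K \<Longrightarrow>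
    (1 - r\<^sup>2) *\<^sub>R x + r\<^sup>2 *\<^sub>R p = pact w a k \<Longrightarrow> c / r\<^sup>2 \<le> cond_number a"
proof -
  obtain A where A: "0 < A" "\<And>g q. g \<in> \<Gamma> \<Longrightarrow> q \<in> insert p K \<Longrightarrow>
    exp (2 * hilbert_dist U p (pact w g q)) \<le> A * cond_number g"
    using hilbert_le_cond_number by blast
  obtain f where f: "0 < f" "\<And>\<phi> v m. norm \<phi> = 1 \<Longrightarrow> (\<And>u. u \<in> U \<Longrightarrow> 0 < \<phi> \<bullet> u) \<Longrightarrow> v \<in> U \<Longrightarrow>
    \<phi> \<bullet> v \<le> m \<Longrightarrow> f / m \<le> exp (2 * hilbert_dist U p v)"
    using hilbert_far by blast
  have np: "0 < norm p" using w_U[OF p_U] by auto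
  have "f / (norm p * A) / r\<^sup>2 \<le> cond_number a"
    if x: "x \<in> closure C - U" and \<phi>: "norm \<phi> = 1" "\<phi> \<bullet> x = 0" "\<And>u. u \<in> U \<Longrightarrow> 0 < \<phi> \<bullet> u"
      and r: "0 < r" "r < 1" and a: "a \<in> \<Gamma>" "k \<in> K" and zk: "(1 - r\<^sup>2) *\<^sub>R x + r\<^sup>2 *\<^sub>R p = pact w a k"
      for x \<phi> r a k
  proof -
    have "k \<in> U" using a(2) K(2) C_subset_U by blast
    then have zU: "pact w a k \<in> U" by (rule pact_in_U[OF a(1)])
    have "\<phi> \<bullet> p \<le> norm p" using norm_cauchy_schwarz[of \<phi> p] \<phi>(1) by simp
    then have "r\<^sup>2 * (\<phi> \<bullet> p) \<le> r\<^sup>2 * norm p" by (intro mult_left_mono) auto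
    then have "\<phi> \<bullet> pact w a k \<le> r\<^sup>2 * norm p"
      unfolding zk[symmetric] using \<phi>(2) by (simp add: inner_add_right)
    from f(2)[OF \<phi>(1,3) zU this] have "f / (r\<^sup>2 * norm p) \<le> exp (2 * hilbert_dist U p (pact w a k))" .
    also have "\<dots> \<le> A * cond_number a" using a by (intro A(2)) auto
    finally have "f / (r\<^sup>2 * norm p) \<le> cond_number a * A" by (simp only: mult.commute)
    then have "f / (r\<^sup>2 * norm p) / A \<le> cond_number a"
      by (simp only: pos_divide_le_eq[OF A(1)])
    then show ?thesis by (simp add: mult_ac)
  qed
  moreover have "0 < f / (norm p * A)" using f(1) A(1) np by simp
  ultimately show ?thesis using that by blast
qed

text \<open>For tangent pairs, \<open>\<phi> \<bullet> y + \<psi> \<bullet> x = (\<phi> - \<psi>) \<bullet> (y - x)\<close>, so that \<open>\<phi> \<bullet> y\<close> is quadratic in the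
  distance; the restriction to small \<open>r\<close> excludes the antipodal representatives.\<close>
lemma tangent_quadratic:
  obtains r0 B where "0 < r0" "0 < B" "\<And>x \<phi> y \<psi> r. (x, \<phi>) \<in> sym_boundary_image U C \<Longrightarrow>
    (y, \<psi>) \<in> sym_boundary_image U C \<Longrightarrow> pdist2 (x, \<phi>) (y, \<psi>) \<le> r \<Longrightarrow> r < r0 \<Longrightarrow>
    (\<phi> /\<^sub>R norm \<phi>) \<bullet> y \<le> B * r\<^sup>2"
proof -
  obtain B where B: "0 < B" "\<And>v. v \<in> closure T \<Longrightarrow> norm v \<le> B * (w \<bullet> v)"
    using exists_norm_bound by blast
  obtain c where c: "0 < c"
    "\<And>\<phi> q. (\<And>u. u \<in> U \<Longrightarrow> 0 \<le> \<phi> \<bullet> u) \<Longrightarrow> q \<in> insert p K \<Longrightarrow> c * norm \<phi> \<le> \<phi> \<bullet> q"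
    using functional_lower_bound[OF base_compact] by blast
  have np: "0 < norm p" "0 < norm w" using w_U[OF p_U] by auto
  \<comment> \<open>The two terms bound from below the norms of x' + y', tested with
    \<open>w\<close>, and of \<phi>' + \<psi>', tested at \<open>p\<close>. Below them the minimum
    in \<open>pdist\<close> is attained by the difference.\<close>
  define r0 where "r0 = min (2 / (B * norm w)) (2 * c / norm p)"
  have r0: "0 < r0" using B(1) c(1) np by (simp add: r0_def)
  have "(\<phi> /\<^sub>R norm \<phi>) \<bullet> y \<le> B * r\<^sup>2"
    if P: "(x, \<phi>) \<in> sym_boundary_image U C" and Q: "(y, \<psi>) \<in> sym_boundary_image U C"
      and d: "pdist2 (x, \<phi>) (y, \<psi>) \<le> r" and r: "r < r0" for x \<phi> y \<psi> r
  proof -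
    have x: "x \<in> closure C" "\<phi> \<noteq> 0" "\<phi> \<bullet> x = 0" "\<And>u. u \<in> U \<Longrightarrow> 0 < \<phi> \<bullet> u"
      and y: "y \<in> closure C" "\<psi> \<noteq> 0" "\<psi> \<bullet> y = 0" "\<And>u. u \<in> U \<Longrightarrow> 0 < \<psi> \<bullet> u"
      using P Q by (auto simp: sym_boundary_image_def)
    have cl: "x \<in> closure T" "y \<in> closure T" using x y closure_C_subset closure_U_subset by auto
    have w1: "w \<bullet> x = 1" "w \<bullet> y = 1" using x y closure_C_subset w_closure_U by auto
    have nB: "norm x \<le> B" "norm y \<le> B" using B(2)[OF cl(1)] B(2)[OF cl(2)] w1 by auto
    have nz: "0 < norm x" "0 < norm y" "0 < norm \<phi>" "0 < norm \<psi>" using w1 x y by auto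
    define x' y' \<phi>' \<psi>' where "x' = x /\<^sub>R norm x" and "y' = y /\<^sub>R norm y"
      and "\<phi>' = \<phi> /\<^sub>R norm \<phi>" and "\<psi>' = \<psi> /\<^sub>R norm \<psi>"
    have n1: "norm \<phi>' = 1" "norm \<psi>' = 1" using nz by (auto simp: \<phi>'_def \<psi>'_def)
    have px: "norm (x' - y') \<le> r"
    proof -
      have "1 / B \<le> w \<bullet> x'" "1 / B \<le> w \<bullet> y'"
        using w1 nB nz B(1) by (simp_all add: x'_def y'_def field_simps)
      then have "2 / B \<le> w \<bullet> (x' + y')" by (simp add: inner_add_right)
      also have "\<dots> \<le> norm w * norm (x' + y')" by (rule norm_cauchy_schwarz)
      finally have "2 / (B * norm w) \<le> norm (x' + y')" using B(1) np by (simp add: field_simps)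
      then have "r < norm (x' + y')" using r by (simp add: r0_def)
      moreover have "min (norm (x' - y')) (norm (x' + y')) \<le> r"
        using d by (simp add: pdist2_def pdist_def x'_def y'_def)
      ultimately show ?thesis by (simp add: min_def split: if_splits)
    qed
    have p\<phi>: "norm (\<phi>' - \<psi>') \<le> r"
    proof -
      have "0 \<le> \<phi>' \<bullet> u" "0 \<le> \<psi>' \<bullet> u" if "u \<in> U" for u
        using x(4)[OF that] y(4)[OF that] by (auto simp: \<phi>'_def \<psi>'_def)
      then have "c \<le> \<phi>' \<bullet> p" "c \<le> \<psi>' \<bullet> p"
        using c(2)[of \<phi>' p] c(2)[of \<psi>' p] n1 by auto
      then have "2 * c \<le> (\<phi>' + \<psi>') \<bullet> p" by (simp add: inner_add_left)
      also have "\<dots> \<le> norm (\<phi>' + \<psi>') * norm p" by (rule norm_cauchy_schwarz)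
      finally have "2 * c / norm p \<le> norm (\<phi>' + \<psi>')" using np by (simp add: field_simps)
      then have "r < norm (\<phi>' + \<psi>')" using r by (simp add: r0_def)
      moreover have "min (norm (\<phi>' - \<psi>')) (norm (\<phi>' + \<psi>')) \<le> r"
        using d by (simp add: pdist2_def pdist_def \<phi>'_def \<psi>'_def)
      ultimately show ?thesis by (simp add: min_def split: if_splits)
    qed
    have r0': "0 \<le> r" using px norm_ge_zero[of "x' - y'"] by linarith
    have psix: "0 \<le> \<psi> \<bullet> x"
      using nonneg_closure_T[of \<psi> x] y(4) cl by (simp add: less_imp_le)
    then have psix': "0 \<le> \<psi>' \<bullet> x'" by (simp add: \<psi>'_def x'_def)
    have "\<phi>' \<bullet> y' + \<psi>' \<bullet> x' = (\<phi>' - \<psi>') \<bullet> (y' - x')"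
      using x(3) y(3) by (simp add: inner_diff_left inner_diff_right \<phi>'_def \<psi>'_def x'_def y'_def)
    also have "\<dots> \<le> norm (\<phi>' - \<psi>') * norm (y' - x')" by (rule norm_cauchy_schwarz)
    also have "\<dots> \<le> r * r"
      using px p\<phi> r0' by (intro mult_mono) (auto simp: norm_minus_commute)
    finally have "\<phi>' \<bullet> y' \<le> r\<^sup>2" using psix' by (simp add: power2_eq_square)
    then have "norm y * (\<phi>' \<bullet> y') \<le> norm y * r\<^sup>2" by (intro mult_left_mono) auto
    also have "\<dots> \<le> B * r\<^sup>2" using nB by (intro mult_right_mono) auto
    finally have "norm y * (\<phi>' \<bullet> y') \<le> B * r\<^sup>2" .
    moreover have "\<phi>' \<bullet> y = norm y * (\<phi>' \<bullet> y')" using nz by (simp add: y'_def)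
    ultimately have "\<phi>' \<bullet> y \<le> B * r\<^sup>2" by simp
    then show ?thesis unfolding \<phi>'_def .
  qed
  with r0 B(1) that show ?thesis by blast
qed

end

section \<open>The lower bound\<close>

lemma sum_UN_le:
  fixes f :: "'a \<Rightarrow> real"
  assumes "finite I" and fin: "\<And>i. finite (A i)" and nonneg: "\<And>x. 0 \<le> f x"
  shows "sum f (\<Union>i\<in>I. A i) \<le> (\<Sum>i\<in>I. sum f (A i))"
  using assms(1)
proof (induction I rule: finite_induct)
  case (insert i I)
  let ?Y = "\<Union>i\<in>I. A i"
  have "sum f (A i \<union> ?Y) + sum f (A i \<inter> ?Y) = sum f (A i) + sum f ?Y"
    using insert fin by (intro sum.union_inter) auto
  moreover have "0 \<le> sum f (A i \<inter> ?Y)" using nonneg by (intro sum_nonneg)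
  ultimately show ?case using insert by simp
qed simp

context convex_cocompact
begin

lemma cond_number_pos: "g \<in> \<Gamma> \<Longrightarrow> 0 < cond_number g"
  using onorm_pos_of_det[of g] onorm_pos_of_det[of "matrix_inv g"] det_1[of g] det_1[of "matrix_inv g"] inv_in[of g]
  by (simp add: cond_number_def)

text \<open>A cover of the limit set with small \<open>s\<close>-dimensional sum yields translates \<open>a i\<close> whose shadows
  contain all but finitely many orbit points, and supermultiplicativity of \<open>cond_number\<close> along these
  shadows bounds the Poincare series by a finite sum plus half of itself.\<close>
lemma poincare_series_bounded:
  assumes zero: "hausdorff_measure pdist2 s (sym_boundary_image U C) = 0" and s: "0 < s"
  obtains B where "\<And>G. finite G \<Longrightarrow> G \<subseteq> \<Gamma> \<Longrightarrow> (\<And>a g. a \<in> \<Gamma> \<Longrightarrow> g \<in> G \<Longrightarrow> cond_number a \<le> cond_number g \<Longrightarrow> a \<in> G) \<Longrightarrow>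
    (\<Sum>g\<in>G. cond_number g powr (- (s / 2))) \<le> B"
proof -
  let ?\<Lambda> = "sym_boundary_image U C"
  obtain r0 B where r0: "0 < r0" and B: "0 < B"
    and quad: "\<And>x \<phi> y \<psi> r. (x, \<phi>) \<in> ?\<Lambda> \<Longrightarrow> (y, \<psi>) \<in> ?\<Lambda> \<Longrightarrow> pdist2 (x, \<phi>) (y, \<psi>) \<le> r \<Longrightarrow> r < r0 \<Longrightarrow>
      (\<phi> /\<^sub>R norm \<phi>) \<bullet> y \<le> B * r\<^sup>2"
    using tangent_quadratic by blast
  \<comment> \<open>Exceeds \<open>B\<close> to give strict inequalities, so that the half-spaces
    \<open>W i\<close> are open and compactness applies.\<close>
  define R where "R = B + 1"
  have R: "0 < R" "B < R" using B by (auto simp: R_def)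
  obtain E where E: "0 < E" and super: "\<And>x \<phi> r a k g. x \<in> closure C - U \<Longrightarrow> norm \<phi> = 1 \<Longrightarrow> \<phi> \<bullet> x = 0 \<Longrightarrow>
    (\<And>u. u \<in> U \<Longrightarrow> 0 < \<phi> \<bullet> u) \<Longrightarrow> 0 < r \<Longrightarrow> r < 1 \<Longrightarrow> a \<in> \<Gamma> \<Longrightarrow> k \<in> K \<Longrightarrow>
    (1 - r\<^sup>2) *\<^sub>R x + r\<^sup>2 *\<^sub>R p = pact w a k \<Longrightarrow> g \<in> \<Gamma> \<Longrightarrow> \<phi> \<bullet> pact w g p < R * r\<^sup>2 \<Longrightarrow>
    cond_number a * cond_number (matrix_inv a ** g) \<le> E * cond_number g"
    using cond_number_supermultiplicative[OF R(1)] by blast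
  obtain c where c: "0 < c" and lower: "\<And>x \<phi> r a k. x \<in> closure C - U \<Longrightarrow> norm \<phi> = 1 \<Longrightarrow> \<phi> \<bullet> x = 0 \<Longrightarrow>
    (\<And>u. u \<in> U \<Longrightarrow> 0 < \<phi> \<bullet> u) \<Longrightarrow> 0 < r \<Longrightarrow> r < 1 \<Longrightarrow> a \<in> \<Gamma> \<Longrightarrow> k \<in> K \<Longrightarrow>
    (1 - r\<^sup>2) *\<^sub>R x + r\<^sup>2 *\<^sub>R p = pact w a k \<Longrightarrow> c / r\<^sup>2 \<le> cond_number a"
    using cond_number_lower by blast
  \<comment> \<open>Radii must stay below 1 and \<open>r0\<close>. The third bound gives r^2 <= c /
    E, hence E <= cond_number (a i), which keeps a_i^-1 g in the truncated set.\<close>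
  define \<theta> where "\<theta> = min (min (1/2) (r0 / 2)) (sqrt (c / E))"
  have \<theta>: "0 < \<theta>" "\<theta> < 1" "\<theta> < r0" "\<theta> \<le> sqrt (c / E)"
    using r0 c E by (auto simp: \<theta>_def)
  define Z where "Z = E powr (s / 2) * c powr (- (s / 2))"
  have Z: "0 < Z" using E c by (simp add: Z_def)
  \<comment> \<open>\<theta>^s forces every single radius below \<theta>; 1 / (2 Z) produces the
    factor one half, as Z collects the constants of \<open>super\<close> and
    \<open>lower\<close>.\<close>
  define \<eta> where "\<eta> = min (\<theta> powr s) (1 / (2 * Z))"
  have \<eta>: "0 < \<eta>" using \<theta> Z by (simp add: \<eta>_def)
  obtain V :: "nat \<Rightarrow> _" and r where cover: "?\<Lambda> \<subseteq> (\<Union>i. V i)" and r: "\<And>i. 0 < r i"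
    and diam: "\<And>i P Q. P \<in> V i \<Longrightarrow> Q \<in> V i \<Longrightarrow> pdist2 P Q \<le> r i"
    and sum_r: "\<And>I. finite I \<Longrightarrow> (\<Sum>i\<in>I. r i powr s) \<le> \<eta>"
    using hausdorff_measure_zeroD[OF zero s \<eta> pdist2_nonneg] by blast
  have r\<theta>: "r i \<le> \<theta>" for i
  proof (rule ccontr)
    assume "\<not> r i \<le> \<theta>"
    then have "\<theta> powr s < r i powr s" using \<theta>(1) s by (intro powr_less_mono2) auto
    also have "\<dots> \<le> \<theta> powr s" using sum_r[of "{i}"] by (simp add: \<eta>_def)
    finally show False by simp
  qed
  have r1: "r i < 1" "r i < r0" for i using r\<theta>[of i] \<theta> by linarith+
  define J where "J = {i. V i \<inter> ?\<Lambda> \<noteq> {}}"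
  have "\<forall>i\<in>J. \<exists>q. fst q \<in> closure C - U \<and> norm (fst (snd q)) = 1 \<and> fst (snd q) \<bullet> fst q = 0 \<and>
      (\<forall>u\<in>U. 0 < fst (snd q) \<bullet> u) \<and> fst (snd (snd q)) \<in> \<Gamma> \<and> snd (snd (snd q)) \<in> K \<and>
      (1 - (r i)\<^sup>2) *\<^sub>R fst q + (r i)\<^sup>2 *\<^sub>R p = pact w (fst (snd (snd q))) (snd (snd (snd q))) \<and>
      (\<forall>y \<psi>. (y, \<psi>) \<in> V i \<inter> ?\<Lambda> \<longrightarrow> fst (snd q) \<bullet> y < R * (r i)\<^sup>2)"
  proof
    fix i assume "i \<in> J"
    then obtain x \<phi> where x\<phi>: "(x, \<phi>) \<in> V i" "(x, \<phi>) \<in> ?\<Lambda>"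
      by (auto simp: J_def)
    then have x: "x \<in> closure C - U" and \<phi>: "\<phi> \<noteq> 0" "\<phi> \<bullet> x = 0" "\<And>u. u \<in> U \<Longrightarrow> 0 < \<phi> \<bullet> u"
      by (auto simp: sym_boundary_image_def)
    have r2: "0 < (r i)\<^sup>2" "(r i)\<^sup>2 < 1"
      using r[of i] r1(1)[of i] by (auto simp: power_less_one_iff)
    obtain a k where a: "a \<in> \<Gamma>" "k \<in> K" "(1 - (r i)\<^sup>2) *\<^sub>R x + (r i)\<^sup>2 *\<^sub>R p = pact w a k"
      using ray_meets_translate[OF x r2] by blast
    have small: "(\<phi> /\<^sub>R norm \<phi>) \<bullet> y < R * (r i)\<^sup>2"
      if "(y, \<psi>) \<in> V i \<inter> ?\<Lambda>" for y \<psi>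
    proof -
      have "(\<phi> /\<^sub>R norm \<phi>) \<bullet> y \<le> B * (r i)\<^sup>2"
        using quad[OF x\<phi>(2) _ diam[OF x\<phi>(1)] r1(2)] that by blast
      also have "\<dots> < R * (r i)\<^sup>2" using R(2) r2 by (intro mult_strict_right_mono) auto
      finally show ?thesis .
    qed
    have unit: "norm (\<phi> /\<^sub>R norm \<phi>) = 1" "(\<phi> /\<^sub>R norm \<phi>) \<bullet> x = 0"
      using \<phi> by auto
    have upos: "0 < (\<phi> /\<^sub>R norm \<phi>) \<bullet> u"
      if "u \<in> U" for u using \<phi>(1) \<phi>(3)[OF that] by simp
    show "\<exists>q. fst q \<in> closure C - U \<and> norm (fst (snd q)) = 1 \<and> fst (snd q) \<bullet> fst q = 0 \<and>
      (\<forall>u\<in>U. 0 < fst (snd q) \<bullet> u) \<and> fst (snd (snd q)) \<in> \<Gamma> \<and> snd (snd (snd q)) \<in> K \<and>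
      (1 - (r i)\<^sup>2) *\<^sub>R fst q + (r i)\<^sup>2 *\<^sub>R p = pact w (fst (snd (snd q))) (snd (snd (snd q))) \<and>
      (\<forall>y \<psi>. (y, \<psi>) \<in> V i \<inter> ?\<Lambda> \<longrightarrow> fst (snd q) \<bullet> y < R * (r i)\<^sup>2)"
      by (rule exI[of _ "(x, \<phi> /\<^sub>R norm \<phi>, a, k)"], unfold fst_conv snd_conv, intro conjI ballI allI impI)
        (rule x unit upos a small, assumption?)+
  qed
  then obtain q where q: "\<And>i. i \<in> J \<Longrightarrow> fst (q i) \<in> closure C - U \<and> norm (fst (snd (q i))) = 1 \<and>
      fst (snd (q i)) \<bullet> fst (q i) = 0 \<and>
      (\<forall>u\<in>U. 0 < fst (snd (q i)) \<bullet> u) \<and> fst (snd (snd (q i))) \<in> \<Gamma> \<and> snd (snd (snd (q i))) \<in> K \<and>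
      (1 - (r i)\<^sup>2) *\<^sub>R fst (q i) + (r i)\<^sup>2 *\<^sub>R p = pact w (fst (snd (snd (q i)))) (snd (snd (snd (q i)))) \<and>
      (\<forall>y \<psi>. (y, \<psi>) \<in> V i \<inter> ?\<Lambda> \<longrightarrow> fst (snd (q i)) \<bullet> y < R * (r i)\<^sup>2)"
    unfolding bchoice_iff by blast
  define \<phi> a where "\<phi> i = fst (snd (q i))" and "a i = fst (snd (snd (q i)))" for i
  have a: "a i \<in> \<Gamma>" if "i \<in> J" for i using q[OF that] by (simp add: a_def)
  have \<phi>small: "\<phi> i \<bullet> y < R * (r i)\<^sup>2"
    if "i \<in> J" "(y, \<psi>) \<in> V i" "(y, \<psi>) \<in> ?\<Lambda>" for i y \<psi>
    using q[OF that(1)] that(2,3) unfolding \<phi>_def by blast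
  have cond_number_a: "c / (r i)\<^sup>2 \<le> cond_number (a i)" if "i \<in> J" for i
    using q[OF that] lower[of "fst (q i)" "\<phi> i" "r i" "a i" "snd (snd (snd (q i)))"] r[of i] r1(1)[of i]
    by (simp add: \<phi>_def a_def)
  have super': "cond_number (a i) * cond_number (matrix_inv (a i) ** g) \<le> E * cond_number g"
    if "i \<in> J" "g \<in> \<Gamma>" "\<phi> i \<bullet> pact w g p < R * (r i)\<^sup>2" for i g
    using q[OF that(1)] super[of "fst (q i)" "\<phi> i" "r i" "a i" "snd (snd (snd (q i)))" g] r[of i] r1(1)[of i] that
    by (simp add: \<phi>_def a_def)
  define W where "W i = {y. \<phi> i \<bullet> y < R * (r i)\<^sup>2}" for i
  have openW: "open (W i)" for i unfolding W_def by (rule open_halfspace_lt)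
  have cpt: "compact (closure C)"
    using bounded_U C_subset_U by (simp add: compact_closure bounded_subset)
  \<comment> \<open>\<open>U\<close> is open only inside the chart, where it agrees with the open
    cone \<open>T\<close>; removing \<open>T\<close> instead shows that the limit set is
    compact.\<close>
  have clT: "closure C - U = closure C - T"
    using closure_C_subset w_closure_U T_iff_U by blast
  have "compact (closure C - U)" unfolding clT using cpt open_T by (rule compact_diff)
  moreover have covW: "closure C - U \<subseteq> (\<Union>i\<in>J. W i)"
  proof
    fix y assume y: "y \<in> closure C - U"
    obtain \<psi> where "\<psi> \<noteq> 0" "\<psi> \<bullet> y = 0" "\<And>u. u \<in> U \<Longrightarrow> 0 < \<psi> \<bullet> u"
      using supporting_functional[of y] y closure_C_subset by blast
    then have mem: "(y, \<psi>) \<in> ?\<Lambda>" using y by (auto simp: sym_boundary_image_def)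
    then obtain i where i: "(y, \<psi>) \<in> V i" using cover by blast
    then have "i \<in> J" using mem by (auto simp: J_def)
    then show "y \<in> (\<Union>i\<in>J. W i)"
      using \<phi>small[OF \<open>i \<in> J\<close> i mem] by (auto simp: W_def)
  qed
  ultimately obtain I where I: "I \<subseteq> J" "finite I" "closure C - U \<subseteq> (\<Union>i\<in>I. W i)"
    using compactE_image[of "closure C - U" J W] openW by blast
  \<comment> \<open>The orbit points in no half-space lie in a compact set that avoids the boundary,
    so they come from finitely many elements.\<close>
  define F where "F = {g \<in> \<Gamma>. pact w g p \<in> closure C - (\<Union>i\<in>I. W i)}"
  have finF: "finite F" unfolding F_def
  proof (rule finite_orbit_compact)
    show "compact (closure C - (\<Union>i\<in>I. W i))"
      using cpt by (rule compact_diff) (use openW in blast)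
    show "closure C - (\<Union>i\<in>I. W i) \<subseteq> U" using I(3) by blast
  qed
  let ?P = "\<lambda>g. cond_number g powr (- (s / 2))"
  have sumP: "(\<Sum>i\<in>I. E powr (s / 2) * ?P (a i)) \<le> 1 / 2"
  proof -
    have "E powr (s / 2) * ?P (a i) \<le> Z * r i powr s" if "i \<in> I" for i
    proof -
      have iJ: "i \<in> J" using that I by blast
      have "?P (a i) \<le> (c / (r i)\<^sup>2) powr (- (s / 2))"
        using cond_number_a[OF iJ] c r[of i] s by (intro powr_mono2') auto
      also have "\<dots> = c powr (- (s / 2)) * r i powr s"
      proof -
        have "(r i)\<^sup>2 powr (- (s / 2)) = r i powr (- s)"
          using r[of i] by (simp add: powr_powr flip: powr_numeral)
        then show ?thesis using c r[of i] by (simp add: powr_divide powr_minus field_simps)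
      qed
      finally have "E powr (s / 2) * ?P (a i) \<le> E powr (s / 2) * (c powr (- (s / 2)) * r i powr s)"
        by (rule mult_left_mono) simp
      then show ?thesis by (simp add: Z_def mult.assoc)
    qed
    then have "(\<Sum>i\<in>I. E powr (s / 2) * ?P (a i)) \<le> (\<Sum>i\<in>I. Z * r i powr s)"
      by (rule sum_mono)
    also have "\<dots> = Z * (\<Sum>i\<in>I. r i powr s)" by (simp add: sum_distrib_left)
    also have "\<dots> \<le> Z * (1 / (2 * Z))"
      using sum_r[OF I(2)] Z by (intro mult_left_mono) (auto simp: \<eta>_def)
    also have "\<dots> = 1 / 2" using Z by simp
    finally show ?thesis .
  qed
  \<comment> \<open>The sum over \<open>G\<close> is finite, so its half on the right can be
    absorbed, which doubles the sum over \<open>F\<close>; \<open>F\<close> does not depend on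
    \<open>G\<close>.\<close>
  have "(\<Sum>g\<in>G. ?P g) \<le> 2 * (\<Sum>g\<in>F. ?P g)"
    if G: "finite G" "G \<subseteq> \<Gamma>" and down: "\<And>a g. a \<in> \<Gamma> \<Longrightarrow> g \<in> G \<Longrightarrow> cond_number a \<le> cond_number g \<Longrightarrow> a \<in> G" for G
  proof -
    define Gi where "Gi i = {g \<in> G. pact w g p \<in> W i}" for i
    have sub: "G \<subseteq> F \<union> (\<Union>i\<in>I. Gi i)"
    proof
      fix g assume g: "g \<in> G"
      then have "g \<in> \<Gamma>" using G by blast
      then have "pact w g p \<in> C" using pact_C[of g] p_C by blast
      then have "pact w g p \<in> closure C" using closure_subset[of C] by blast
      then show "g \<in> F \<union> (\<Union>i\<in>I. Gi i)"
        using g \<open>g \<in> \<Gamma>\<close> unfolding F_def Gi_def by blast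
    qed
    have finGi: "finite (Gi i)" for i using G(1) by (simp add: Gi_def)
    have inner: "(\<Sum>g\<in>Gi i. ?P g) \<le> E powr (s / 2) * ?P (a i) * (\<Sum>g\<in>G. ?P g)"
      if "i \<in> I" for i
    proof -
      have iJ: "i \<in> J" using that I by blast
      have ai: "a i \<in> \<Gamma>" using a[OF iJ] .
      have da: "det (a i) \<noteq> 0" using det_1[OF ai] by simp
      define m where "m g = matrix_inv (a i) ** g" for g :: "real^'n^'n"
      have mem: "m g \<in> G" and bd: "?P g \<le> E powr (s / 2) * ?P (a i) * ?P (m g)"
        if g: "g \<in> Gi i" for g
      proof -
        have g\<Gamma>: "g \<in> \<Gamma>" and gG: "g \<in> G" and gW: "\<phi> i \<bullet> pact w g p < R * (r i)\<^sup>2"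
          using g G by (auto simp: Gi_def W_def)
        have m\<Gamma>: "m g \<in> \<Gamma>" unfolding m_def by (intro mult_in inv_in ai g\<Gamma>)
        have sm: "cond_number (a i) * cond_number (m g) \<le> E * cond_number g"
          unfolding m_def by (rule super'[OF iJ g\<Gamma> gW])
        have pos: "0 < cond_number (a i)" "0 < cond_number (m g)" "0 < cond_number g"
          using cond_number_pos ai m\<Gamma> g\<Gamma> by auto
        \<comment> \<open>Ensures that passing from g to a_i^-1 g does not increase
          \<open>cond_number\<close>, so that \<open>down\<close> applies.\<close>
        have "E \<le> cond_number (a i)"
        proof -
          have "(r i)\<^sup>2 \<le> (sqrt (c / E))\<^sup>2"
            using r[of i] r\<theta>[of i] \<theta>(4) by (intro power_mono) auto
          then have "(r i)\<^sup>2 \<le> c / E" using c E by simp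
          then have "E \<le> c / (r i)\<^sup>2" using E r[of i] by (simp add: field_simps)
          then show ?thesis using cond_number_a[OF iJ] by linarith
        qed
        then have "E * cond_number (m g) \<le> cond_number (a i) * cond_number (m g)"
          using pos by (intro mult_right_mono) auto
        then have "E * cond_number (m g) \<le> E * cond_number g" using sm by linarith
        then have "cond_number (m g) \<le> cond_number g" using E by simp
        then show "m g \<in> G" using down[OF m\<Gamma> gG] by blast
        have "cond_number (a i) * cond_number (m g) / E \<le> cond_number g"
          using sm E by (simp add: pos_divide_le_eq mult.commute)
        then have "?P g \<le> (cond_number (a i) * cond_number (m g) / E) powr (- (s / 2))"
          using pos E s by (intro powr_mono2') auto
        also have "\<dots> = E powr (s / 2) * ?P (a i) * ?P (m g)"
          using pos E by (simp add: powr_divide powr_mult powr_minus field_simps)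
        finally show "?P g \<le> E powr (s / 2) * ?P (a i) * ?P (m g)" .
      qed
      have inj: "inj_on m (Gi i)"
      proof (rule inj_onI)
        fix g g' assume "m g = m g'"
        then have "a i ** (matrix_inv (a i) ** g) = a i ** (matrix_inv (a i) ** g')" by (simp add: m_def)
        then show "g = g'" by (simp only: matrix_mul_assoc matrix_inv_cancel(1)[OF da] matrix_mul_lid)
      qed
      have "(\<Sum>g\<in>Gi i. ?P g) \<le> (\<Sum>g\<in>Gi i. E powr (s / 2) * ?P (a i) * ?P (m g))"
        by (rule sum_mono) (rule bd)
      also have "\<dots> = E powr (s / 2) * ?P (a i) * (\<Sum>g\<in>Gi i. ?P (m g))"
        by (simp only: sum_distrib_left)
      also have "(\<Sum>g\<in>Gi i. ?P (m g)) = (\<Sum>g\<in>m ` Gi i. ?P g)"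
        using inj by (simp add: sum.reindex)
      also have "E powr (s / 2) * ?P (a i) * \<dots> \<le> E powr (s / 2) * ?P (a i) * (\<Sum>g\<in>G. ?P g)"
        using mem G(1) by (intro mult_left_mono sum_mono2) auto
      finally show ?thesis .
    qed
    have "(\<Sum>g\<in>G. ?P g) \<le> (\<Sum>g\<in>F \<union> (\<Union>i\<in>I. Gi i). ?P g)"
      using sub finF I(2) finGi by (intro sum_mono2) auto
    also have "\<dots> \<le> (\<Sum>g\<in>F. ?P g) + (\<Sum>g\<in>(\<Union>i\<in>I. Gi i). ?P g)"
    proof -
      have "(\<Sum>g\<in>F \<union> (\<Union>i\<in>I. Gi i). ?P g) + (\<Sum>g\<in>F \<inter> (\<Union>i\<in>I. Gi i). ?P g)
          = (\<Sum>g\<in>F. ?P g) + (\<Sum>g\<in>(\<Union>i\<in>I. Gi i). ?P g)"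
        using finF I(2) finGi by (intro sum.union_inter) auto
      moreover have "0 \<le> (\<Sum>g\<in>F \<inter> (\<Union>i\<in>I. Gi i). ?P g)"
        by (intro sum_nonneg) simp
      ultimately show ?thesis by linarith
    qed
    also have "(\<Sum>g\<in>(\<Union>i\<in>I. Gi i). ?P g) \<le> (\<Sum>i\<in>I. \<Sum>g\<in>Gi i. ?P g)"
      using I(2) finGi by (intro sum_UN_le) auto
    also have "(\<Sum>i\<in>I. \<Sum>g\<in>Gi i. ?P g) \<le> (\<Sum>i\<in>I. E powr (s / 2) * ?P (a i) * (\<Sum>g\<in>G. ?P g))"
      by (rule sum_mono) (rule inner)
    also have "\<dots> = (\<Sum>i\<in>I. E powr (s / 2) * ?P (a i)) * (\<Sum>g\<in>G. ?P g)"
      by (simp only: sum_distrib_right)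
    also have "\<dots> \<le> 1 / 2 * (\<Sum>g\<in>G. ?P g)"
      using sumP by (intro mult_right_mono sum_nonneg) auto
    finally show ?thesis by simp
  qed
  then show ?thesis using that by blast
qed

text \<open>Sublevel sets of \<open>cond_number\<close> are finite and closed downwards, hence
  admissible truncations, and the uniform bound at s / 2 feeds \<open>crit_exp_le\<close>.\<close>

theorem hausdorff_dim_lower: "2 * delta1n \<Gamma> \<le> hausdorff_dim pdist2 (sym_boundary_image U C)"
  unfolding hausdorff_dim_def
proof (rule INF_greatest)
  fix s :: real assume "s \<in> {s. 0 < s \<and> hausdorff_measure pdist2 s (sym_boundary_image U C) = 0}"
  then have s: "0 < s" and zero: "hausdorff_measure pdist2 s (sym_boundary_image U C) = 0" by auto
  obtain B where B: "\<And>G. finite G \<Longrightarrow> G \<subseteq> \<Gamma> \<Longrightarrow>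
      (\<And>a g. a \<in> \<Gamma> \<Longrightarrow> g \<in> G \<Longrightarrow> cond_number a \<le> cond_number g \<Longrightarrow> a \<in> G) \<Longrightarrow> (\<Sum>g\<in>G. cond_number g powr (- (s / 2))) \<le> B"
    using poincare_series_bounded[OF zero s] by blast
  define f where "f g = mu 1 g - mu CARD('n) g" for g :: "real^'n^'n"
  have ef: "exp (f g) = cond_number g" if "g \<in> \<Gamma>" for g
    using exp_mu_diff[OF _ card_ge_2, of g] det_1[OF that] by (simp add: f_def)
  have le_iff: "f g \<le> t \<longleftrightarrow> cond_number g \<le> exp t"
    if "g \<in> \<Gamma>" for g t
    using ef[OF that] by (metis exp_le_cancel_iff)
  have fin: "finite {g \<in> \<Gamma>. f g \<le> t}" for t
    using finite_cond_number_le[of "exp t"] by (rule rev_finite_subset) (use le_iff in blast)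
  have "crit_exp \<Gamma> f \<le> ereal (s / 2)"
  proof (rule crit_exp_le[OF fin])
    fix t
    have "(\<Sum>g | g \<in> \<Gamma> \<and> f g \<le> t. exp (- (s / 2) * f g)) = (\<Sum>g | g \<in> \<Gamma> \<and> f g \<le> t. cond_number g powr (- (s / 2)))"
    proof (rule sum.cong[OF refl])
      fix g assume "g \<in> {g \<in> \<Gamma>. f g \<le> t}"
      then have "cond_number g = exp (f g)" using ef by simp
      then show "exp (- (s / 2) * f g) = cond_number g powr (- (s / 2))"
        by (simp add: exp_powr_real mult.commute)
    qed
    also have "\<dots> \<le> B"
    proof (rule B[OF fin])
      fix a g assume ag: "a \<in> \<Gamma>" "g \<in> {g \<in> \<Gamma>. f g \<le> t}" "cond_number a \<le> cond_number g"
      then have "f a \<le> f g"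
        using ef[of a] ef[of g] by (metis (no_types, lifting) exp_le_cancel_iff mem_Collect_eq)
      then show "a \<in> {g \<in> \<Gamma>. f g \<le> t}" using ag by auto
    qed auto
    finally show "(\<Sum>g | g \<in> \<Gamma> \<and> f g \<le> t. exp (- (s / 2) * f g)) \<le> B" .
  qed (use s in simp)
  then have "delta1n \<Gamma> \<le> ereal (s / 2)" by (simp add: delta1n_def f_def[abs_def])
  then have "2 * delta1n \<Gamma> \<le> 2 * ereal (s / 2)" by (rule ereal_mult_left_mono) simp
  then show "2 * delta1n \<Gamma> \<le> ereal s" by simp
qed

end

theorem theorem1p1:
  fixes \<Gamma> :: "(real^'n^'n) set" and w :: "real^'n" and U C :: "(real^'n) set"
  assumes "CARD('n) \<ge> 2"
    and "discrete_subgroup_SL \<Gamma>"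
    and "spcc_data \<Gamma> w U C"
  shows "2 * delta1n \<Gamma> \<le> hausdorff_dim pdist2 (sym_boundary_image U C)
         \<and> hausdorff_dim pdist2 (sym_boundary_image U C) \<le> delta12 \<Gamma>"
proof -
  obtain K where K: "compact K" "K \<subseteq> C" "C \<subseteq> (\<Union>g\<in>\<Gamma>. pact w g ` K)"
    using assms(3) by (auto simp: spcc_data_def)
  \<comment> \<open>\<open>C\<close> may span a smaller affine subspace, so only its relative
    interior is sure to be nonempty.\<close>
  have "rel_interior C \<noteq> {}"
    using assms(3) rel_interior_eq_empty[of C] by (simp add: spcc_data_def)
  then obtain p where p: "p \<in> rel_interior C" by blast
  interpret convex_cocompact w U \<Gamma> C K p
  proof
    show "properly_convex_chart w U" using assms(3) by (simp add: spcc_data_def)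
  qed (use assms K p in auto)
  show ?thesis using hausdorff_dim_lower hausdorff_dim_upper by blast
qed

end
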